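(* Suppose the linear independence, set-$B$, projection and Hölder conditions (defined in the context) hold. Then for each $\alpha\in U$ the family of transition functions $\{P_t^\alpha\}$ on $\mathbb{X}$, $P_t^\alpha(\xi,A)=\mathbb{P}(\Xi^{\alpha,\xi}(t)\in A)$ for $t\ge 0$, $\xi\in\mathbb{X}$, $A\in\mathcal{B}(\mathbb{X})$, of the joint process is Markovian and Feller continuous; that is, (Markovian) for every bounded measurable $\zeta:\mathbb{X}\to\mathbb{R}$ and all $s,t>0$, the joint process $\Xi$ associated with $\alpha$ satisfies $\mathbb{E}[\zeta(\Xi(s+t))\mid\mathcal{F}_s]=\mathbb{E}[\zeta(\Xi(s+t))\mid\Xi(s)]$; and (Feller) for every bounded continuous $\zeta:\mathbb{X}\to\mathbb{R}$ and every $t>0$, the map $\xi\mapsto (P_t^\alpha\zeta)(\xi)=\int_{\mathbb{X}}\zeta(\tilde\xi)P_t^\alpha(\xi,d\tilde\xi)$ is continuous on $\mathbb{X}$.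
   Context: Geometry. $J\in\mathbb{N}$, $\mathcal{I}=\{1,\dots,J\}$; $n_1,\dots,n_J\in\mathbb{R}^J$ are linearly independent unit vectors; $G=\{x\in\mathbb{R}^J:\langle x,n_i\rangle\ge0\ \forall i\in\mathcal{I}\}$ with interior $G^\circ$; $F_i=\{x\in\partial G:\langle x,n_i\rangle=0\}$; $\mathcal{I}(x)=\{i\in\mathcal{I}:x\in F_i\}$ for $x\in G$. $U\subset\mathbb{R}$ is open; for each $i\in\mathcal{I}$, $d_i:U\to\mathbb{R}^J$ is continuously differentiable with $\langle d_i(\alpha),n_i\rangle=1$ for all $\alpha$. $R(\alpha)$ is the $J\times J$ matrix with columns $d_1(\alpha),\dots,d_J(\alpha)$. $\mathrm{cone}(E)$ is the set of finite nonnegative linear combinations of elements of $E$; $\mathrm{cone}(\emptyset)=\mathrm{span}(\emptyset)=\{0\}$. $d(\alpha,x)=\mathrm{cone}(\{d_i(\alpha):i\in\mathcal{I}(x)\})$ for $x\in G$ (so $\{0\}$ if $x\in G^\circ$). $\mathbb{H}_x=\{y\in\mathbb{R}^J:\langle y,n_i\rangle=0\ \forall i\in\mathcal{I}(x)\}$ (so $\mathbb{R}^J$ if $x\in G^\circ$). Conditions. Linear independence condition: for each $\alpha\in U$, $\{d_i(\alpha)\}_{i\in\mathcal{I}}$ is linearly independent. Set-$B$ condition: for each $\alpha\in U$ there are $\theta(\alpha)>0$ and a compact, convex, symmetric set $B^\alpha\subset\mathbb{R}^J$ with $0$ in its interior such that for every $i\in\mathcal{I}$: if $z\in\partial B^\alpha$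 and $|\langle z,n_i\rangle|<\theta(\alpha)$ then $\langle\nu,d_i(\alpha)\rangle=0$ for every unit vector $\nu$ with $\langle\nu,y-z\rangle\ge0$ for all $y\in B^\alpha$; moreover $\alpha\mapsto B^\alpha$ is continuous in the Hausdorff metric. Projection condition: for each $\alpha\in U$ there is $\pi^\alpha:\mathbb{R}^J\to G$ with $\pi^\alpha(x)=x$ for $x\in G$ and $\pi^\alpha(x)-x\in d(\alpha,\pi^\alpha(x))$ for $x\notin G$. Coefficients. $a$ is a continuously differentiable map from $U$ to the symmetric positive-definite $J\times J$ matrices, $b:U\to\mathbb{R}^J$ is continuously differentiable, $\sigma(\alpha)$ is the unique symmetric positive-definite square root of $a(\alpha)$; primes denote derivatives in $\alpha$. Hölder condition: there are $\kappa'<\infty$, $\gamma\in(0,1]$ with $|b'(\alpha)-b'(\tilde\alpha)|+\|\sigma'(\alpha)-\sigma'(\tilde\alpha)\|+\|R'(\alpha)-R'(\tilde\alpha)\|\le\kappa'|\alpha-\tilde\alpha|^\gamma$ for all $\alpha,\tilde\alpha\in U$. Processes. $(\Omega,\mathcal{F},\{\mathcal{F}_t\},\mathbb{P})$ is a filtered probability space satisfying the usual conditions, $W$ a $J$-dimensional $\{\mathcal{F}_t\}$-Brownian motion started at $0$. An RBM associated with $\alpha$ is a continuous $\{\mathcal{F}_t\}$-adapted process $Z^\alpha$ such that a.s. for all $t\ge0$, $Z^\alpha(t)\in G$ and $Z^\alpha(t)=Z^\alpha(0)+b(\alpha)t+\sigma(\alpha)W(t)+Y^\alpha(t)$, where $Y^\alpha$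 is continuous, adapted and a.s. $Y^\alpha(t)-Y^\alpha(s)\in\mathrm{cone}[\bigcup_{u\in(s,t]}d(\alpha,Z^\alpha(u))]$ for all $0\le s<t$. Put $L^\alpha=R(\alpha)^{-1}Y^\alpha$. A derivative process along $Z^\alpha$ is a right-continuous with left limits (RCLL) adapted $\mathbb{R}^J$-valued process $\mathcal{J}^\alpha$ such that a.s. for all $t\ge0$, $\mathcal{J}^\alpha(t)\in\mathbb{H}_{Z^\alpha(t)}$ and $\mathcal{J}^\alpha(t)=\mathcal{J}^\alpha(0)+b'(\alpha)t+\sigma'(\alpha)W(t)+R'(\alpha)L^\alpha(t)+\mathcal{K}^\alpha(t)$, where $\mathcal{K}^\alpha$ is RCLL, adapted, $\mathcal{K}^\alpha(0)=0$ and a.s. $\mathcal{K}^\alpha(t)-\mathcal{K}^\alpha(s)\in\mathrm{span}[\bigcup_{u\in(s,t]}d(\alpha,Z^\alpha(u))]$ for all $0\le s<t$. It is known that under the four conditions, for $\alpha\in U$, $x\in G$, $y\in\mathbb{H}_x$, there are a pathwise unique RBM $Z^{\alpha,x}$ with $Z^{\alpha,x}(0)=x$ and, with $\xi=(x,y)$, a pathwise unique derivative process $\mathcal{J}^{\alpha,\xi}$ along $Z^{\alpha,x}$ with $\mathcal{J}^{\alpha,\xi}(0)=y$. The joint process is $\Xi^{\alpha,\xi}=(Z^{\alpha,x},\mathcal{J}^{\alpha,\xi})$, taking values in $\mathbb{X}=\bigcup_{x\in G}(\{x\}\times\mathbb{H}_x)\subseteq G\times\mathbb{R}^J$ (with the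 subspace topology). *)

theory Defs
  imports "HOL-Probability.Probability"
begin

text \<open>
  The finite type \<open>'n\<close> serves both as the index set of the faces and as the coordinate set,
  so \<open>J = CARD('n)\<close>. Throughout, \<open>n i\<close> is the normal of the \<open>i\<close>-th face and \<open>d i \<alpha>\<close> the
  \<open>i\<close>-th direction of reflection at the parameter \<open>\<alpha>\<close>. Time is \<open>t \<ge> 0\<close> in the type \<open>real\<close>;
  no condition concerns negative times.
\<close>

section \<open>Geometry\<close>

text \<open>Linear independence of an indexed family; without injectivity the range of a family
  with repetitions could still be an independent set.\<close>

definition lin_indep_family :: "('i \<Rightarrow> 'v::real_vector) \<Rightarrow> bool" where
  "lin_indep_family v \<longleftrightarrow> inj v \<and> independent (range v)"

definition polycone :: "('n::finite \<Rightarrow> real^'n) \<Rightarrow> (real^'n) set" where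
  "polycone n = {x. \<forall>i. 0 \<le> x \<bullet> n i}"

definition face :: "('n::finite \<Rightarrow> real^'n) \<Rightarrow> 'n \<Rightarrow> (real^'n) set" where
  "face n i = {x \<in> frontier (polycone n). x \<bullet> n i = 0}"

definition active :: "('n::finite \<Rightarrow> real^'n) \<Rightarrow> real^'n \<Rightarrow> 'n set" where
  "active n x = {i. x \<in> face n i}"

definition refl_matrix :: "('n::finite \<Rightarrow> real \<Rightarrow> real^'n) \<Rightarrow> real \<Rightarrow> real^'n^'n" where
  "refl_matrix d \<alpha> = (\<chi> k i. d i \<alpha> $ k)"

text \<open>The set of finite nonnegative linear combinations of elements of \<open>E\<close> is
  \<open>convex_cone hull E\<close>, which is \<open>{0}\<close> for empty \<open>E\<close>.\<close>

lemma convex_cone_hull_explicit: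
  fixes E :: "'v::real_vector set"
  shows "convex_cone hull E =
    {\<Sum>v\<in>T. c v *\<^sub>R v | T c. finite T \<and> T \<subseteq> E \<and> (\<forall>v\<in>T. (0::real) \<le> c v)}"
    (is "_ = ?C")
proof (rule hull_unique)
  have I: "(\<Sum>v\<in>T. c v *\<^sub>R v) \<in> ?C" if "finite T" "T \<subseteq> E" "\<And>v. v \<in> T \<Longrightarrow> 0 \<le> c v" for T c
    using that by blast
  show "E \<subseteq> ?C"
  proof
    fix v assume "v \<in> E"
    then show "v \<in> ?C"
      using I[of "{v}" "\<lambda>_. 1"] by simp
  qed
  have zero: "0 \<in> ?C"
    using I[of "{}"] by simp
  have scale: "r *\<^sub>R x \<in> ?C" if x: "x \<in> ?C" and r: "0 \<le> r" for r x
  proof -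
    from x obtain T c where T: "finite T" "T \<subseteq> E" "\<forall>v\<in>T. 0 \<le> c v" "x = (\<Sum>v\<in>T. c v *\<^sub>R v)"
      by (elim CollectE exE conjE)
    have "r *\<^sub>R x = (\<Sum>v\<in>T. (r * c v) *\<^sub>R v)"
      by (simp only: T(4) scaleR_sum_right scaleR_scaleR)
    then show ?thesis
      using I[of T "\<lambda>v. r * c v"] T(1-3) r by simp
  qed
  have add: "x + y \<in> ?C" if x: "x \<in> ?C" and y: "y \<in> ?C" for x y
  proof -
    from x obtain S b where S: "finite S" "S \<subseteq> E" "\<forall>v\<in>S. 0 \<le> b v" "x = (\<Sum>v\<in>S. b v *\<^sub>R v)"
      by (elim CollectE exE conjE)
    from y obtain T c where T: "finite T" "T \<subseteq> E" "\<forall>v\<in>T. 0 \<le> c v" "y = (\<Sum>v\<in>T. c v *\<^sub>R v)"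
      by (elim CollectE exE conjE)
    define e where "e = (\<lambda>v. (if v \<in> S then b v else 0) + (if v \<in> T then c v else 0))"
    have "x = (\<Sum>v\<in>S \<union> T. (if v \<in> S then b v else 0) *\<^sub>R v)"
      unfolding S(4) using S(1) T(1) by (intro sum.mono_neutral_cong_left) auto
    moreover have "y = (\<Sum>v\<in>S \<union> T. (if v \<in> T then c v else 0) *\<^sub>R v)"
      unfolding T(4) using S(1) T(1) by (intro sum.mono_neutral_cong_left) auto
    ultimately have "x + y = (\<Sum>v\<in>S \<union> T. e v *\<^sub>R v)"
      by (simp only: e_def scaleR_add_left sum.distrib)
    moreover have "0 \<le> e v" for v
      using S(3) T(3) by (simp add: e_def)
    ultimately show ?thesis
      using I[of "S \<union> T" e] S(1,2) T(1,2) by simp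
  qed
  show "convex_cone ?C"
    unfolding convex_cone_iff by (intro conjI ballI allI impI zero add scale)
  fix K assume K: "E \<subseteq> K" "convex_cone K"
  show "?C \<subseteq> K"
  proof
    fix x assume "x \<in> ?C"
    then obtain T c where T: "finite T" "T \<subseteq> E" "\<forall>v\<in>T. 0 \<le> c v" "x = (\<Sum>v\<in>T. c v *\<^sub>R v)"
      by (elim CollectE exE conjE)
    from T(1-3) have "(\<Sum>v\<in>T. c v *\<^sub>R v) \<in> K"
    proof (induction T rule: finite_induct)
      case empty
      show ?case
        using K(2) by (simp add: convex_cone_contains_0)
    next
      case (insert v T)
      then have "c v *\<^sub>R v \<in> K"
        using K by (intro convex_cone_scaleR) auto
      moreover have "(\<Sum>v\<in>T. c v *\<^sub>R v) \<in> K"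
        using insert by simp
      ultimately show ?case
        using insert(1,2) K(2) by (simp add: convex_cone_add)
    qed
    then show "x \<in> K"
      by (simp only: T(4))
  qed
qed

definition refl_cone ::
  "('n::finite \<Rightarrow> real^'n) \<Rightarrow> ('n \<Rightarrow> real \<Rightarrow> real^'n) \<Rightarrow> real \<Rightarrow> real^'n \<Rightarrow> (real^'n) set" where
  "refl_cone n d \<alpha> x = convex_cone hull ((\<lambda>i. d i \<alpha>) ` active n x)"

definition face_space :: "('n::finite \<Rightarrow> real^'n) \<Rightarrow> real^'n \<Rightarrow> (real^'n) set" where
  "face_space n x = {y. \<forall>i\<in>active n x. y \<bullet> n i = 0}"

definition state_space :: "('n::finite \<Rightarrow> real^'n) \<Rightarrow> ((real^'n) \<times> (real^'n)) set" where
  "state_space n = (\<Union>x\<in>polycone n. {x} \<times> face_space n x)"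

section \<open>Data and conditions\<close>

definition pos_def_sym :: "real^'n^'n \<Rightarrow> bool" where
  "pos_def_sym A \<longleftrightarrow> transpose A = A \<and> (\<forall>x. x \<noteq> 0 \<longrightarrow> 0 < x \<bullet> (A *v x))"

definition pd_sqrt :: "real^'n^'n \<Rightarrow> real^'n^'n" where
  "pd_sqrt A = (THE S. pos_def_sym S \<and> S ** S = A)"

definition rbm_data ::
  "('n::finite \<Rightarrow> real^'n) \<Rightarrow> real set \<Rightarrow> ('n \<Rightarrow> real \<Rightarrow> real^'n) \<Rightarrow>
   (real \<Rightarrow> real^'n^'n) \<Rightarrow> (real \<Rightarrow> real^'n) \<Rightarrow> bool" where
  "rbm_data n U d a b \<longleftrightarrow>
     lin_indep_family n \<and> (\<forall>i. norm (n i) = 1) \<and>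
     open U \<and>
     (\<forall>i. d i C1_differentiable_on U \<and> (\<forall>\<alpha>\<in>U. d i \<alpha> \<bullet> n i = 1)) \<and>
     a C1_differentiable_on U \<and> (\<forall>\<alpha>\<in>U. pos_def_sym (a \<alpha>)) \<and>
     b C1_differentiable_on U"

definition linear_independence_condition ::
  "real set \<Rightarrow> ('n::finite \<Rightarrow> real \<Rightarrow> real^'n) \<Rightarrow> bool" where
  "linear_independence_condition U d \<longleftrightarrow> (\<forall>\<alpha>\<in>U. lin_indep_family (\<lambda>i. d i \<alpha>))"

text \<open>The Hausdorff metric, to be used for nonempty compact sets only.\<close>

definition hausdorff_distance :: "'v::metric_space set \<Rightarrow> 'v set \<Rightarrow> real" where
  "hausdorff_distance A B = max (SUP x\<in>A. infdist x B) (SUP y\<in>B. infdist y A)"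

definition set_B_condition ::
  "('n::finite \<Rightarrow> real^'n) \<Rightarrow> real set \<Rightarrow> ('n \<Rightarrow> real \<Rightarrow> real^'n) \<Rightarrow> bool" where
  "set_B_condition n U d \<longleftrightarrow>
     (\<exists>(\<theta> :: real \<Rightarrow> real) (B :: real \<Rightarrow> (real^'n) set).
        (\<forall>\<alpha>\<in>U. 0 < \<theta> \<alpha> \<and>
           compact (B \<alpha>) \<and> convex (B \<alpha>) \<and> (\<forall>x\<in>B \<alpha>. - x \<in> B \<alpha>) \<and> 0 \<in> interior (B \<alpha>) \<and>
           (\<forall>i. \<forall>z\<in>frontier (B \<alpha>). \<bar>z \<bullet> n i\<bar> < \<theta> \<alpha> \<longrightarrow>
              (\<forall>\<nu>. norm \<nu> = 1 \<and> (\<forall>y\<in>B \<alpha>. 0 \<le> \<nu> \<bullet> (y - z)) \<longrightarrow> \<nu> \<bullet> d i \<alpha> = 0))) \<and>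
        (\<forall>\<alpha>\<in>U. ((\<lambda>\<beta>. hausdorff_distance (B \<beta>) (B \<alpha>)) \<longlongrightarrow> 0) (at \<alpha> within U)))"

definition projection_condition ::
  "('n::finite \<Rightarrow> real^'n) \<Rightarrow> real set \<Rightarrow> ('n \<Rightarrow> real \<Rightarrow> real^'n) \<Rightarrow> bool" where
  "projection_condition n U d \<longleftrightarrow>
     (\<forall>\<alpha>\<in>U. \<exists>\<pi>. (\<forall>x. \<pi> x \<in> polycone n) \<and> (\<forall>x\<in>polycone n. \<pi> x = x) \<and>
        (\<forall>x. x \<notin> polycone n \<longrightarrow> \<pi> x - x \<in> refl_cone n d \<alpha> (\<pi> x)))"

text \<open>The matrix norm is the Frobenius norm; as \<open>\<kappa>\<close> is existentially quantified, the choice of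
  the norm does not matter.\<close>

definition hoelder_condition ::
  "real set \<Rightarrow> ('n::finite \<Rightarrow> real \<Rightarrow> real^'n) \<Rightarrow> (real \<Rightarrow> real^'n^'n) \<Rightarrow> (real \<Rightarrow> real^'n) \<Rightarrow> bool"
where
  "hoelder_condition U d a b \<longleftrightarrow>
     (\<exists>\<kappa> \<gamma> :: real. 0 < \<gamma> \<and> \<gamma> \<le> 1 \<and>
        (\<forall>\<alpha>\<in>U. \<forall>\<beta>\<in>U.
           norm (vector_derivative b (at \<alpha>) - vector_derivative b (at \<beta>)) +
           norm (vector_derivative (\<lambda>u. pd_sqrt (a u)) (at \<alpha>) -
                 vector_derivative (\<lambda>u. pd_sqrt (a u)) (at \<beta>)) +
           norm (vector_derivative (refl_matrix d) (at \<alpha>) -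
                 vector_derivative (refl_matrix d) (at \<beta>))
           \<le> \<kappa> * \<bar>\<alpha> - \<beta>\<bar> powr \<gamma>))"

section \<open>Processes\<close>

definition usual_conditions :: "'w measure \<Rightarrow> (real \<Rightarrow> 'w measure) \<Rightarrow> bool" where
  "usual_conditions M F \<longleftrightarrow>
     (\<forall>t\<ge>0. subalgebra M (F t)) \<and>
     (\<forall>s\<ge>0. \<forall>t\<ge>s. sets (F s) \<subseteq> sets (F t)) \<and>
     (\<forall>t\<ge>0. sets (F t) = (\<Inter>u\<in>{t<..}. sets (F u))) \<and>
     complete_measure M \<and> null_sets M \<subseteq> sets (F 0)"

definition adapted ::
  "(real \<Rightarrow> 'w measure) \<Rightarrow> (real \<Rightarrow> 'w \<Rightarrow> 'v::topological_space) \<Rightarrow> bool" where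
  "adapted F X \<longleftrightarrow> (\<forall>t\<ge>0. X t \<in> borel_measurable (F t))"

text \<open>The increments are centred Gaussian vectors with covariance \<open>(t - s)\<close> times the identity,
  i.e. their components are independent centred normal variables with variance \<open>t - s\<close>.\<close>

definition brownian_motion ::
  "'w measure \<Rightarrow> (real \<Rightarrow> 'w measure) \<Rightarrow> (real \<Rightarrow> 'w \<Rightarrow> real^'n::finite) \<Rightarrow> bool" where
  "brownian_motion M F W \<longleftrightarrow>
     adapted F W \<and>
     (AE \<omega> in M. W 0 \<omega> = 0) \<and>
     (AE \<omega> in M. continuous_on {0..} (\<lambda>t. W t \<omega>)) \<and>
     (\<forall>s\<ge>0. \<forall>t>s.
        prob_space.indep_set M (sets (F s))
          (sets (vimage_algebra (space M) (\<lambda>\<omega>. W t \<omega> - W s \<omega>) borel)) \<and>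
        prob_space.indep_vars M (\<lambda>_. borel) (\<lambda>i \<omega>. (W t \<omega> - W s \<omega>) $ i) UNIV \<and>
        (\<forall>i. distributed M lborel (\<lambda>\<omega>. (W t \<omega> - W s \<omega>) $ i) (normal_density 0 (sqrt (t - s)))))"

text \<open>Path properties of processes are understood almost surely.

  \<open>reflected_bm M F W n d a b \<alpha> Z Y\<close>: the process \<open>Z\<close> is a reflected Brownian motion associated
  with \<open>\<alpha>\<close>, and \<open>Y\<close> is its (by the first equation almost surely unique) pushing process.\<close>

definition reflected_bm ::
  "'w measure \<Rightarrow> (real \<Rightarrow> 'w measure) \<Rightarrow> (real \<Rightarrow> 'w \<Rightarrow> real^'n::finite) \<Rightarrow>
   ('n \<Rightarrow> real^'n) \<Rightarrow> ('n \<Rightarrow> real \<Rightarrow> real^'n) \<Rightarrow>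
   (real \<Rightarrow> real^'n^'n) \<Rightarrow> (real \<Rightarrow> real^'n) \<Rightarrow> real \<Rightarrow>
   (real \<Rightarrow> 'w \<Rightarrow> real^'n) \<Rightarrow> (real \<Rightarrow> 'w \<Rightarrow> real^'n) \<Rightarrow> bool" where
  "reflected_bm M F W n d a b \<alpha> Z Y \<longleftrightarrow>
     adapted F Z \<and> (AE \<omega> in M. continuous_on {0..} (\<lambda>t. Z t \<omega>)) \<and>
     adapted F Y \<and> (AE \<omega> in M. continuous_on {0..} (\<lambda>t. Y t \<omega>)) \<and>
     (AE \<omega> in M. \<forall>t\<ge>0. Z t \<omega> \<in> polycone n \<and>
        Z t \<omega> = Z 0 \<omega> + t *\<^sub>R b \<alpha> + pd_sqrt (a \<alpha>) *v W t \<omega> + Y t \<omega>) \<and>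
     (AE \<omega> in M. \<forall>s\<ge>0. \<forall>t>s.
        Y t \<omega> - Y s \<omega> \<in> convex_cone hull (\<Union>u\<in>{s<..t}. refl_cone n d \<alpha> (Z u \<omega>)))"

definition rcll :: "(real \<Rightarrow> 'v::topological_space) \<Rightarrow> bool" where
  "rcll f \<longleftrightarrow> (\<forall>t\<ge>0. (f \<longlongrightarrow> f t) (at_right t)) \<and> (\<forall>t>0. \<exists>l. (f \<longlongrightarrow> l) (at_left t))"

text \<open>In the next definition \<open>D\<close> is the derivative process along \<open>Z\<close>, where \<open>Y\<close> is the pushing
  process of \<open>Z\<close>, so that \<open>matrix_inv (refl_matrix d \<alpha>) *v Y t \<omega>\<close> is the local time process \<open>L\<close>.\<close>

definition derivative_process ::
  "'w measure \<Rightarrow> (real \<Rightarrow> 'w measure) \<Rightarrow> (real \<Rightarrow> 'w \<Rightarrow> real^'n::finite) \<Rightarrow>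
   ('n \<Rightarrow> real^'n) \<Rightarrow> ('n \<Rightarrow> real \<Rightarrow> real^'n) \<Rightarrow>
   (real \<Rightarrow> real^'n^'n) \<Rightarrow> (real \<Rightarrow> real^'n) \<Rightarrow> real \<Rightarrow>
   (real \<Rightarrow> 'w \<Rightarrow> real^'n) \<Rightarrow> (real \<Rightarrow> 'w \<Rightarrow> real^'n) \<Rightarrow> (real \<Rightarrow> 'w \<Rightarrow> real^'n) \<Rightarrow> bool" where
  "derivative_process M F W n d a b \<alpha> Z Y D \<longleftrightarrow>
     adapted F D \<and> (AE \<omega> in M. rcll (\<lambda>t. D t \<omega>)) \<and>
     (\<exists>K. adapted F K \<and> (AE \<omega> in M. rcll (\<lambda>t. K t \<omega>)) \<and> (AE \<omega> in M. K 0 \<omega> = 0) \<and>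
        (AE \<omega> in M. \<forall>t\<ge>0. D t \<omega> \<in> face_space n (Z t \<omega>) \<and>
           D t \<omega> = D 0 \<omega> + t *\<^sub>R vector_derivative b (at \<alpha>)
             + vector_derivative (\<lambda>u. pd_sqrt (a u)) (at \<alpha>) *v W t \<omega>
             + vector_derivative (refl_matrix d) (at \<alpha>) *v
                 (matrix_inv (refl_matrix d \<alpha>) *v Y t \<omega>)
             + K t \<omega>) \<and>
        (AE \<omega> in M. \<forall>s\<ge>0. \<forall>t>s.
           K t \<omega> - K s \<omega> \<in> span (\<Union>u\<in>{s<..t}. refl_cone n d \<alpha> (Z u \<omega>))))"

definition joint_process ::
  "'w measure \<Rightarrow> (real \<Rightarrow> 'w measure) \<Rightarrow> (real \<Rightarrow> 'w \<Rightarrow> real^'n::finite) \<Rightarrow>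
   ('n \<Rightarrow> real^'n) \<Rightarrow> ('n \<Rightarrow> real \<Rightarrow> real^'n) \<Rightarrow>
   (real \<Rightarrow> real^'n^'n) \<Rightarrow> (real \<Rightarrow> real^'n) \<Rightarrow> real \<Rightarrow>
   (real \<Rightarrow> 'w \<Rightarrow> real^'n) \<Rightarrow> (real \<Rightarrow> 'w \<Rightarrow> real^'n) \<Rightarrow> bool" where
  "joint_process M F W n d a b \<alpha> Z D \<longleftrightarrow>
     (\<exists>Y. reflected_bm M F W n d a b \<alpha> Z Y \<and> derivative_process M F W n d a b \<alpha> Z Y D)"

text \<open>
  A joint process is in \<open>state_space n\<close> only almost surely, and a test function \<open>\<zeta>\<close> is constrained
  on \<open>state_space n\<close> only. By completeness of the probability space the exceptional null sets
  are harmless both in \<open>\<zeta> \<circ> \<Xi> t\<close> below and in the image measure \<open>transition\<close>.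
\<close>

definition markov_property ::
  "'w measure \<Rightarrow> (real \<Rightarrow> 'w measure) \<Rightarrow> 's::topological_space set \<Rightarrow> (real \<Rightarrow> 'w \<Rightarrow> 's) \<Rightarrow> bool"
where
  "markov_property M F S \<Xi> \<longleftrightarrow>
     (\<forall>\<zeta> :: 's \<Rightarrow> real. \<zeta> \<in> borel_measurable (restrict_space borel S) \<and> bounded (\<zeta> ` S) \<longrightarrow>
        (\<forall>s>0. \<forall>t>0. AE \<omega> in M.
           real_cond_exp M (F s) (\<lambda>\<omega>'. \<zeta> (\<Xi> (s + t) \<omega>')) \<omega> =
           real_cond_exp M (vimage_algebra (space M) (\<Xi> s) borel) (\<lambda>\<omega>'. \<zeta> (\<Xi> (s + t) \<omega>')) \<omega>))"

text \<open>For \<open>A\<close> in the Borel sets of the subspace \<open>S\<close>, the measure of \<open>A\<close> under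
  \<open>transition M S \<Xi> t \<xi>\<close> is the probability that \<open>\<Xi> \<xi> t\<close> is in \<open>A\<close>.\<close>

definition transition ::
  "'w measure \<Rightarrow> 's::topological_space set \<Rightarrow> ('s \<Rightarrow> real \<Rightarrow> 'w \<Rightarrow> 's) \<Rightarrow> real \<Rightarrow> 's \<Rightarrow> 's measure"
where
  "transition M S \<Xi> t \<xi> = distr M (restrict_space borel S) (\<Xi> \<xi> t)"

definition feller_continuous ::
  "'s::topological_space set \<Rightarrow> (real \<Rightarrow> 's \<Rightarrow> 's measure) \<Rightarrow> bool" where
  "feller_continuous S P \<longleftrightarrow>
     (\<forall>\<zeta> :: 's \<Rightarrow> real. continuous_on S \<zeta> \<and> bounded (\<zeta> ` S) \<longrightarrow>
        (\<forall>t>0. continuous_on S (\<lambda>\<xi>. integral\<^sup>L (P t \<xi>) \<zeta>)))"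

end

theory Submission
  imports Defs
begin

text \<open>
  The multiples of \<open>B\<close> are invariant under the oblique projections onto the faces, which makes the
  Skorokhod and derivative problems Lipschitz. Hence an Euler scheme, which projects the
  reflected path by \<open>\<pi>\<close> and the derivative along all faces that are close to the new position,
  converges to the joint process in probability.

  The transition operators \<open>G\<close> of the Euler scheme do not depend on the joint process, and by independence of
  the Brownian increments the expectation of \<open>U * G (\<Xi> s)\<close> approximates that of \<open>U * f (\<Xi> (s + t))\<close> for all
  \<open>U\<close> measurable at time \<open>s\<close>. This gives the Markov property.

  For the Feller property, which is not a consequence of pathwise continuity since the derivative
  process is discontinuous in the starting point, wait a short time. By then the derivative process has hardly moved,
  because it stays close to \<open>y\<close> as long as \<open>Z\<close> hits no face inactive at \<open>x\<close>. The boundary has small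
  probability at some arbitrarily small time, and away from it a nearby starting point only shifts \<open>Z\<close> by
  a small vector, which the nondegenerate Gaussian increment makes invisible in total variation.
  As \<open>G\<close> is equicontinuous in the derivative variable only, nothing about its dependence on the position is needed.
\<close>

section \<open>Invariance of the set B\<close>

text \<open>The obstacle is that the derivative process is only right-continuous and may jump when
  \<open>Z\<close> reaches a face, so closeness of two positions says nothing about closeness of the
  derivatives. It also dictates the gauge: a step along the directions of some faces that ends near
  their hyperplanes cannot leave a given multiple of \<open>B\<close>, so errors do not accumulate
  over many steps, as they might in a norm where each projection costs a factor. Mesh and \<delta>
  are chosen from the modulus of continuity of the Brownian paths alone. The speed of convergence
  depends on the path and on the solution, but enters only through dominated convergence; hence one
  sequence \<open>G\<close> serves every joint process. For the Markov property it is decisive that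
  \<open>G (\<Xi> s)\<close> is a function of the state at time \<open>s\<close>: it cannot
  distinguish an event from its conditional probability given that state.\<close>

text \<open>The parameter is fixed here. \<open>B_normal\<close> takes outward normals of any
  length; as its conclusion is homogeneous in the normal, this is the condition on inward unit
  normals.\<close>

locale set_B_data =
  fixes n d :: "'n::finite \<Rightarrow> real^'n" and B :: "(real^'n) set" and \<theta> :: real
  assumes n_unit: "norm (n i) = 1"
    and d_n: "d i \<bullet> n i = 1"
    and d_indep: "lin_indep_family d"
    and theta_pos: "0 < \<theta>"
    and B_compact: "compact B" and B_convex: "convex B"
    and B_interior: "0 \<in> interior B"
    and B_normal: "\<lbrakk>z \<in> frontier B; \<bar>z \<bullet> n i\<bar> < \<theta>; \<And>y. y \<in> B \<Longrightarrow> \<nu> \<bullet> y \<le> \<nu> \<bullet> z\<rbrakk> \<Longrightarrow> \<nu> \<bullet> d i = 0"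
begin

lemma zero_in_B: "0 \<in> B"
  using B_interior interior_subset by blast

lemma frontier_B_subset: "frontier B \<subseteq> B"
  by (simp add: B_compact compact_imp_closed frontier_subset_closed)

text \<open>The invariance proofs argue by contradiction: a point outside \<open>B\<close> is shrunk
  to the frontier, where the normal condition is available.\<close>

lemma scale_to_frontier:
  assumes "x \<notin> B"
  obtains g where "1 < g" "x /\<^sub>R g \<in> frontier B"
proof -
  have "closed_segment 0 x \<inter> frontier B \<noteq> {}"
    using zero_in_B assms by (intro connected_Int_frontier) auto
  then obtain u where u: "0 \<le> u" "u \<le> 1" "u *\<^sub>R x \<in> frontier B"
    by (auto simp: in_segment)
  have "u \<noteq> 0"
    using u(3) B_interior by (auto simp: frontier_def)
  moreover have "u \<noteq> 1"
    using u(3) assms frontier_B_subset by auto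
  ultimately show thesis
    using u that[of "1 / u"] by (auto simp: field_simps)
qed

text \<open>Strictness comes from 0 being an interior point: a supporting hyperplane cannot pass
  through it.\<close>

lemma support:
  assumes "z \<in> frontier B"
  obtains \<nu> where "\<And>y. y \<in> B \<Longrightarrow> \<nu> \<bullet> y \<le> \<nu> \<bullet> z" "0 < \<nu> \<bullet> z"
proof -
  have ne: "interior B \<noteq> {}" using B_interior by auto
  have "z \<in> B" "z \<notin> rel_interior B"
    using assms frontier_B_subset ne by (auto simp: frontier_def rel_interior_nonempty_interior)
  then obtain a where a: "\<And>y. y \<in> B \<Longrightarrow> a \<bullet> z \<le> a \<bullet> y" "\<And>y. y \<in> rel_interior B \<Longrightarrow> a \<bullet> z < a \<bullet> y"
    using supporting_hyperplane_rel_boundary[OF B_convex] by metis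
  have "a \<bullet> z < 0"
    using a(2)[of 0] B_interior ne by (simp add: rel_interior_nonempty_interior)
  then show thesis
    using a that[of "-a"] by simp
qed

text \<open>The sheared point lies on the hyperplane of face \<open>i\<close>. If it left
  \<open>B\<close>, then at the frontier point below it the normal would be orthogonal to
  \<open>d i\<close>, so moving back along \<open>d i\<close> to \<open>z\<close> would not lower
  the normal component, and \<open>z\<close> would be beyond the supporting hyperplane.\<close>

lemma shear_in_B:
  assumes "z \<in> B"
  shows "z - (z \<bullet> n i) *\<^sub>R d i \<in> B"
proof (rule ccontr)
  let ?z0 = "z - (z \<bullet> n i) *\<^sub>R d i"
  assume "?z0 \<notin> B"
  then obtain g where g: "1 < g" "?z0 /\<^sub>R g \<in> frontier B"
    by (rule scale_to_frontier)
  obtain \<nu> where \<nu>: "\<And>y. y \<in> B \<Longrightarrow> \<nu> \<bullet> y \<le> \<nu> \<bullet> (?z0 /\<^sub>R g)" "0 < \<nu> \<bullet> (?z0 /\<^sub>R g)"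
    using support[OF g(2)] by blast
  have z0: "?z0 \<bullet> n i = 0"
    by (simp add: inner_diff_left d_n)
  then have "\<nu> \<bullet> d i = 0"
    using \<nu>(1) theta_pos by (intro B_normal[OF g(2)]) (simp_all only: z0 inner_scaleR_left mult_zero_right abs_zero)
  then have "\<nu> \<bullet> z = g * (\<nu> \<bullet> (?z0 /\<^sub>R g))"
    using g(1) by (simp add: inner_diff_right)
  moreover have "\<dots> > 1 * (\<nu> \<bullet> (?z0 /\<^sub>R g))"
    using g(1) \<nu>(2) by (intro mult_strict_right_mono) auto
  ultimately show False
    using \<nu>(1)[OF assms] by simp
qed

text \<open>Testing the normal against the sheared point gives a nonnegative product of
  \<open>z \<bullet> n i\<close> and \<open>\<nu> \<bullet> d i\<close>. So outside the slab of
  width \<theta> the two have compatible signs, and inside the slab the second one vanishes.\<close>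

lemma normal_sign:
  assumes z: "z \<in> frontier B" and \<nu>: "\<And>y. y \<in> B \<Longrightarrow> \<nu> \<bullet> y \<le> \<nu> \<bullet> z"
  shows "z \<bullet> n i < \<theta> \<Longrightarrow> \<nu> \<bullet> d i \<le> 0" and "- \<theta> < z \<bullet> n i \<Longrightarrow> 0 \<le> \<nu> \<bullet> d i"
proof -
  have "z - (z \<bullet> n i) *\<^sub>R d i \<in> B"
    using z frontier_B_subset by (intro shear_in_B) auto
  from \<nu>[OF this] have *: "0 \<le> (z \<bullet> n i) * (\<nu> \<bullet> d i)"
    by (simp add: inner_diff_right)
  show "\<nu> \<bullet> d i \<le> 0" if "z \<bullet> n i < \<theta>"
  proof (cases "\<bar>z \<bullet> n i\<bar> < \<theta>")
    case True
    then show ?thesis using B_normal[OF z True \<nu>] by simp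
  next
    case False
    with that theta_pos have "z \<bullet> n i < 0" by linarith
    with * show ?thesis by (simp add: zero_le_mult_iff)
  qed
  show "0 \<le> \<nu> \<bullet> d i" if "- \<theta> < z \<bullet> n i"
  proof (cases "\<bar>z \<bullet> n i\<bar> < \<theta>")
    case True
    then show ?thesis using B_normal[OF z True \<nu>] by simp
  next
    case False
    with that theta_pos have "z \<bullet> n i > 0" by linarith
    with * show ?thesis by (simp add: zero_le_mult_iff)
  qed
qed

lemma inner_cone_nonpos:
  assumes "p \<in> convex_cone hull (d ` A)" "\<And>i. i \<in> A \<Longrightarrow> \<nu> \<bullet> d i \<le> 0"
  shows "\<nu> \<bullet> p \<le> 0"
proof -
  have "convex_cone hull (d ` A) \<subseteq> {p. \<nu> \<bullet> p \<le> 0}"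
    using assms(2) by (intro hull_minimal)
      (auto simp: convex_cone_iff inner_add_right mult_nonneg_nonpos)
  with assms(1) show ?thesis by auto
qed

lemma inner_span_zero:
  assumes "p \<in> span (d ` A)" "\<And>i. i \<in> A \<Longrightarrow> \<nu> \<bullet> d i = 0"
  shows "\<nu> \<bullet> p = 0"
  using assms(1)
proof (induction rule: span_induct_alt)
  case (step c x y)
  then show ?case using assms(2) by (auto simp: inner_add_right)
qed auto

text \<open>A convex body adapted to the reflection directions is invariant under a reflection step,
  up to a tolerance \<open>c\<close> proportional to its size.\<close>

lemma reflection_step_in_B:
  assumes V: "V /\<^sub>R l \<in> B" and c: "0 \<le> c" "c < l * \<theta>"
    and p: "p \<in> convex_cone hull (d ` A)" and q: "q \<in> convex_cone hull (d ` A')"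
    and A: "\<And>i. i \<in> A \<Longrightarrow> (V + p - q) \<bullet> n i \<le> c"
    and A': "\<And>i. i \<in> A' \<Longrightarrow> - c \<le> (V + p - q) \<bullet> n i"
  shows "(V + p - q) /\<^sub>R l \<in> B"
proof (rule ccontr)
  let ?V' = "V + p - q"
  have l: "0 < l"
    using c theta_pos by (smt (verit) mult_nonneg_nonpos2 mult.commute)
  assume "\<not> ?thesis"
  then obtain g where g: "1 < g" "(?V' /\<^sub>R l) /\<^sub>R g \<in> frontier B"
    by (rule scale_to_frontier)
  define z where "z = (?V' /\<^sub>R l) /\<^sub>R g"
  have V': "?V' = (l * g) *\<^sub>R z"
    using l g by (simp add: z_def field_simps)
  obtain \<nu> where \<nu>: "\<And>y. y \<in> B \<Longrightarrow> \<nu> \<bullet> y \<le> \<nu> \<bullet> z" "0 < \<nu> \<bullet> z"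
    using support[OF g(2)] unfolding z_def by blast
  have zf: "z \<in> frontier B" using g(2) by (simp add: z_def)
  \<comment> \<open>Enlarging the multiple by \<open>g\<close> only lowers the relative tolerance,
    so at \<open>z\<close> the pushed coordinates are still within reach of
    \<open>normal_sign\<close>.\<close>
  have c': "c < (l * g) * \<theta>"
    using c g l theta_pos by (smt (verit, best) mult.commute mult_less_cancel_left_pos mult_le_cancel_right1 mult_pos_pos mult.assoc)
  have lg: "0 < l * g" using l g by simp
  have "\<nu> \<bullet> d i \<le> 0" if "i \<in> A" for i
  proof (rule normal_sign(1)[OF zf \<nu>(1)])
    have "(l * g) * (z \<bullet> n i) < (l * g) * \<theta>"
      using A[OF that] c' V' by (metis inner_scaleR_left le_less_trans)
    then show "z \<bullet> n i < \<theta>" using lg mult_less_cancel_left_pos by blast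
  qed auto
  then have "\<nu> \<bullet> p \<le> 0"
    by (rule inner_cone_nonpos[OF p])
  moreover have "- \<nu> \<bullet> d i \<le> 0" if "i \<in> A'" for i
  proof -
    have "(l * g) * (- \<theta>) < (l * g) * (z \<bullet> n i)"
      using A'[OF that] c' V' by (smt (verit, best) inner_scaleR_left mult_minus_right)
    then have "- \<theta> < z \<bullet> n i" using lg mult_less_cancel_left_pos by blast
    then show ?thesis using normal_sign(2)[OF zf \<nu>(1)] by simp
  qed
  then have "- \<nu> \<bullet> q \<le> 0"
    by (rule inner_cone_nonpos[OF q])
  \<comment> \<open>Both pushes point inward at the exit point, yet \<open>V\<close> was inside the
    multiple \<open>l\<close> and the new point lies at \<open>g * l\<close> with
    \<open>1 < g\<close>.\<close>
  ultimately have "\<nu> \<bullet> ?V' \<le> \<nu> \<bullet> V"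
    by (simp add: inner_add_right inner_diff_right)
  moreover have "\<nu> \<bullet> V = l * (\<nu> \<bullet> (V /\<^sub>R l))" using l by simp
  moreover have "\<dots> \<le> l * (\<nu> \<bullet> z)" using \<nu>(1)[OF V] l by simp
  moreover have "\<nu> \<bullet> ?V' = l * (g * (\<nu> \<bullet> z))" by (simp add: V')
  moreover have "l * (g * (\<nu> \<bullet> z)) > l * (\<nu> \<bullet> z)" using l g \<nu>(2) by simp
  ultimately show False by linarith
qed

text \<open>Directions may now be used with either sign, so the new point has to be close to the
  hyperplanes from both sides; then the normal at the exit point is orthogonal to the whole
  step.\<close>

lemma span_step_in_B:
  assumes V: "V /\<^sub>R l \<in> B" and c: "0 \<le> c" "c < l * \<theta>"
    and p: "p \<in> span (d ` A)"
    and A: "\<And>i. i \<in> A \<Longrightarrow> \<bar>(V + p) \<bullet> n i\<bar> \<le> c"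
  shows "(V + p) /\<^sub>R l \<in> B"
proof (rule ccontr)
  let ?V' = "V + p"
  have l: "0 < l"
    using c theta_pos by (smt (verit) mult_nonneg_nonpos2 mult.commute)
  assume "\<not> ?thesis"
  then obtain g where g: "1 < g" "(?V' /\<^sub>R l) /\<^sub>R g \<in> frontier B"
    by (rule scale_to_frontier)
  define z where "z = (?V' /\<^sub>R l) /\<^sub>R g"
  have V': "?V' = (l * g) *\<^sub>R z"
    using l g by (simp add: z_def field_simps)
  obtain \<nu> where \<nu>: "\<And>y. y \<in> B \<Longrightarrow> \<nu> \<bullet> y \<le> \<nu> \<bullet> z" "0 < \<nu> \<bullet> z"
    using support[OF g(2)] unfolding z_def by blast
  have zf: "z \<in> frontier B" using g(2) by (simp add: z_def)
  have c': "c < (l * g) * \<theta>"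
    using c g l theta_pos by (smt (verit, best) mult.commute mult_less_cancel_left_pos mult_le_cancel_right1 mult_pos_pos mult.assoc)
  have lg: "0 < l * g" using l g by simp
  have "\<nu> \<bullet> d i = 0" if "i \<in> A" for i
  proof (rule B_normal[OF zf _ \<nu>(1)])
    have "(l * g) * \<bar>z \<bullet> n i\<bar> < (l * g) * \<theta>"
      using A[OF that] c' lg unfolding V' by (metis inner_scaleR_left abs_mult abs_of_pos le_less_trans)
    then show "\<bar>z \<bullet> n i\<bar> < \<theta>" using lg mult_less_cancel_left_pos by blast
  qed auto
  then have "\<nu> \<bullet> p = 0"
    by (rule inner_span_zero[OF p])
  then have "\<nu> \<bullet> ?V' = \<nu> \<bullet> V"
    by (simp add: inner_add_right)
  moreover have "\<nu> \<bullet> V = l * (\<nu> \<bullet> (V /\<^sub>R l))" using l by simp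
  moreover have "\<dots> \<le> l * (\<nu> \<bullet> z)" using \<nu>(1)[OF V] l by simp
  moreover have "\<nu> \<bullet> ?V' = l * (g * (\<nu> \<bullet> z))" by (simp add: V')
  moreover have "l * (g * (\<nu> \<bullet> z)) > l * (\<nu> \<bullet> z)" using l g \<nu>(2) by simp
  ultimately show False by linarith
qed

section \<open>Radii and constants of the gauge of \<open>B\<close>\<close>

definition rB :: real where "rB = (SOME r. 0 < r \<and> cball 0 r \<subseteq> B)"
definition RB :: real where "RB = (SOME R. 0 < R \<and> B \<subseteq> cball 0 R)"
text \<open>The outer radius times the size \<open>2 * c / \<theta> + e / rB\<close> of a multiple
  of \<open>B\<close> is at most \<open>CB * (c + e)\<close>, which turns gauge bounds into norm
  bounds.\<close>

definition CB :: real where "CB = 2 * RB / \<theta> + RB / rB"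

lemma rB: "0 < rB" "cball 0 rB \<subseteq> B"
proof -
  have "\<exists>r. 0 < r \<and> cball 0 r \<subseteq> B"
    using B_interior by (simp add: mem_interior_cball)
  from someI_ex[OF this] show "0 < rB" "cball 0 rB \<subseteq> B" by (auto simp: rB_def)
qed

lemma RB: "0 < RB" "B \<subseteq> cball 0 RB"
proof -
  have "\<exists>r. 0 < r \<and> B \<subseteq> cball 0 r"
    using B_compact compact_imp_bounded bounded_subset_ballD ball_subset_cball by (meson order_trans)
  from someI_ex[OF this] show "0 < RB" "B \<subseteq> cball 0 RB" by (auto simp: RB_def)
qed

lemma CB_pos: "0 < CB"
  using rB(1) RB(1) theta_pos by (simp add: CB_def add_pos_pos)

lemma in_B_norm:
  assumes "V /\<^sub>R l \<in> B" "0 < l" shows "norm V \<le> RB * l"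
proof -
  have "norm (V /\<^sub>R l) \<le> RB" using assms(1) RB(2) by auto
  then show ?thesis using assms(2) by (simp add: field_simps)
qed

lemma norm_in_B:
  assumes "norm V \<le> rB * l" "0 < l" shows "V /\<^sub>R l \<in> B"
proof -
  have "norm (V /\<^sub>R l) \<le> rB" using assms by (simp add: field_simps)
  then show ?thesis using rB(2) by auto
qed

text \<open>The size \<open>2 * c / \<theta> + e / rB\<close> for a multiple of \<open>B\<close> admits the tolerance \<open>c\<close> and starting errors up to \<open>e\<close>.\<close>

lemma gauge_size:
  assumes "0 \<le> c" "0 \<le> e" "0 < c + e"
  shows "0 < 2 * c / \<theta> + e / rB" "c < (2 * c / \<theta> + e / rB) * \<theta>"
    "norm V \<le> e \<Longrightarrow> V /\<^sub>R (2 * c / \<theta> + e / rB) \<in> B"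
    "V /\<^sub>R (2 * c / \<theta> + e / rB) \<in> B \<Longrightarrow> norm V \<le> CB * (c + e)"
proof -
  let ?l = "2 * c / \<theta> + e / rB"
  show l: "0 < ?l"
    using assms theta_pos rB(1)
    by (smt (verit, ccfv_SIG) divide_nonneg_pos divide_pos_pos)
  \<comment> \<open>The factor 2 provides strictness when \<open>c\<close> is positive; when
    \<open>c = 0\<close>, the starting error provides it.\<close>
  have "c < 2 * c + e / rB * \<theta>"
  proof (cases "c = 0")
    case True then show ?thesis using assms theta_pos rB(1) by simp
  next
    case False then show ?thesis using assms theta_pos rB(1)
      by (smt (verit) divide_nonneg_pos mult_nonneg_nonneg)
  qed
  also have "\<dots> = ?l * \<theta>"
    using theta_pos by (simp add: distrib_right)
  finally show "c < ?l * \<theta>" .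
  have *: "e \<le> rB * ?l"
    using assms theta_pos rB(1) by (simp add: field_simps)
  show "V /\<^sub>R ?l \<in> B" if "norm V \<le> e"
    using that * l by (intro norm_in_B) auto
  have "norm V \<le> RB * ?l" if "V /\<^sub>R ?l \<in> B"
    using that l by (intro in_B_norm)
  moreover have "RB * ?l \<le> CB * (c + e)"
    using assms theta_pos rB(1) RB(1) by (simp add: CB_def field_simps)
  ultimately show "norm V \<le> CB * (c + e)" if "V /\<^sub>R ?l \<in> B" using that by force
qed

text \<open>While \<open>Y\<close> is pushed by face \<open>i\<close>, the path \<open>Z\<close> is
  within \<eta> of that face and \<open>Z'\<close> is on its nonnegative side, so
  \<open>Y - Y'\<close> exceeds the tolerance \<open>c + \<eta>\<close> in no pushed coordinate and
  \<open>reflection_step_in_B\<close> applies. The slack \<eta> is for continuous paths seen at grid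
  times only; a face touched between them is not exactly active at the end of the step.\<close>

lemma discrete_skorokhod_lipschitz:
  fixes Z Z' Y Y' :: "nat \<Rightarrow> real^'n"
  assumes c: "0 \<le> c" "0 \<le> \<eta>" "0 < c + \<eta>" and Y0: "Y 0 = Y' 0"
    and G: "\<And>j i. j < N \<Longrightarrow> 0 \<le> Z (Suc j) \<bullet> n i" "\<And>j i. j < N \<Longrightarrow> 0 \<le> Z' (Suc j) \<bullet> n i"
    and Y: "\<And>j. j < N \<Longrightarrow> Y (Suc j) - Y j \<in> convex_cone hull (d ` A j)"
    and Y': "\<And>j. j < N \<Longrightarrow> Y' (Suc j) - Y' j \<in> convex_cone hull (d ` A' j)"
    and A: "\<And>j i. j < N \<Longrightarrow> i \<in> A j \<Longrightarrow> Z (Suc j) \<bullet> n i \<le> \<eta>"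
    and A': "\<And>j i. j < N \<Longrightarrow> i \<in> A' j \<Longrightarrow> Z' (Suc j) \<bullet> n i \<le> \<eta>"
    and X: "\<And>j. j < N \<Longrightarrow> norm ((Z (Suc j) - Y (Suc j)) - (Z' (Suc j) - Y' (Suc j))) \<le> c"
    and j: "j \<le> N"
  shows "norm (Y j - Y' j) \<le> CB * (c + \<eta>)"
proof -
  let ?l = "2 * (c + \<eta>) / \<theta> + 0 / rB"
  have c': "0 \<le> c + \<eta>" "0 < c + \<eta> + 0" using c by auto
  note size = gauge_size[OF c'(1) order.refl c'(2)]
  have "(Y j - Y' j) /\<^sub>R ?l \<in> B" using j
  proof (induction j)
    case 0
    then show ?case using zero_in_B Y0 by simp
  next
    case (Suc j)
    then have jN: "j < N" and IH: "(Y j - Y' j) /\<^sub>R ?l \<in> B" by auto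
    let ?p = "Y (Suc j) - Y j" and ?q = "Y' (Suc j) - Y' j"
    have eq: "(Y j - Y' j) + ?p - ?q = Y (Suc j) - Y' (Suc j)" by simp
    have X': "\<bar>(Y (Suc j) - Y' (Suc j)) \<bullet> n i - (Z (Suc j) - Z' (Suc j)) \<bullet> n i\<bar> \<le> c" for i
    proof -
      have "(Y (Suc j) - Y' (Suc j)) \<bullet> n i - (Z (Suc j) - Z' (Suc j)) \<bullet> n i
        = - (((Z (Suc j) - Y (Suc j)) - (Z' (Suc j) - Y' (Suc j))) \<bullet> n i)"
        by (simp add: inner_diff_left)
      then show ?thesis
        using X[OF jN] Cauchy_Schwarz_ineq2[of "(Z (Suc j) - Y (Suc j)) - (Z' (Suc j) - Y' (Suc j))" "n i"]
          n_unit[of i] by simp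
    qed
    have "((Y j - Y' j) + ?p - ?q) /\<^sub>R ?l \<in> B"
    proof (rule reflection_step_in_B[OF IH c'(1) size(2) Y[OF jN] Y'[OF jN]], unfold eq)
      fix i assume "i \<in> A j"
      then show "(Y (Suc j) - Y' (Suc j)) \<bullet> n i \<le> c + \<eta>"
        using A[OF jN, of i] G(2)[OF jN, of i] X'[of i] by (simp add: inner_diff_left)
    next
      fix i assume "i \<in> A' j"
      then show "- (c + \<eta>) \<le> (Y (Suc j) - Y' (Suc j)) \<bullet> n i"
        using A'[OF jN, of i] G(1)[OF jN, of i] X'[of i] by (simp add: inner_diff_left)
    qed
    then show ?case by (simp only: eq)
  qed
  then show ?thesis using size(4) by simp
qed

section \<open>Oblique projections onto intersections of faces\<close>

text \<open>A step by \<open>v\<close> from 0 has tolerance 0, so it stays in every multiple of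
  \<open>B\<close>, however small; the multiple \<open>norm v / (2 * RB)\<close> is too small to
  contain \<open>v\<close>.\<close>

lemma span_face_trivial:
  assumes "v \<in> span (d ` I)" "\<And>i. i \<in> I \<Longrightarrow> v \<bullet> n i = 0"
  shows "v = 0"
proof (rule ccontr)
  assume "v \<noteq> 0"
  then have e: "0 < norm v / (2 * RB)" using RB(1) by simp
  have "(0 + v) /\<^sub>R (norm v / (2 * RB)) \<in> B"
    using assms mult_pos_pos[OF e theta_pos] zero_in_B
    by (intro span_step_in_B[where c = 0 and A = I]) auto
  then have "norm v \<le> RB * (norm v / (2 * RB))"
    using e in_B_norm by fastforce
  then show False using RB(1) \<open>v \<noteq> 0\<close> by simp
qed

text \<open>The projection along the directions of \<open>I\<close> onto the common zero set of the
  normals of \<open>I\<close>; for the faces active at a point this is the derivative of the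
  reflection there.\<close>

definition oblique_proj :: "'n set \<Rightarrow> real^'n \<Rightarrow> real^'n" where
  "oblique_proj I = (SOME P. linear P \<and> (\<forall>v. P v - v \<in> span (d ` I) \<and> (\<forall>i\<in>I. P v \<bullet> n i = 0)))"

lemma oblique_proj:
  "linear (oblique_proj I)" "oblique_proj I v - v \<in> span (d ` I)"
  "i \<in> I \<Longrightarrow> oblique_proj I v \<bullet> n i = 0"
proof -
  \<comment> \<open>On the coordinates in \<open>I\<close> this is the Gram-type system for the
    coefficients of the correction; the identity on the others makes it square, so that injectivity
    gives solvability.\<close>
  define A :: "real^'n \<Rightarrow> real^'n" where
    "A c = (\<chi> i. if i \<in> I then (\<Sum>j\<in>I. c $ j *\<^sub>R d j) \<bullet> n i else c $ i)" for c
  have A_lin: "linear A"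
    by (rule linearI)
      (simp_all add: A_def vec_eq_iff inner_sum_left sum.distrib sum_distrib_left algebra_simps)
  have span: "(\<Sum>j\<in>I. c $ j *\<^sub>R d j) \<in> span (d ` I)" for c :: "real^'n"
    by (intro span_sum span_scale span_base) auto
  have "inj A"
  proof (subst linear_injective_0[OF A_lin], intro allI impI)
    fix c assume 0: "A c = 0"
    have out: "c $ i = 0" if "i \<notin> I" for i
      using 0 that by (simp add: A_def vec_eq_iff) metis
    have "(\<Sum>j\<in>I. c $ j *\<^sub>R d j) = 0"
      using 0 by (intro span_face_trivial[OF span]) (simp add: A_def vec_eq_iff; metis)
    then have "(\<Sum>j\<in>UNIV. c $ j *\<^sub>R d j) = 0"
      using out by (subst sum.mono_neutral_right[of UNIV I]) auto
    then have "(\<Sum>v\<in>range d. c $ (inv d v) *\<^sub>R v) = 0"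
      using d_indep by (subst sum.reindex) (auto simp: lin_indep_family_def)
    moreover have "independent (range d)" "finite (range d)" using d_indep by (auto simp: lin_indep_family_def)
    ultimately have "c $ (inv d v) = 0" if "v \<in> range d" for v
      using that independentD[of "range d" "range d" "\<lambda>v. c $ (inv d v)" v] by auto
    then have "c $ j = 0" for j
      using d_indep by (metis inv_f_f lin_indep_family_def rangeI)
    then show "c = 0" by (simp add: vec_eq_iff)
  qed
  then have "surj A" using A_lin linear_injective_imp_surjective by blast
  then obtain A' where A': "linear A'" "A \<circ> A' = id"
    using linear_surjective_right_inverse[OF A_lin] by blast
  define u :: "real^'n \<Rightarrow> real^'n" where "u v = (\<chi> i. if i \<in> I then v \<bullet> n i else 0)" for v
  have u_lin: "linear u"
    by (rule linearI) (simp_all add: u_def vec_eq_iff inner_add_left)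
  define P where "P v = v - (\<Sum>j\<in>I. A' (u v) $ j *\<^sub>R d j)" for v
  have "linear P"
    unfolding P_def
    by (rule linearI)
      (simp_all add: linear_add[OF u_lin] linear_add[OF A'(1)] linear_scale[OF u_lin]
         linear_scale[OF A'(1)] sum.distrib scaleR_sum_right algebra_simps)
  moreover have "P v - v \<in> span (d ` I)" for v
    using span_neg[OF span[of "A' (u v)"]] by (simp add: P_def)
  moreover have "P v \<bullet> n i = 0" if "i \<in> I" for v i
  proof -
    have "A (A' (u v)) = u v" using A'(2) by (metis comp_apply id_apply)
    then have "A (A' (u v)) $ i = u v $ i" by simp
    then show ?thesis using that by (simp add: A_def u_def P_def inner_diff_left)
  qed
  ultimately have "\<exists>P. linear P \<and> (\<forall>v. P v - v \<in> span (d ` I) \<and> (\<forall>i\<in>I. P v \<bullet> n i = 0))"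
    by blast
  from someI_ex[OF this] show "linear (oblique_proj I)" "oblique_proj I v - v \<in> span (d ` I)"
    "i \<in> I \<Longrightarrow> oblique_proj I v \<bullet> n i = 0"
    by (auto simp: oblique_proj_def)
qed

text \<open>The result lies exactly on the hyperplanes, so the tolerance is 0 and no gauge is
  lost.\<close>

lemma oblique_proj_in_B:
  assumes "V /\<^sub>R l \<in> B" "0 < l"
  shows "oblique_proj I V /\<^sub>R l \<in> B"
proof -
  have "(V + (oblique_proj I V - V)) /\<^sub>R l \<in> B"
    using assms theta_pos
    by (intro span_step_in_B[where c = 0 and A = I, OF assms(1)] oblique_proj(2)) (auto simp: oblique_proj(3))
  then show ?thesis by simp
qed


section \<open>Skorokhod and derivative problems\<close>

text \<open>The left end is excluded, as in the conditions on the increments of the pushing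
  terms.\<close>

definition hits :: "(real \<Rightarrow> real^'n) \<Rightarrow> real \<Rightarrow> real \<Rightarrow> 'n set" where
  "hits Z s t = {i. \<exists>u\<in>{s<..t}. Z u \<bullet> n i = 0}"

text \<open>Lying on the frontier is automatic, because the interior of the cone is inside each open
  half space.\<close>

lemma active_eq:
  assumes "x \<in> polycone n"
  shows "active n x = {i. x \<bullet> n i = 0}"
proof -
  have "x \<in> frontier (polycone n)" if "x \<bullet> n i = 0" for i
  proof -
    have "polycone n \<subseteq> {x. 0 \<le> n i \<bullet> x}"
      by (auto simp: polycone_def inner_commute)
    then have "interior (polycone n) \<subseteq> interior {x. 0 \<le> n i \<bullet> x}"
      by (rule interior_mono)
    also have "\<dots> = {x. 0 < n i \<bullet> x}"
      using n_unit[of i] by (intro interior_halfspace_ge) auto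
    finally have "x \<notin> interior (polycone n)" using that by (auto simp: inner_commute)
    then show ?thesis using assms closure_subset by (auto simp: frontier_def)
  qed
  then show ?thesis by (auto simp: active_def face_def)
qed

text \<open>The driving path is \<open>Z - Y\<close> and therefore no separate argument. No initial
  value of \<open>Y\<close> is prescribed, so that restrictions to later intervals are solutions
  again.\<close>

definition skorokhod_sol :: "real \<Rightarrow> real \<Rightarrow> (real \<Rightarrow> real^'n) \<Rightarrow> (real \<Rightarrow> real^'n) \<Rightarrow> bool" where
  "skorokhod_sol a e Z Y \<longleftrightarrow> continuous_on {a..e} Z \<and> (\<forall>t\<in>{a..e}. \<forall>i. 0 \<le> Z t \<bullet> n i) \<and>
     (\<forall>s t. a \<le> s \<longrightarrow> s < t \<longrightarrow> t \<le> e \<longrightarrow> Y t - Y s \<in> convex_cone hull (d ` hits Z s t))"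

lemma skorokhod_solD:
  assumes "skorokhod_sol a e Z Y"
  shows "continuous_on {a..e} Z" "\<lbrakk>a \<le> t; t \<le> e\<rbrakk> \<Longrightarrow> 0 \<le> Z t \<bullet> n i"
    "\<lbrakk>a \<le> s; s < t; t \<le> e\<rbrakk> \<Longrightarrow> Y t - Y s \<in> convex_cone hull (d ` hits Z s t)"
  using assms by (auto simp: skorokhod_sol_def)

lemma skorokhod_sol_mono:
  assumes "skorokhod_sol a e Z Y" "a \<le> a'" "e' \<le> e"
  shows "skorokhod_sol a' e' Z Y"
  using assms continuous_on_subset[of "{a..e}" Z "{a'..e'}"]
  by (auto simp: skorokhod_sol_def)

lemma skorokhod_sol_const:
  assumes "\<And>i. 0 \<le> z \<bullet> n i"
  shows "skorokhod_sol a e (\<lambda>_. z) (\<lambda>_. y)"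
  using assms by (auto simp: skorokhod_sol_def convex_cone_hull_contains_0)

section \<open>Uniform grids and the Lipschitz property of the Skorokhod problem\<close>

definition grid :: "real \<Rightarrow> real \<Rightarrow> nat \<Rightarrow> nat \<Rightarrow> real" where
  "grid a e N j = a + real j * ((e - a) / real N)"

lemma grid_0 [simp]: "grid a e N 0 = a"
  by (simp add: grid_def)

lemma grid_N [simp]: "N > 0 \<Longrightarrow> grid a e N N = e"
  by (simp add: grid_def)

lemma grid_Suc: "grid a e N (Suc j) = grid a e N j + (e - a) / real N"
  unfolding grid_def of_nat_Suc distrib_right mult_1_left by simp

lemma grid_mono:
  assumes "a \<le> e" "j \<le> k" shows "grid a e N j \<le> grid a e N k"
  using assms by (simp add: grid_def mult_right_mono divide_right_mono)

lemma grid_less: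
  assumes "a < e" "j < N" shows "grid a e N j < grid a e N (Suc j)"
  using assms by (simp add: grid_Suc)

lemma grid_in:
  assumes "a \<le> e" "j \<le> N" "0 < N" shows "a \<le> grid a e N j" "grid a e N j \<le> e"
  using grid_mono[OF assms(1), of 0 j N] grid_mono[OF assms(1,2), of N] assms(3) by auto

lemma hits_small:
  assumes "i \<in> hits Z s t" "\<And>u. s < u \<Longrightarrow> u \<le> t \<Longrightarrow> norm (Z t - Z u) \<le> \<eta>"
  shows "Z t \<bullet> n i \<le> \<eta>"
proof -
  obtain u where u: "s < u" "u \<le> t" "Z u \<bullet> n i = 0"
    using assms(1) by (auto simp: hits_def)
  have "Z t \<bullet> n i = (Z t - Z u) \<bullet> n i" using u by (simp add: inner_diff_left)
  also have "\<dots> \<le> norm (Z t - Z u) * norm (n i)" by (rule norm_cauchy_schwarz)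
  finally show ?thesis using assms(2)[OF u(1,2)] n_unit[of i] by simp
qed

lemma fine_grid:
  assumes "0 < (\<delta>::real)" obtains N :: nat where "0 < N" "c / real N < \<delta>"
proof -
  obtain N :: nat where N: "\<bar>c\<bar> / \<delta> < real N" using reals_Archimedean2 by blast
  moreover have "0 \<le> \<bar>c\<bar> / \<delta>" using assms by simp
  ultimately have "0 < real N" by linarith
  moreover have "\<bar>c\<bar> < real N * \<delta>" using N assms by (simp only: pos_divide_less_eq)
  then have "c < \<delta> * real N" by (simp add: mult.commute)
  ultimately have "c / real N < \<delta>" by (simp only: pos_divide_less_eq)
  then show thesis using that \<open>0 < real N\<close> by simp
qed

text \<open>Sampling on grids so fine that both paths oscillate by at most \<eta> reduces this to
  the discrete estimate; then \<eta> tends to 0. The grid ends at \<open>t\<close>, so that the last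
  sample is the wanted value.\<close>

lemma skorokhod_lipschitz:
  assumes Z: "skorokhod_sol a e Z Y" and Z': "skorokhod_sol a e Z' Y'" and Y0: "Y a = Y' a"
    and X: "\<And>t. a \<le> t \<Longrightarrow> t \<le> e \<Longrightarrow> norm ((Z t - Y t) - (Z' t - Y' t)) \<le> c"
    and t: "a \<le> t" "t \<le> e"
  shows "norm (Y t - Y' t) \<le> CB * c"
proof (cases "t = a")
  case True
  have "0 \<le> c" using X[OF t] norm_ge_zero order_trans by blast
  then show ?thesis using True Y0 CB_pos by simp
next
  case False
  with t have at: "a < t" by simp
  have c0: "0 \<le> c" using X[OF t] norm_ge_zero order_trans by blast
  have "norm (Y t - Y' t) \<le> CB * c + \<epsilon>" if "0 < \<epsilon>" for \<epsilon>
  proof -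
    define \<eta> where "\<eta> = \<epsilon> / CB"
    have \<eta>: "0 < \<eta>" using that CB_pos by (simp add: \<eta>_def)
    have uc: "uniformly_continuous_on {a..t} Z" "uniformly_continuous_on {a..t} Z'"
      using skorokhod_solD(1)[OF skorokhod_sol_mono[OF Z order.refl t(2)]]
        skorokhod_solD(1)[OF skorokhod_sol_mono[OF Z' order.refl t(2)]]
      by (auto intro: compact_uniformly_continuous)
    obtain \<delta>1 where \<delta>1: "0 < \<delta>1" "\<And>u v. u \<in> {a..t} \<Longrightarrow> v \<in> {a..t} \<Longrightarrow> dist v u < \<delta>1 \<Longrightarrow> dist (Z v) (Z u) < \<eta>"
      using uc(1) \<eta> unfolding uniformly_continuous_on_def by blast
    obtain \<delta>2 where \<delta>2: "0 < \<delta>2" "\<And>u v. u \<in> {a..t} \<Longrightarrow> v \<in> {a..t} \<Longrightarrow> dist v u < \<delta>2 \<Longrightarrow> dist (Z' v) (Z' u) < \<eta>"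
      using uc(2) \<eta> unfolding uniformly_continuous_on_def by blast
    obtain N where N: "0 < N" "(t - a) / real N < min \<delta>1 \<delta>2"
      using fine_grid[of "min \<delta>1 \<delta>2" "t - a"] \<delta>1(1) \<delta>2(1) by auto
    let ?t = "grid a t N"
    have in1: "a \<le> ?t j" "?t j \<le> t" if "j \<le> N" for j using grid_in[of a t j N] that at N by auto
    have osc: "norm (Z (?t (Suc j)) - Z u) \<le> \<eta>" "norm (Z' (?t (Suc j)) - Z' u) \<le> \<eta>"
      if "j < N" "?t j < u" "u \<le> ?t (Suc j)" for j u
    proof -
      have u: "u \<in> {a..t}" "?t (Suc j) \<in> {a..t}" using that in1[of j] in1[of "Suc j"] by auto
      have "dist (?t (Suc j)) u < min \<delta>1 \<delta>2"
        using that N(2) unfolding dist_real_def by (simp add: grid_Suc)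
      then show "norm (Z (?t (Suc j)) - Z u) \<le> \<eta>" "norm (Z' (?t (Suc j)) - Z' u) \<le> \<eta>"
        using \<delta>1(2)[OF u] \<delta>2(2)[OF u] by (auto simp: dist_norm less_imp_le)
    qed
    have "norm (Y (?t N) - Y' (?t N)) \<le> CB * (c + \<eta>)"
    proof (rule discrete_skorokhod_lipschitz[where Z = "\<lambda>j. Z (?t j)" and Z' = "\<lambda>j. Z' (?t j)"
          and A = "\<lambda>j. hits Z (?t j) (?t (Suc j))" and A' = "\<lambda>j. hits Z' (?t j) (?t (Suc j))"
          and Y = "\<lambda>j. Y (?t j)" and Y' = "\<lambda>j. Y' (?t j)" and N = N and c = c and \<eta> = \<eta>])
      fix j assume j: "j < N"
      note in2 = in1[of j] in1[of "Suc j"] grid_less[OF at j]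
      show "0 \<le> Z (?t (Suc j)) \<bullet> n i" "0 \<le> Z' (?t (Suc j)) \<bullet> n i" for i
        using j in2 t skorokhod_solD(2)[OF Z] skorokhod_solD(2)[OF Z'] by auto
      show "Y (?t (Suc j)) - Y (?t j) \<in> convex_cone hull (d ` hits Z (?t j) (?t (Suc j)))"
        using j in2 t by (intro skorokhod_solD(3)[OF Z]) auto
      show "Y' (?t (Suc j)) - Y' (?t j) \<in> convex_cone hull (d ` hits Z' (?t j) (?t (Suc j)))"
        using j in2 t by (intro skorokhod_solD(3)[OF Z']) auto
      show "Z (?t (Suc j)) \<bullet> n i \<le> \<eta>" if "i \<in> hits Z (?t j) (?t (Suc j))" for i
        using hits_small[OF that] osc(1)[OF j] by blast
      show "Z' (?t (Suc j)) \<bullet> n i \<le> \<eta>" if "i \<in> hits Z' (?t j) (?t (Suc j))" for i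
        using hits_small[OF that] osc(2)[OF j] by blast
      show "norm (Z (?t (Suc j)) - Y (?t (Suc j)) - (Z' (?t (Suc j)) - Y' (?t (Suc j)))) \<le> c"
        using j in2 t by (intro X) auto
    qed (use c0 \<eta> Y0 in auto)
    then show ?thesis using N(1) CB_pos by (simp add: \<eta>_def distrib_left)
  qed
  then show ?thesis by (rule field_le_epsilon)
qed

text \<open>The comparison is with the constant solution resting at \<open>Z a\<close>.\<close>

lemma skorokhod_modulus:
  assumes Z: "skorokhod_sol a e Z Y"
    and X: "\<And>t. a \<le> t \<Longrightarrow> t \<le> e \<Longrightarrow> norm ((Z t - Y t) - (Z a - Y a)) \<le> c"
    and t: "a \<le> t" "t \<le> e"
  shows "norm (Y t - Y a) \<le> CB * c" "norm (Z t - Z a) \<le> (CB + 1) * c"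
proof -
  have "skorokhod_sol a e (\<lambda>_. Z a) (\<lambda>_. Y a)"
    using skorokhod_solD(2)[OF Z, of a] t by (intro skorokhod_sol_const) auto
  from skorokhod_lipschitz[OF Z this _ X t] show Y: "norm (Y t - Y a) \<le> CB * c" by simp
  have "Z t - Z a = ((Z t - Y t) - (Z a - Y a)) + (Y t - Y a)" by simp
  then have "norm (Z t - Z a) \<le> norm ((Z t - Y t) - (Z a - Y a)) + norm (Y t - Y a)"
    by (metis norm_triangle_ineq)
  then show "norm (Z t - Z a) \<le> (CB + 1) * c" using X[OF t] Y by (simp add: algebra_simps)
qed

text \<open>Scheme and path have the same driving values at the grid times, so the discrete estimate
  holds with \<open>c = 0\<close> and only the oscillation between grid times remains.\<close>

lemma euler_skorokhod:
  assumes Z: "skorokhod_sol a e Z Y" and ae: "a < e" and N: "0 < N" and \<eta>: "0 < \<eta>"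
    and Y0: "Yd 0 = Y a"
    and X: "\<And>j. j < N \<Longrightarrow> Zd (Suc j) - Yd (Suc j) = Z (grid a e N (Suc j)) - Y (grid a e N (Suc j))"
    and G: "\<And>j i. j < N \<Longrightarrow> 0 \<le> Zd (Suc j) \<bullet> n i"
    and Y: "\<And>j. j < N \<Longrightarrow> Yd (Suc j) - Yd j \<in> convex_cone hull (d ` {i. Zd (Suc j) \<bullet> n i = 0})"
    and osc: "\<And>j u. j < N \<Longrightarrow> grid a e N j < u \<Longrightarrow> u \<le> grid a e N (Suc j) \<Longrightarrow>
       norm (Z (grid a e N (Suc j)) - Z u) \<le> \<eta>"
    and j: "j \<le> N"
  shows "norm (Yd j - Y (grid a e N j)) \<le> CB * \<eta>"
proof -
  let ?t = "grid a e N"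
  have in1: "a \<le> ?t j" "?t j \<le> e" if "j \<le> N" for j using grid_in[of a e j N] that ae N by auto
  have "norm (Yd j - Y (?t j)) \<le> CB * (0 + \<eta>)"
  proof (rule discrete_skorokhod_lipschitz[where Z = Zd and Z' = "\<lambda>j. Z (?t j)"
        and A = "\<lambda>j. {i. Zd (Suc j) \<bullet> n i = 0}" and A' = "\<lambda>j. hits Z (?t j) (?t (Suc j))"
        and Y' = "\<lambda>j. Y (?t j)" and N = N])
    fix j assume jN: "j < N"
    note in2 = in1[of j] in1[of "Suc j"] grid_less[OF ae jN]
    show "0 \<le> Z (?t (Suc j)) \<bullet> n i" for i
      using jN in2 skorokhod_solD(2)[OF Z] by auto
    show "Y (?t (Suc j)) - Y (?t j) \<in> convex_cone hull (d ` hits Z (?t j) (?t (Suc j)))"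
      using jN in2 by (intro skorokhod_solD(3)[OF Z]) auto
    show "Z (?t (Suc j)) \<bullet> n i \<le> \<eta>" if "i \<in> hits Z (?t j) (?t (Suc j))" for i
      using hits_small[OF that] osc[OF jN] by blast
  qed (use assms in auto)
  then show ?thesis by simp
qed

text \<open>Near a time \<open>\<tau>\<close> only the faces active at \<open>Z \<tau>\<close> can be hit, and right after \<open>\<tau>\<close> the path \<open>J\<close> almost
  satisfies their constraints, so that its increment is itself a projection step up to a small tolerance.
  Finitely many such neighbourhoods cover the interval.\<close>

lemma derivative_scheme_converges:
  fixes J \<psi> :: "real \<Rightarrow> real^'n"
  assumes ae: "a < e" and Zc: "continuous_on {a..e} Z"
    and Zn: "\<And>t i. a \<le> t \<Longrightarrow> t \<le> e \<Longrightarrow> 0 \<le> Z t \<bullet> n i"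
    and Jr: "\<And>t. a \<le> t \<Longrightarrow> t < e \<Longrightarrow> (J \<longlongrightarrow> J t) (at_right t)"
    and Jf: "\<And>t i. a \<le> t \<Longrightarrow> t \<le> e \<Longrightarrow> Z t \<bullet> n i = 0 \<Longrightarrow> J t \<bullet> n i = 0"
    and K: "\<And>s t. a \<le> s \<Longrightarrow> s < t \<Longrightarrow> t \<le> e \<Longrightarrow> (J t - \<psi> t) - (J s - \<psi> s) \<in> span (d ` hits Z s t)"
    and \<epsilon>: "0 < \<epsilon>"
  obtains \<eta> where "0 < \<eta>"
    "\<And>N Jd \<psi>d I. \<lbrakk>0 < N; (e - a) / real N \<le> \<eta>; Jd 0 - \<psi>d 0 = J a - \<psi> a;
      \<And>j. j < N \<Longrightarrow> (Jd (Suc j) - \<psi>d (Suc j)) - (Jd j - \<psi>d j) \<in> span (d ` I j);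
      \<And>j i. j < N \<Longrightarrow> i \<in> I j \<Longrightarrow> Jd (Suc j) \<bullet> n i = 0;
      \<And>j. j < N \<Longrightarrow> norm (\<psi>d (Suc j) - \<psi> (grid a e N (Suc j))) \<le> \<eta>;
      \<And>j. j < N \<Longrightarrow> hits Z (grid a e N j) (grid a e N (Suc j)) \<subseteq> I j;
      \<And>j i. j < N \<Longrightarrow> i \<in> I j \<Longrightarrow> Z (grid a e N (Suc j)) \<bullet> n i \<le> \<eta>\<rbrakk>
      \<Longrightarrow> norm (Jd N - J e) \<le> \<epsilon>"
proof -
  \<comment> \<open>The final error is at most \<open>CB * (q + \<eta>) + \<eta>\<close> with
    \<open>\<eta> \<le> q\<close>, hence at most \<open>2 * (CB + 1) * q\<close>, half of
    \<epsilon>.\<close>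
  define q where "q = \<epsilon> / (4 * (CB + 1))"
  have q: "0 < q" using \<epsilon> CB_pos by (simp add: q_def)
  have loc: "\<exists>\<delta>>0. \<exists>\<rho>>0. \<forall>t\<in>{a..e}. \<bar>t - \<tau>\<bar> < \<delta> \<longrightarrow>
      (\<forall>i. Z \<tau> \<bullet> n i \<noteq> 0 \<longrightarrow> \<rho> < Z t \<bullet> n i) \<and> (\<tau> \<le> t \<longrightarrow> (\<forall>i. Z \<tau> \<bullet> n i = 0 \<longrightarrow> \<bar>J t \<bullet> n i\<bar> \<le> q))"
    if \<tau>: "\<tau> \<in> {a..e}" for \<tau>
  proof -
    \<comment> \<open>Half the distance to the nearest inactive face, which leaves room for
      \<open>Z\<close> to move by the other half; the 1 covers the case that all faces are
      active.\<close>
    define \<rho> where "\<rho> = Min (insert 1 ((\<lambda>i. Z \<tau> \<bullet> n i) ` {i. Z \<tau> \<bullet> n i \<noteq> 0})) / 2"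
    have "0 < x" if "x \<in> insert 1 ((\<lambda>i. Z \<tau> \<bullet> n i) ` {i. Z \<tau> \<bullet> n i \<noteq> 0})" for x
      using that \<tau> by (auto simp: order.strict_iff_order Zn)
    then have \<rho>: "0 < \<rho>" unfolding \<rho>_def by (subst half_gt_zero_iff) (rule Min_gr_iff[THEN iffD2]; auto)
    have \<rho>2: "2 * \<rho> \<le> Z \<tau> \<bullet> n i" if "Z \<tau> \<bullet> n i \<noteq> 0" for i
      unfolding \<rho>_def using that by (simp add: Min_le)
    obtain \<delta>1 where \<delta>1: "0 < \<delta>1" "\<And>t. t \<in> {a..e} \<Longrightarrow> dist t \<tau> < \<delta>1 \<Longrightarrow> dist (Z t) (Z \<tau>) < \<rho>"
      using Zc \<tau> \<rho> unfolding continuous_on_iff by metis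
    have 1: "\<rho> < Z t \<bullet> n i" if "t \<in> {a..e}" "\<bar>t - \<tau>\<bar> < \<delta>1" "Z \<tau> \<bullet> n i \<noteq> 0" for t i
    proof -
      have "norm (Z \<tau> - Z t) < \<rho>" using \<delta>1(2)[of t] that by (simp add: dist_norm norm_minus_commute)
      moreover have "(Z \<tau> - Z t) \<bullet> n i \<le> norm (Z \<tau> - Z t) * norm (n i)" by (rule norm_cauchy_schwarz)
      ultimately have "(Z \<tau> - Z t) \<bullet> n i < \<rho>" using n_unit[of i] by simp
      then show ?thesis using \<rho>2[OF that(3)] by (simp add: inner_diff_left)
    qed
    have "\<exists>\<delta>2>0. \<forall>t. \<tau> \<le> t \<and> t < \<tau> + \<delta>2 \<and> t \<le> e \<longrightarrow> norm (J t - J \<tau>) < q"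
    proof (cases "\<tau> = e")
      case True
      then show ?thesis using q by (intro exI[of _ 1]) auto
    next
      case False
      then have "eventually (\<lambda>t. dist (J t) (J \<tau>) < q) (at_right \<tau>)"
        using tendstoD[OF Jr[of \<tau>] q] \<tau> by simp
      then obtain b where b: "b > \<tau>" "\<And>t. \<tau> < t \<Longrightarrow> t < b \<Longrightarrow> dist (J t) (J \<tau>) < q"
        by (auto simp: eventually_at_right_field)
      show ?thesis
      proof (intro exI[of _ "b - \<tau>"] conjI allI impI)
        fix t assume "\<tau> \<le> t \<and> t < \<tau> + (b - \<tau>) \<and> t \<le> e"
        then show "norm (J t - J \<tau>) < q" using b(2)[of t] q by (cases "t = \<tau>") (auto simp: dist_norm)
      qed (use b in auto)
    qed
    then obtain \<delta>2 where \<delta>2: "0 < \<delta>2" "\<And>t. \<tau> \<le> t \<Longrightarrow> t < \<tau> + \<delta>2 \<Longrightarrow> t \<le> e \<Longrightarrow> norm (J t - J \<tau>) < q"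
      by blast
    have 2: "\<bar>J t \<bullet> n i\<bar> \<le> q" if "t \<in> {a..e}" "\<bar>t - \<tau>\<bar> < \<delta>2" "\<tau> \<le> t" "Z \<tau> \<bullet> n i = 0" for t i
    proof -
      have "J t \<bullet> n i = (J t - J \<tau>) \<bullet> n i" using Jf[of \<tau> i] that \<tau> by (simp add: inner_diff_left)
      then have "\<bar>J t \<bullet> n i\<bar> \<le> norm (J t - J \<tau>) * norm (n i)" by (simp add: Cauchy_Schwarz_ineq2)
      then show ?thesis using \<delta>2(2)[of t] that n_unit[of i] by auto
    qed
    show ?thesis
      using \<delta>1(1) \<delta>2(1) \<rho> 1 2 by (intro exI[of _ "min \<delta>1 \<delta>2"] exI[of _ \<rho>] conjI ballI impI allI) auto
  qed
  then obtain \<delta> \<rho> where loc': "\<And>\<tau>. \<tau> \<in> {a..e} \<Longrightarrow> 0 < \<delta> \<tau> \<and> 0 < \<rho> \<tau>"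
    "\<And>\<tau> t i. \<tau> \<in> {a..e} \<Longrightarrow> t \<in> {a..e} \<Longrightarrow> \<bar>t - \<tau>\<bar> < \<delta> \<tau> \<Longrightarrow> Z \<tau> \<bullet> n i \<noteq> 0 \<Longrightarrow> \<rho> \<tau> < Z t \<bullet> n i"
    "\<And>\<tau> t i. \<tau> \<in> {a..e} \<Longrightarrow> t \<in> {a..e} \<Longrightarrow> \<bar>t - \<tau>\<bar> < \<delta> \<tau> \<Longrightarrow> \<tau> \<le> t \<Longrightarrow> Z \<tau> \<bullet> n i = 0 \<Longrightarrow> \<bar>J t \<bullet> n i\<bar> \<le> q"
    by metis
  have "{a..e} \<subseteq> (\<Union>\<tau>\<in>{a..e}. ball \<tau> (\<delta> \<tau> / 2))"
    using loc'(1) by force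
  then obtain C where C: "C \<subseteq> {a..e}" "finite C" "{a..e} \<subseteq> (\<Union>\<tau>\<in>C. ball \<tau> (\<delta> \<tau> / 2))"
    by (rule compactE_image[OF compact_Icc open_ball])
  \<comment> \<open>The bound \<open>\<rho> \<tau>\<close> keeps faces inactive at \<tau> out of the
    sets \<open>I j\<close> near \<tau>; the bound \<open>\<delta> \<tau> / 4\<close> on the mesh
    keeps the first grid time after \<tau> inside the neighbourhood of \<tau>.\<close>
  define \<eta> where "\<eta> = Min (insert q ((\<lambda>\<tau>. min (\<rho> \<tau>) (\<delta> \<tau> / 4)) ` C))"
  have \<eta>: "0 < \<eta>" "\<eta> \<le> q" "\<And>\<tau>. \<tau> \<in> C \<Longrightarrow> \<eta> \<le> \<rho> \<tau>" "\<And>\<tau>. \<tau> \<in> C \<Longrightarrow> \<eta> \<le> \<delta> \<tau> / 4"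
  proof -
    have fin: "finite (insert q ((\<lambda>\<tau>. min (\<rho> \<tau>) (\<delta> \<tau> / 4)) ` C))" using C(2) by auto
    show "0 < \<eta>" unfolding \<eta>_def using fin q C(1) loc'(1)
      by (subst Min_gr_iff) (auto simp: subset_iff)
    show "\<eta> \<le> q" unfolding \<eta>_def using fin by (intro Min_le) auto
    have "\<eta> \<le> min (\<rho> \<tau>) (\<delta> \<tau> / 4)" if "\<tau> \<in> C" for \<tau>
      unfolding \<eta>_def using fin that by (intro Min_le) auto
    then show "\<And>\<tau>. \<tau> \<in> C \<Longrightarrow> \<eta> \<le> \<rho> \<tau>" "\<And>\<tau>. \<tau> \<in> C \<Longrightarrow> \<eta> \<le> \<delta> \<tau> / 4" by auto
  qed
  show thesis
  proof (rule that[OF \<eta>(1)])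
    fix N :: nat and Jd \<psi>d :: "nat \<Rightarrow> real^'n" and I :: "nat \<Rightarrow> 'n set"
    let ?t = "grid a e N"
    assume N: "0 < N" and mesh: "(e - a) / real N \<le> \<eta>" and J0: "Jd 0 - \<psi>d 0 = J a - \<psi> a"
      and Kd: "\<And>j. j < N \<Longrightarrow> (Jd (Suc j) - \<psi>d (Suc j)) - (Jd j - \<psi>d j) \<in> span (d ` I j)"
      and Jd: "\<And>j i. j < N \<Longrightarrow> i \<in> I j \<Longrightarrow> Jd (Suc j) \<bullet> n i = 0"
      and \<psi>: "\<And>j. j < N \<Longrightarrow> norm (\<psi>d (Suc j) - \<psi> (?t (Suc j))) \<le> \<eta>"
      and I1: "\<And>j. j < N \<Longrightarrow> hits Z (?t j) (?t (Suc j)) \<subseteq> I j"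
      and I2: "\<And>j i. j < N \<Longrightarrow> i \<in> I j \<Longrightarrow> Z (?t (Suc j)) \<bullet> n i \<le> \<eta>"
    have in1: "?t j \<in> {a..e}" if "j \<le> N" for j using grid_in[of a e j N] that ae N by auto
    \<comment> \<open>With the drivers removed, both increments lie in the span of the same
      directions, since \<open>I j\<close> contains the faces hit.\<close>
    define E where "E j = (Jd j - \<psi>d j) - (J (?t j) - \<psi> (?t j))" for j
    let ?l = "2 * (q + \<eta>) / \<theta> + 0 / rB"
    have c0: "0 \<le> q + \<eta>" "0 < q + \<eta> + 0" using q \<eta> by auto
    note size = gauge_size[OF c0(1) order.refl c0(2)]
    have Estep: "E (Suc j) - E j \<in> span (d ` I j)" if "j < N" for j
    proof -
      have "(J (?t (Suc j)) - \<psi> (?t (Suc j))) - (J (?t j) - \<psi> (?t j)) \<in> span (d ` hits Z (?t j) (?t (Suc j)))"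
        using in1[of j] in1[of "Suc j"] that grid_less[OF ae that] by (intro K) auto
      then have "(J (?t (Suc j)) - \<psi> (?t (Suc j))) - (J (?t j) - \<psi> (?t j)) \<in> span (d ` I j)"
        using span_mono[OF image_mono[OF I1[OF that]]] by blast
      from span_diff[OF Kd[OF that] this] show ?thesis by (simp add: E_def algebra_simps)
    qed
    have Esmall: "\<bar>E (Suc j) \<bullet> n i\<bar> \<le> q + \<eta>" if "j < N" "i \<in> I j" "\<bar>J (?t (Suc j)) \<bullet> n i\<bar> \<le> q" for j i
    proof -
      have "E (Suc j) \<bullet> n i = - ((\<psi>d (Suc j) - \<psi> (?t (Suc j))) \<bullet> n i) - J (?t (Suc j)) \<bullet> n i"
        using Jd[OF that(1,2)] by (simp add: E_def inner_diff_left)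
      moreover have "\<bar>(\<psi>d (Suc j) - \<psi> (?t (Suc j))) \<bullet> n i\<bar> \<le> \<eta>"
        using Cauchy_Schwarz_ineq2[of "\<psi>d (Suc j) - \<psi> (?t (Suc j))" "n i"] n_unit[of i] \<psi>[OF that(1)] by simp
      ultimately show ?thesis using that(3) by linarith
    qed
    \<comment> \<open>Membership is not shown for every index: before a time at which
      \<open>J\<close> jumps, its constraints may fail. It suffices that from each good index a
      later good one can be reached.\<close>
    define S where "S = {j. j \<le> N \<and> E j /\<^sub>R ?l \<in> B}"
    have S: "finite S" "S \<noteq> {}"
    proof -
      show "finite S" by (simp add: S_def)
      have "0 \<in> S" using J0 zero_in_B by (simp add: S_def E_def)
      then show "S \<noteq> {}" by auto
    qed
    have next_good: "\<exists>j'>j. j' \<in> S" if j: "j \<in> S" "j < N" for j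
    proof -
      have EB: "E j /\<^sub>R ?l \<in> B" using j by (simp add: S_def)
      obtain \<tau> where \<tau>: "\<tau> \<in> C" "\<bar>?t (Suc j) - \<tau>\<bar> < \<delta> \<tau> / 2"
        using C(3) in1[of "Suc j"] j(2) by (fastforce simp: dist_real_def abs_minus_commute)
      have \<tau>': "\<tau> \<in> {a..e}" using \<tau>(1) C(1) by auto
      have mesh': "(e - a) / real N \<le> \<delta> \<tau> / 4" using mesh \<eta>(4)[OF \<tau>(1)] by linarith
      have \<delta>pos: "0 < \<delta> \<tau>" using loc'(1)[OF \<tau>'] by simp
      have Iact: "Z \<tau> \<bullet> n i = 0" if "k < N" "\<bar>?t (Suc k) - \<tau>\<bar> < \<delta> \<tau>" "i \<in> I k" for k i
      proof (rule ccontr)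
        assume "Z \<tau> \<bullet> n i \<noteq> 0"
        then have "\<rho> \<tau> < Z (?t (Suc k)) \<bullet> n i"
          using that(1) by (intro loc'(2)[OF \<tau>' in1 that(2)]) auto
        then show False using I2[OF that(1,3)] \<eta>(3)[OF \<tau>(1)] by linarith
      qed
      show ?thesis
      proof (cases "\<tau> \<le> ?t (Suc j)")
        case True
        have near: "\<bar>?t (Suc j) - \<tau>\<bar> < \<delta> \<tau>" using \<tau>(2) \<delta>pos by linarith
        have "(E j + (E (Suc j) - E j)) /\<^sub>R ?l \<in> B"
        proof (rule span_step_in_B[OF EB c0(1) size(2) Estep[OF j(2)]])
          fix i assume i: "i \<in> I j"
          have "\<bar>J (?t (Suc j)) \<bullet> n i\<bar> \<le> q"
            using j(2) by (intro loc'(3)[OF \<tau>' in1 near True] Iact[OF j(2) near i]) auto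
          then show "\<bar>(E j + (E (Suc j) - E j)) \<bullet> n i\<bar> \<le> q + \<eta>" using Esmall[OF j(2) i] by simp
        qed
        then show ?thesis using j(2) by (intro exI[of _ "Suc j"]) (auto simp: S_def)
      next
        case False
        have ex: "\<tau> \<le> ?t N" using \<tau>' N by simp
        \<comment> \<open>Here \<tau> lies ahead, and the estimate for \<open>J\<close> holds only
          from \<tau> on. All steps up to the first grid time past \<tau> are therefore merged into
          one; they use only directions of faces active at \<tau>.\<close>
        define k where "k = (LEAST k. \<tau> \<le> ?t k)"
        have k: "\<tau> \<le> ?t k" "k \<le> N" "\<And>m. m < k \<Longrightarrow> ?t m < \<tau>"
          using LeastI[of "\<lambda>k. \<tau> \<le> ?t k", OF ex] Least_le[of "\<lambda>k. \<tau> \<le> ?t k", OF ex]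
            not_less_Least[of _ "\<lambda>k. \<tau> \<le> ?t k"] by (auto simp: k_def not_le)
        have jk: "Suc j < k"
          using False k(1) grid_mono[of a e k "Suc j" N] ae by (meson less_imp_le not_le order_trans)
        then obtain k' where k': "k = Suc k'" by (cases k) auto
        have near: "\<bar>?t (Suc m) - \<tau>\<bar> < \<delta> \<tau>" if "j \<le> m" "m < k" for m
        proof -
          have "?t (Suc j) \<le> ?t (Suc m)" "?t (Suc m) \<le> ?t (Suc k')"
            using that k' ae by (auto intro!: grid_mono)
          moreover have "?t (Suc k') < \<tau> + \<delta> \<tau> / 2"
            using k(3)[of k'] k' mesh' \<delta>pos unfolding grid_Suc by linarith
          ultimately show ?thesis using \<tau>(2) \<delta>pos by linarith
        qed
        define A where "A = {i. Z \<tau> \<bullet> n i = 0}"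
        have "E m - E j \<in> span (d ` A)" if "j \<le> m" "m \<le> k" for m
          using that
        proof (induction m)
          case 0 then show ?case by (simp add: span_zero)
        next
          case (Suc m)
          show ?case
          proof (cases "Suc m = j")
            case True then show ?thesis by (simp add: span_zero)
          next
            case False
            then have m: "j \<le> m" "m < k" "m < N" using Suc.prems k(2) by auto
            have "I m \<subseteq> A" using Iact[OF m(3) near[OF m(1,2)]] by (auto simp: A_def)
            from span_mono[OF image_mono[OF this]] Estep[OF m(3)]
            have "E (Suc m) - E m \<in> span (d ` A)" by blast
            from span_add[OF this Suc.IH[OF m(1) less_imp_le[OF m(2)]]] show ?thesis
              by (simp only: diff_add_cancel add_diff_eq)
          qed
        qed
        then have Ek: "E k - E j \<in> span (d ` A)" using jk by simp
        have "(E j + (E k - E j)) /\<^sub>R ?l \<in> B"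
        proof (rule span_step_in_B[OF EB c0(1) size(2) Ek])
          fix i assume i: "i \<in> A"
          have k'N: "k' < N" "j \<le> k'" "k' < k" using k(2) k' jk by auto
          have t1: "?t k' < \<tau>" "\<tau> \<le> ?t (Suc k')" using k(3)[OF k'N(3)] k(1) by (simp_all only: k')
          have Z0: "Z \<tau> \<bullet> n i = 0" using i by (simp add: A_def)
          \<comment> \<open>The last of the merged steps contains \<tau> itself, so every face
            active at \<tau> is hit in it and \<open>Jd\<close> satisfies all these constraints at
            its end.\<close>
          have "i \<in> hits Z (?t k') (?t (Suc k'))" unfolding hits_def using t1 Z0 by force
          then have ik: "i \<in> I k'" using I1[OF k'N(1)] by blast
          have "?t (Suc k') \<in> {a..e}" using k'N(1) by (intro in1) simp
          from loc'(3)[OF \<tau>' this near[OF k'N(2,3)] t1(2) Z0]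
          show "\<bar>(E j + (E k - E j)) \<bullet> n i\<bar> \<le> q + \<eta>"
            using Esmall[OF k'N(1) ik] by (simp only: k' add_diff_cancel_left' add_diff_eq)
        qed
        then show ?thesis using jk k(2) by (intro exI[of _ k]) (auto simp: S_def)
      qed
    qed
    have "Max S = N"
    proof (rule ccontr)
      assume "Max S \<noteq> N"
      moreover have "Max S \<in> S" using S by simp
      ultimately have "Max S \<in> S" "Max S < N" by (auto simp: S_def)
      from next_good[OF this] show False using S by (metis Max_ge not_le)
    qed
    then have "E N /\<^sub>R ?l \<in> B" using Max_in[OF S] by (simp add: S_def)
    then have EN: "norm (E N) \<le> CB * (q + \<eta> + 0)" by (rule size(4))
    obtain N' where N': "N = Suc N'" using N by (cases N) auto
    have "norm (\<psi>d N - \<psi> e) \<le> \<eta>" using \<psi>[of N'] N' grid_N[OF N, of a e] by simp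
    moreover have "Jd N - J e = E N + (\<psi>d N - \<psi> e)" using N by (simp add: E_def)
    ultimately have "norm (Jd N - J e) \<le> CB * (q + \<eta>) + \<eta>"
      using EN norm_triangle_ineq[of "E N" "\<psi>d N - \<psi> e"] by simp
    also have "\<dots> \<le> CB * (2 * q) + 2 * q"
      using \<eta>(2) q CB_pos by (intro add_mono mult_left_mono) auto
    also have "\<dots> = 2 * ((CB + 1) * q)" by (simp add: algebra_simps)
    also have "(CB + 1) * q = \<epsilon> / 4"
    proof -
      have "s * (\<epsilon> / (4 * s)) = \<epsilon> / 4" if "0 < s" for s :: real using that by simp
      from this[of "CB + 1"] show ?thesis using CB_pos by (simp add: q_def)
    qed
    finally show "norm (Jd N - J e) \<le> \<epsilon>" using \<epsilon> by simp
  qed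
qed

text \<open>There is no induction over time for \<open>J\<close> itself. Its approximating scheme is
  a sequence of projection steps, and since \<open>y\<close> satisfies the constraints of every face
  that is hit, these steps preserve a multiple of \<open>B\<close> around \<open>y\<close>; the
  bound passes to \<open>J\<close> in the limit.\<close>

lemma derivative_near:
  fixes J \<psi> :: "real \<Rightarrow> real^'n"
  assumes ae: "a < e" and Zc: "continuous_on {a..e} Z"
    and Zn: "\<And>t i. a \<le> t \<Longrightarrow> t \<le> e \<Longrightarrow> 0 \<le> Z t \<bullet> n i"
    and Jr: "\<And>t. a \<le> t \<Longrightarrow> t < e \<Longrightarrow> (J \<longlongrightarrow> J t) (at_right t)"
    and Jf: "\<And>t i. a \<le> t \<Longrightarrow> t \<le> e \<Longrightarrow> Z t \<bullet> n i = 0 \<Longrightarrow> J t \<bullet> n i = 0"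
    and K: "\<And>s t. a \<le> s \<Longrightarrow> s < t \<Longrightarrow> t \<le> e \<Longrightarrow> (J t - \<psi> t) - (J s - \<psi> s) \<in> span (d ` hits Z s t)"
    and y: "\<And>t i. a \<le> t \<Longrightarrow> t \<le> e \<Longrightarrow> Z t \<bullet> n i = 0 \<Longrightarrow> y \<bullet> n i = 0"
    and c: "0 < c" "\<And>t. a \<le> t \<Longrightarrow> t \<le> e \<Longrightarrow> norm (\<psi> t - \<psi> a) \<le> c"
  shows "norm (J e - y) \<le> (CB + 1) * (c + norm (J a - y))"
proof -
  have "norm (J e - y) \<le> (CB + 1) * (c + norm (J a - y)) + \<epsilon>" if \<epsilon>: "0 < \<epsilon>" for \<epsilon>
  proof -
    obtain \<eta> where \<eta>: "0 < \<eta>"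
      "\<And>N Jd \<psi>d I. \<lbrakk>0 < N; (e - a) / real N \<le> \<eta>; Jd 0 - \<psi>d 0 = J a - \<psi> a;
      \<And>j. j < N \<Longrightarrow> (Jd (Suc j) - \<psi>d (Suc j)) - (Jd j - \<psi>d j) \<in> span (d ` I j);
      \<And>j i. j < N \<Longrightarrow> i \<in> I j \<Longrightarrow> Jd (Suc j) \<bullet> n i = 0;
      \<And>j. j < N \<Longrightarrow> norm (\<psi>d (Suc j) - \<psi> (grid a e N (Suc j))) \<le> \<eta>;
      \<And>j. j < N \<Longrightarrow> hits Z (grid a e N j) (grid a e N (Suc j)) \<subseteq> I j;
      \<And>j i. j < N \<Longrightarrow> i \<in> I j \<Longrightarrow> Z (grid a e N (Suc j)) \<bullet> n i \<le> \<eta>\<rbrakk>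
      \<Longrightarrow> norm (Jd N - J e) \<le> \<epsilon>"
      using derivative_scheme_converges[OF ae Zc Zn Jr Jf K \<epsilon>] by blast
    have "uniformly_continuous_on {a..e} Z" using Zc by (auto intro: compact_uniformly_continuous)
    then obtain \<delta> where \<delta>: "0 < \<delta>" "\<And>u v. u \<in> {a..e} \<Longrightarrow> v \<in> {a..e} \<Longrightarrow> dist v u < \<delta> \<Longrightarrow> dist (Z v) (Z u) < \<eta>"
      using \<eta>(1) unfolding uniformly_continuous_on_def by blast
    obtain N where N: "0 < N" "(e - a) / real N < min \<delta> \<eta>"
      using fine_grid[of "min \<delta> \<eta>" "e - a"] \<delta>(1) \<eta>(1) by auto
    let ?t = "grid a e N"
    have in1: "?t j \<in> {a..e}" if "j \<le> N" for j using grid_in[of a e j N] that ae N by auto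
    \<comment> \<open>The smallest admissible choice, so that \<open>y\<close> is tangent to every
      face of \<open>I j\<close>.\<close>
    define I where "I j = hits Z (?t j) (?t (Suc j))" for j
    define Jd where "Jd = rec_nat (J a) (\<lambda>j x. oblique_proj (I j) (x + (\<psi> (?t (Suc j)) - \<psi> (?t j))))"
    have Jd: "Jd 0 = J a" "Jd (Suc j) = oblique_proj (I j) (Jd j + (\<psi> (?t (Suc j)) - \<psi> (?t j)))" for j
      by (simp_all add: Jd_def)
    have step: "(Jd (Suc j) - \<psi> (?t (Suc j))) - (Jd j - \<psi> (?t j)) \<in> span (d ` I j)" for j
      using oblique_proj(2)[of "I j" "Jd j + (\<psi> (?t (Suc j)) - \<psi> (?t j))"]
      by (simp only: Jd) (simp add: algebra_simps)
    have Jd0: "Jd (Suc j) \<bullet> n i = 0" if "i \<in> I j" for i j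
      using oblique_proj(3)[OF that] by (simp add: Jd)
    have "norm (Jd N - J e) \<le> \<epsilon>"
    proof (rule \<eta>(2)[where I = I and \<psi>d = "\<lambda>j. \<psi> (?t j)"])
      fix j i assume j: "j < N" "i \<in> I j"
      show "Z (?t (Suc j)) \<bullet> n i \<le> \<eta>"
      proof (rule hits_small[of i Z "?t j" "?t (Suc j)"])
        fix u assume u: "?t j < u" "u \<le> ?t (Suc j)"
        have "dist (Z (?t (Suc j))) (Z u) < \<eta>"
          using u N(2) in1[of j] in1[of "Suc j"] j by (intro \<delta>(2)) (auto simp: dist_real_def grid_Suc)
        then show "norm (Z (?t (Suc j)) - Z u) \<le> \<eta>" by (simp add: dist_norm)
      qed (use j in \<open>auto simp: I_def\<close>)
    qed (use N \<eta>(1) Jd step Jd0 in \<open>auto simp: I_def\<close>)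
    moreover
    \<comment> \<open>The deviation from \<open>y\<close> without the driver. On a face of
      \<open>I j\<close> only the displacement of the driver is left of it, which is at most
      \<open>c\<close>.\<close>
    define E where "E j = (Jd j - \<psi> (?t j)) - (y - \<psi> a)" for j
    let ?e = "norm (J a - y)"
    let ?l = "2 * c / \<theta> + ?e / rB"
    have c0: "0 \<le> c" "0 < c + ?e" using c by (auto simp: add_pos_nonneg)
    note size = gauge_size[OF c0(1) norm_ge_zero c0(2)]
    have "E j /\<^sub>R ?l \<in> B" if "j \<le> N" for j
      using that
    proof (induction j)
      case 0
      show ?case by (intro size(3)) (simp add: E_def Jd)
    next
      case (Suc j)
      then have j: "j < N" and IH: "E j /\<^sub>R ?l \<in> B" by auto
      have "E (Suc j) - E j \<in> span (d ` I j)" using step[of j] by (simp add: E_def algebra_simps)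
      then have "(E j + (E (Suc j) - E j)) /\<^sub>R ?l \<in> B"
      proof (rule span_step_in_B[OF IH c0(1) size(2)])
        fix i assume i: "i \<in> I j"
        then obtain u where u: "?t j < u" "u \<le> ?t (Suc j)" "Z u \<bullet> n i = 0" by (auto simp: I_def hits_def)
        have "y \<bullet> n i = 0" using u in1[of j] in1[of "Suc j"] j by (intro y[of u]) auto
        then have "E (Suc j) \<bullet> n i = - ((\<psi> (?t (Suc j)) - \<psi> a) \<bullet> n i)"
          using Jd0[OF i] by (simp add: E_def inner_diff_left)
        then show "\<bar>(E j + (E (Suc j) - E j)) \<bullet> n i\<bar> \<le> c"
          using Cauchy_Schwarz_ineq2[of "\<psi> (?t (Suc j)) - \<psi> a" "n i"] n_unit[of i] c(2)[of "?t (Suc j)"] in1[of "Suc j"] j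
          by simp
      qed
      then show ?case by simp
    qed
    then have "norm (E N) \<le> CB * (c + ?e)" by (intro size(4)) auto
    moreover have eq: "J e - y = E N + (\<psi> e - \<psi> a) - (Jd N - J e)" using N by (simp add: E_def)
    have "norm (J e - y) \<le> norm (E N) + norm (\<psi> e - \<psi> a) + norm (Jd N - J e)"
      using norm_triangle_ineq4[of "E N + (\<psi> e - \<psi> a)" "Jd N - J e"]
        norm_triangle_ineq[of "E N" "\<psi> e - \<psi> a"] unfolding eq by linarith
    moreover have "norm (\<psi> e - \<psi> a) \<le> c" using c(2) ae by simp
    ultimately have "norm (J e - y) \<le> CB * (c + ?e) + c + \<epsilon>" by linarith
    also have "\<dots> \<le> (CB + 1) * (c + ?e) + \<epsilon>" by (simp add: distrib_right)
    finally show ?thesis .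
  qed
  then show ?thesis by (rule field_le_epsilon)
qed

end

section \<open>Square roots of positive definite matrices\<close>

lemma symmetric_iff:
  fixes A :: "real^'n^'n"
  shows "transpose A = A \<longleftrightarrow> (\<forall>x y. (A *v x) \<bullet> y = x \<bullet> (A *v y))"
proof
  assume A: "transpose A = A"
  show "\<forall>x y. (A *v x) \<bullet> y = x \<bullet> (A *v y)"
    by (metis A dot_lmul_matrix transpose_matrix_vector)
next
  assume A: "\<forall>x y. (A *v x) \<bullet> y = x \<bullet> (A *v y)"
  have "transpose A *v x = A *v x" for x
    using A by (metis dot_lmul_matrix transpose_matrix_vector vector_eq_rdot)
  then show "transpose A = A" by (simp add: matrix_eq)
qed

text \<open>By symmetry of \<open>D\<close>, the diagonal entries of the product are the values of
  the quadratic form of \<open>S\<close> at the columns of \<open>D\<close>.\<close>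

lemma trace_conj_nonneg:
  fixes D S :: "real^'n^'n"
  assumes "transpose D = D" "pos_def_sym S"
  shows "0 \<le> trace (D ** (S ** D))" "trace (D ** (S ** D)) = 0 \<Longrightarrow> D = 0"
proof -
  have eq: "(D ** (S ** D)) $ i $ i = column i D \<bullet> (S *v column i D)" for i
  proof -
    have "D $ i $ k = D $ k $ i" for k using assms(1) by (metis transpose_def vec_lambda_beta)
    then show ?thesis
      by (simp add: matrix_matrix_mult_def inner_vec_def matrix_vector_mult_def column_def)
  qed
  have nn: "0 \<le> column i D \<bullet> (S *v column i D)" for i
    using assms(2) by (cases "column i D = 0") (auto simp: pos_def_sym_def less_imp_le)
  show "0 \<le> trace (D ** (S ** D))"
    unfolding trace_def eq using nn by (intro sum_nonneg)
  assume "trace (D ** (S ** D)) = 0"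
  then have "column i D \<bullet> (S *v column i D) = 0" for i
    unfolding trace_def eq using nn by (subst (asm) sum_nonneg_eq_0_iff) auto
  then have "column i D = 0" for i
    using assms(2) by (metis less_irrefl pos_def_sym_def)
  then show "D = 0" by (simp add: vec_eq_iff column_def)
qed

text \<open>With \<open>D = S - T\<close>, equality of the squares reads
  \<open>S ** D + D ** T = 0\<close>. Multiplying by \<open>D\<close> and taking the trace gives two
  nonnegative terms with sum 0.\<close>

lemma pd_sqrt_unique:
  fixes S T :: "real^'n^'n"
  assumes S: "pos_def_sym S" and T: "pos_def_sym T" and eq: "S ** S = T ** T"
  shows "S = T"
proof -
  define D where "D = S - T"
  have D: "transpose D = D"
    using S T by (simp add: D_def pos_def_sym_def transpose_def vec_eq_iff)
  have "S ** D + D ** T = 0"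
  proof -
    have "S *v (S *v x) = T *v (T *v x)" for x
      using eq by (simp add: matrix_vector_mul_assoc)
    then show ?thesis
      by (simp add: D_def matrix_eq matrix_vector_mult_add_rdistrib matrix_vector_mult_diff_rdistrib
          matrix_vector_mult_diff_distrib matrix_vector_mul_assoc[symmetric])
  qed
  then have "(S ** D) *v x + (D ** T) *v x = 0" for x
    by (metis matrix_vector_mult_add_rdistrib matrix_vector_mult_0)
  then have "(S ** D) ** D + (D ** T) ** D = 0"
    by (simp add: matrix_eq matrix_vector_mult_add_rdistrib matrix_vector_mul_assoc[symmetric])
  then have "trace ((S ** D) ** D) + trace ((D ** T) ** D) = 0"
    by (metis trace_add trace_0 mat_0)
  moreover have "trace ((S ** D) ** D) = trace (D ** (S ** D))"
    by (rule trace_mul_sym)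
  ultimately have "trace (D ** (S ** D)) + trace (D ** (T ** D)) = 0"
    by (simp add: matrix_mul_assoc)
  then have "trace (D ** (S ** D)) = 0"
    using trace_conj_nonneg(1)[OF D S] trace_conj_nonneg(1)[OF D T] by linarith
  then have "D = 0" using trace_conj_nonneg(2)[OF D S] by simp
  then show ?thesis by (simp add: D_def)
qed

lemma pos_def_bounds:
  fixes A :: "real^'n^'n"
  assumes "pos_def_sym A"
  obtains m M where "0 < m" "m \<le> M" "\<And>x. m * (norm x)\<^sup>2 \<le> x \<bullet> (A *v x)" "\<And>x. norm (A *v x) \<le> M * norm x"
proof -
  obtain M where M: "0 < M" "\<And>x. norm (A *v x) \<le> norm x * M"
    using bounded_linear.pos_bounded[OF matrix_vector_mul_bounded_linear[of A]] by blast
  obtain k :: "real^'n" where k: "norm k = 1" using vector_choose_size[of 1] by auto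
  have "continuous_on (sphere 0 1) (\<lambda>x. x \<bullet> (A *v x))"
    by (intro continuous_intros matrix_vector_mult_linear_continuous_on)
  moreover have "k \<in> sphere 0 1" using k by simp
  ultimately obtain z where z: "z \<in> sphere 0 1" "\<And>x. x \<in> sphere 0 1 \<Longrightarrow> z \<bullet> (A *v z) \<le> x \<bullet> (A *v x)"
    using continuous_attains_inf[of "sphere 0 1" "\<lambda>x. x \<bullet> (A *v x)"] by (metis compact_sphere emptyE)
  define m where "m = z \<bullet> (A *v z)"
  have zn: "z \<noteq> 0" using z(1) by auto
  have m0: "0 < m" using assms zn by (simp add: m_def pos_def_sym_def)
  have mx: "m * (norm x)\<^sup>2 \<le> x \<bullet> (A *v x)" for x
  proof (cases "x = 0")
    case False
    have "m \<le> (x /\<^sub>R norm x) \<bullet> (A *v (x /\<^sub>R norm x))" unfolding m_def using False by (intro z(2)) simp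
    also have "\<dots> = (x \<bullet> (A *v x)) / (norm x)\<^sup>2"
      by (simp add: scaleR_matrix_vector_assoc[symmetric] matrix_vector_mult_scaleR power2_eq_square field_simps)
    finally show ?thesis using False by (simp add: field_simps)
  qed simp
  have "m \<le> M"
  proof -
    have "m \<le> norm z * norm (A *v z)" unfolding m_def by (rule norm_cauchy_schwarz)
    then show ?thesis using M(2)[of z] z(1) by simp
  qed
  then show thesis using that[OF m0 _ mx, of M] M(2) by (simp add: mult.commute)
qed

text \<open>The square root of \<open>c *\<^sub>R A\<close> is sought as the identity minus
  \<open>Y\<close>. Then \<open>Y\<close> is a fixed point of \<open>f\<close>, half of
  \<open>B\<close> plus the square of \<open>Y\<close>, where \<open>B\<close> is the identity minus
  \<open>c *\<^sub>R A\<close>; Banach's theorem yields it without diagonalisation.\<close>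

lemma pd_sqrt_exists:
  fixes A :: "real^'n^'n"
  assumes A: "pos_def_sym A"
  shows "\<exists>S. pos_def_sym S \<and> S ** S = A"
proof -
  obtain m M where mM: "0 < m" "m \<le> M" "\<And>x. m * (norm x)\<^sup>2 \<le> x \<bullet> (A *v x)"
    "\<And>x. norm (A *v x) \<le> M * norm x"
    using pos_def_bounds[OF A] by blast
  \<comment> \<open>The minimiser of \<open>1 - 2 * c * m + c\<^sup>2 * M\<^sup>2\<close>, which
    bounds the squared norm of \<open>B\<close>; the minimum is the square of
    \<open>q\<close>.\<close>
  define c where "c = m / M\<^sup>2"
  have M0: "0 < M" using mM by linarith
  have c: "0 < c" using mM(1) M0 by (simp add: c_def)
  define q where "q = sqrt (1 - m\<^sup>2 / M\<^sup>2)"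
  have mM2: "0 < m\<^sup>2 / M\<^sup>2" "m\<^sup>2 / M\<^sup>2 \<le> 1"
    using mM M0 by (auto simp: power_mono)
  have q: "0 \<le> q" "q < 1" "q\<^sup>2 = 1 - m\<^sup>2 / M\<^sup>2"
    using mM2 by (auto simp: q_def real_less_lsqrt)
  define B where "B = id_blinfun - c *\<^sub>R Blinfun ((*v) A)"
  have B_app: "blinfun_apply B x = x - c *\<^sub>R (A *v x)" for x
    by (simp add: B_def blinfun.diff_left blinfun.scaleR_left bounded_linear_Blinfun_apply matrix_vector_mul_bounded_linear)
  have normB: "norm B \<le> q"
  proof (rule norm_blinfun_bound[OF q(1)])
    fix x
    have "(norm (x - c *\<^sub>R (A *v x)))\<^sup>2 = (norm x)\<^sup>2 - 2 * c * (x \<bullet> (A *v x)) + c\<^sup>2 * (norm (A *v x))\<^sup>2"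
      unfolding power2_norm_eq_inner power2_eq_square[of c]
      by (simp add: inner_diff_left inner_diff_right inner_commute algebra_simps)
    also have "\<dots> \<le> (norm x)\<^sup>2 - 2 * c * (m * (norm x)\<^sup>2) + c\<^sup>2 * (M * norm x)\<^sup>2"
      using mM(3,4) c by (intro add_mono diff_mono mult_left_mono power_mono) auto
    also have "\<dots> = (1 - 2 * c * m + c\<^sup>2 * M\<^sup>2) * (norm x)\<^sup>2" by (simp add: algebra_simps)
    also have "1 - 2 * c * m + c\<^sup>2 * M\<^sup>2 = q\<^sup>2"
      unfolding q(3) c_def using M0 by (simp add: power2_eq_square field_simps)
    finally have "norm (x - c *\<^sub>R (A *v x)) \<le> q * norm x"
      using q(1) by (metis power_mult_distrib power2_le_imp_le mult_nonneg_nonneg norm_ge_zero)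
    then show "norm (blinfun_apply B x) \<le> q * norm x" by (simp add: B_app)
  qed
  \<comment> \<open>The smaller root of \<open>(q + r * r) / 2 = r\<close>: the ball of radius
    \<open>r\<close> is mapped into itself, and \<open>f\<close> contracts there by the factor
    \<open>r\<close>.\<close>
  define r where "r = 1 - sqrt (1 - q)"
  have r: "0 \<le> r" "r < 1" using q by (auto simp: r_def)
  have rq: "(q + r * r) / 2 = r"
  proof -
    have "(1 - r) * (1 - r) = 1 - q" using q by (simp add: r_def)
    then show ?thesis by (simp add: algebra_simps)
  qed
  \<comment> \<open>Symmetry is a closed condition preserved by \<open>f\<close>, so it is built
    into the domain instead of being derived afterwards.\<close>
  define X where "X = {Y :: (real^'n) \<Rightarrow>\<^sub>L (real^'n). norm Y \<le> r \<and> (\<forall>x y. blinfun_apply Y x \<bullet> y = x \<bullet> blinfun_apply Y y)}"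
  define f where "f Y = (1/2) *\<^sub>R (B + (Y o\<^sub>L Y))" for Y
  have Asym: "(A *v x) \<bullet> y = x \<bullet> (A *v y)" for x y
    using A symmetric_iff[of A] by (auto simp: pos_def_sym_def)
  have cl: "closed X"
      unfolding X_def Collect_conj_eq Collect_all_eq
      by (intro closed_Int closed_INT ballI closed_Collect_le closed_Collect_eq continuous_intros)
  have "\<exists>!Y\<in>X. f Y = Y"
  proof (rule Banach_fix[OF complete_eq_closed[THEN iffD2, OF cl] _ r])
    show "X \<noteq> {}" using r by (auto simp: X_def intro!: exI[of _ 0])
    show "f ` X \<subseteq> X"
    proof
      fix Z assume "Z \<in> f ` X"
      then obtain Y where Y: "norm Y \<le> r" "\<And>x y. blinfun_apply Y x \<bullet> y = x \<bullet> blinfun_apply Y y" "Z = f Y"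
        by (auto simp: X_def)
      have "norm (B + (Y o\<^sub>L Y)) \<le> q + r * r"
        using normB norm_blinfun_compose[of Y Y] mult_mono[OF Y(1) Y(1) r(1) norm_ge_zero]
          norm_triangle_ineq[of B "Y o\<^sub>L Y"] by linarith
      then have "norm Z \<le> r" using rq Y(3) by (simp add: f_def)
      moreover have "blinfun_apply Z x \<bullet> y = x \<bullet> blinfun_apply Z y" for x y
        using Y(2) by (simp add: Y(3) f_def B_app blinfun.add_left blinfun.scaleR_left
            inner_add_left inner_add_right inner_diff_left inner_diff_right Asym)
      ultimately show "Z \<in> X" by (simp add: X_def)
    qed
    fix Y Y' assume "Y \<in> X" "Y' \<in> X"
    then have Y: "norm Y \<le> r" "norm Y' \<le> r" by (auto simp: X_def)
    have "f Y - f Y' = (1/2) *\<^sub>R ((Y o\<^sub>L (Y - Y')) + ((Y - Y') o\<^sub>L Y'))"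
      unfolding f_def
      by (intro blinfun_eqI) (simp add: blinfun.diff_left blinfun.add_left blinfun.scaleR_left blinfun.diff_right algebra_simps)
    then have "norm (f Y - f Y') \<le> (norm (Y o\<^sub>L (Y - Y')) + norm ((Y - Y') o\<^sub>L Y')) / 2"
      using norm_triangle_ineq[of "Y o\<^sub>L (Y - Y')" "(Y - Y') o\<^sub>L Y'"] by simp
    also have "\<dots> \<le> (r * norm (Y - Y') + norm (Y - Y') * r) / 2"
      using norm_blinfun_compose[of Y "Y - Y'"] norm_blinfun_compose[of "Y - Y'" Y']
        mult_right_mono[OF Y(1), of "norm (Y - Y')"] mult_left_mono[OF Y(2), of "norm (Y - Y')"]
      by (intro divide_right_mono add_mono) auto
    finally show "dist (f Y) (f Y') \<le> r * dist Y Y'" by (simp add: dist_norm)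
  qed
  then obtain Y where Y: "norm Y \<le> r" "\<And>x y. blinfun_apply Y x \<bullet> y = x \<bullet> blinfun_apply Y y" "f Y = Y"
    by (auto simp: X_def)
  have YY: "blinfun_apply Y (blinfun_apply Y x) = 2 *\<^sub>R blinfun_apply Y x - x + c *\<^sub>R (A *v x)" for x
  proof -
    have "2 *\<^sub>R blinfun_apply Y x = 2 *\<^sub>R blinfun_apply (f Y) x" by (simp add: Y(3))
    also have "\<dots> = x - c *\<^sub>R (A *v x) + blinfun_apply Y (blinfun_apply Y x)"
      by (simp add: f_def B_app blinfun.add_left blinfun.scaleR_left)
    finally show ?thesis by simp
  qed
  define s where "s = 1 / sqrt c"
  have s: "0 < s" "s * s * c = 1" using c by (auto simp: s_def)
  define S where "S = matrix (\<lambda>x. s *\<^sub>R (x - blinfun_apply Y x))"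
  have lin: "linear (\<lambda>x. s *\<^sub>R (x - blinfun_apply Y x))"
    by (rule linearI) (simp_all add: blinfun.add_right blinfun.scaleR_right algebra_simps)
  have S_app: "S *v x = s *\<^sub>R (x - blinfun_apply Y x)" for x
    unfolding S_def using lin by (simp add: matrix_works)
  have "transpose S = S"
    unfolding symmetric_iff using Y(2) by (simp add: S_app inner_diff_left inner_diff_right)
  moreover have "0 < x \<bullet> (S *v x)" if "x \<noteq> 0" for x
  proof -
    have "x \<bullet> blinfun_apply Y x \<le> norm x * norm (blinfun_apply Y x)" by (rule norm_cauchy_schwarz)
    also have "\<dots> \<le> norm x * (r * norm x)"
      using norm_blinfun[of Y x] mult_right_mono[OF Y(1), of "norm x"] by (intro mult_left_mono) auto
    also have "\<dots> < norm x * norm x" using r that by simp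
    also have "\<dots> = x \<bullet> x" by (metis power2_norm_eq_inner power2_eq_square)
    finally show ?thesis using s by (simp add: S_app inner_diff_right)
  qed
  moreover have "S ** S = A"
  proof -
    have "(S ** S) *v x = A *v x" for x
    proof -
      have "(S ** S) *v x = (s * s) *\<^sub>R (x - 2 *\<^sub>R blinfun_apply Y x + blinfun_apply Y (blinfun_apply Y x))"
        by (simp add: matrix_vector_mul_assoc[symmetric] S_app blinfun.diff_right blinfun.scaleR_right algebra_simps scaleR_2)
      also have "\<dots> = (s * s * c) *\<^sub>R (A *v x)" by (simp add: YY)
      finally show ?thesis by (simp add: s)
    qed
    then show ?thesis by (simp add: matrix_eq)
  qed
  ultimately show ?thesis unfolding pos_def_sym_def by blast
qed

lemma pos_def_sym_pd_sqrt:
  fixes A :: "real^'n^'n"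
  assumes "pos_def_sym A"
  shows "pos_def_sym (pd_sqrt A)"
proof -
  have "\<exists>!S. pos_def_sym S \<and> S ** S = A"
    using pd_sqrt_exists[OF assms] pd_sqrt_unique by (metis (full_types))
  from theI'[OF this] show ?thesis by (simp add: pd_sqrt_def)
qed

section \<open>The Euler scheme\<close>

text \<open>At the fixed parameter, \<open>b0\<close> and \<sigma> are the drift and the dispersion,
  \<open>b1\<close> and \<sigma>1 their derivatives, \<open>Q\<close> is the derivative of the
  reflection matrix times its inverse, so that \<open>Q *v Y\<close> is the local time term, and
  \<pi> is the map of the projection condition.\<close>

locale euler_data = set_B_data n d B \<theta>
  for n d :: "'n::finite \<Rightarrow> real^'n" and B \<theta> +
  fixes b0 b1 :: "real^'n" and \<sigma> \<sigma>1 Q :: "real^'n^'n" and \<pi> :: "real^'n \<Rightarrow> real^'n"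
  assumes proj_cone: "0 \<le> \<pi> x \<bullet> n i"
    and proj_push: "\<pi> x - x \<in> convex_cone hull (d ` {i. \<pi> x \<bullet> n i = 0})"
begin

text \<open>A projection is a Skorokhod problem with a single step in which the push goes from 0 to
  \<open>\<pi> x - x\<close>; faces used are exactly active, so the slack is 0.\<close>

lemma proj_lipschitz: "norm (\<pi> x - \<pi> x') \<le> (CB + 1) * norm (x - x')"
proof (cases "x = x'")
  case False
  have "norm ((if 1 = (0::nat) then 0 else \<pi> x - x) - (if 1 = (0::nat) then 0 else \<pi> x' - x'))
      \<le> CB * (norm (x - x') + 0)"
    by (rule discrete_skorokhod_lipschitz[where N = 1 and Z = "\<lambda>_. \<pi> x" and Z' = "\<lambda>_. \<pi> x'"
          and Y = "\<lambda>j. if j = 0 then 0 else \<pi> x - x" and Y' = "\<lambda>j. if j = 0 then 0 else \<pi> x' - x'"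
          and A = "\<lambda>_. {i. \<pi> x \<bullet> n i = 0}" and A' = "\<lambda>_. {i. \<pi> x' \<bullet> n i = 0}"])
      (use False proj_cone proj_push in auto)
  then have "norm ((\<pi> x - x) - (\<pi> x' - x')) \<le> CB * norm (x - x')" by simp
  moreover have "\<pi> x - \<pi> x' = ((\<pi> x - x) - (\<pi> x' - x')) + (x - x')" by simp
  then have "norm (\<pi> x - \<pi> x') \<le> norm ((\<pi> x - x) - (\<pi> x' - x')) + norm (x - x')"
    by (metis norm_triangle_ineq)
  ultimately show ?thesis by (simp add: distrib_right)
qed simp

lemma continuous_proj: "continuous_on UNIV \<pi>"
proof -
  have "(CB + 1)-lipschitz_on UNIV \<pi>"
    using CB_pos by (intro lipschitz_onI) (auto simp: dist_norm proj_lipschitz)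
  then show ?thesis by (rule lipschitz_on_continuous_on)
qed

text \<open>The argument \<open>v\<close> is the Brownian increment and \<open>z - x\<close> the
  increment of the pushing term. The derivative is projected along all faces within \<delta> of
  \<open>z\<close> and not just those through \<open>z\<close>, as the path may have touched them
  during the step.\<close>

definition step :: "real \<Rightarrow> real \<Rightarrow> (real^'n) \<times> (real^'n) \<Rightarrow> real^'n \<Rightarrow> (real^'n) \<times> (real^'n)" where
  "step h \<delta> \<xi> v = (let x = fst \<xi> + h *\<^sub>R b0 + \<sigma> *v v; z = \<pi> x in
     (z, oblique_proj {i. z \<bullet> n i \<le> \<delta>} (snd \<xi> + h *\<^sub>R b1 + \<sigma>1 *v v + Q *v (z - x))))"

fun euler :: "real \<Rightarrow> real \<Rightarrow> (nat \<Rightarrow> real^'n) \<Rightarrow> (real^'n) \<times> (real^'n) \<Rightarrow> nat \<Rightarrow> (real^'n) \<times> (real^'n)" where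
  "euler h \<delta> v \<xi> 0 = \<xi>"
| "euler h \<delta> v \<xi> (Suc j) = step h \<delta> (euler h \<delta> v \<xi> j) (v j)"

definition driver :: "(real \<Rightarrow> real^'n) \<Rightarrow> (real \<Rightarrow> real^'n) \<Rightarrow> real \<Rightarrow> real^'n" where
  "driver w y t = t *\<^sub>R b1 + \<sigma>1 *v w t + Q *v y t"

text \<open>Everything is stated through increments: \<open>z - y\<close> moves like the free
  diffusion, and \<open>j - driver w y\<close> is the derivative push up to a constant. Thus neither
  initial values nor the process \<open>K\<close> occur.\<close>

definition path_sol :: "(real \<Rightarrow> real^'n) \<Rightarrow> (real \<Rightarrow> real^'n) \<Rightarrow> (real \<Rightarrow> real^'n) \<Rightarrow> (real \<Rightarrow> real^'n) \<Rightarrow> bool" where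
  "path_sol w z y j \<longleftrightarrow> continuous_on {0..} w \<and> (\<forall>e. skorokhod_sol 0 e z y) \<and>
     (\<forall>s\<ge>0. \<forall>t\<ge>0. (z t - y t) - (z s - y s) = (t - s) *\<^sub>R b0 + \<sigma> *v (w t - w s)) \<and>
     (\<forall>t\<ge>0. (j \<longlongrightarrow> j t) (at_right t)) \<and>
     (\<forall>t\<ge>0. \<forall>i. z t \<bullet> n i = 0 \<longrightarrow> j t \<bullet> n i = 0) \<and>
     (\<forall>s\<ge>0. \<forall>t>s. (j t - driver w y t) - (j s - driver w y s) \<in> span (d ` hits z s t))"

lemma path_solD:
  assumes "path_sol w z y j"
  shows "continuous_on {0..} w" "0 \<le> a \<Longrightarrow> skorokhod_sol a e z y"
    "\<lbrakk>0 \<le> s; 0 \<le> t\<rbrakk> \<Longrightarrow> (z t - y t) - (z s - y s) = (t - s) *\<^sub>R b0 + \<sigma> *v (w t - w s)"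
    "0 \<le> t \<Longrightarrow> (j \<longlongrightarrow> j t) (at_right t)"
    "\<lbrakk>0 \<le> t; z t \<bullet> n i = 0\<rbrakk> \<Longrightarrow> j t \<bullet> n i = 0"
    "\<lbrakk>0 \<le> s; s < t\<rbrakk> \<Longrightarrow> (j t - driver w y t) - (j s - driver w y s) \<in> span (d ` hits z s t)"
    "0 \<le> t \<Longrightarrow> 0 \<le> z t \<bullet> n i"
  using assms skorokhod_sol_mono[of 0 e z y a e] skorokhod_solD(2)[of 0 t z y t i] by (auto simp: path_sol_def)

definition S0 :: real where "S0 = norm b0 + onorm ((*v) \<sigma>) + norm b1 + onorm ((*v) \<sigma>1) + onorm ((*v) Q) + 1"

lemma S0: "1 \<le> S0" "norm (\<sigma> *v x) \<le> S0 * norm x" "norm (\<sigma>1 *v x) \<le> S0 * norm x"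
  "norm (Q *v x) \<le> S0 * norm x" "norm b0 \<le> S0" "norm b1 \<le> S0"
proof -
  have *: "0 \<le> onorm ((*v) A)" "norm (A *v x) \<le> onorm ((*v) A) * norm x" for A :: "real^'n^'n"
    by (auto intro: onorm_pos_le onorm)
  note nn = *(1)[of \<sigma>] *(1)[of \<sigma>1] *(1)[of Q] norm_ge_zero[of b0] norm_ge_zero[of b1]
  show "1 \<le> S0" "norm b0 \<le> S0" "norm b1 \<le> S0" using nn by (auto simp: S0_def)
  have "onorm ((*v) \<sigma>) \<le> S0" "onorm ((*v) \<sigma>1) \<le> S0" "onorm ((*v) Q) \<le> S0"
    using nn by (auto simp: S0_def)
  then show "norm (\<sigma> *v x) \<le> S0 * norm x" "norm (\<sigma>1 *v x) \<le> S0 * norm x" "norm (Q *v x) \<le> S0 * norm x"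
    using *(2) by (meson mult_right_mono norm_ge_zero order_trans)+
qed

lemma drift_bound:
  assumes "0 \<le> h" "\<bar>t\<bar> \<le> h" "norm v \<le> r"
  shows "norm (t *\<^sub>R b0 + \<sigma> *v v) \<le> S0 * (h + r)" "norm (t *\<^sub>R b1 + \<sigma>1 *v v) \<le> S0 * (h + r)"
proof -
  have S: "0 \<le> S0" using S0(1) by simp
  have "norm (t *\<^sub>R b0) \<le> S0 * h" "norm (t *\<^sub>R b1) \<le> S0 * h"
    using mult_mono[OF assms(2) S0(5)] mult_mono[OF assms(2) S0(6)] assms(1) by (simp_all add: mult.commute)
  moreover have "norm (\<sigma> *v v) \<le> S0 * r" "norm (\<sigma>1 *v v) \<le> S0 * r"
    using S0(2)[of v] S0(3)[of v] mult_left_mono[OF assms(3) S] by linarith+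
  ultimately show "norm (t *\<^sub>R b0 + \<sigma> *v v) \<le> S0 * (h + r)" "norm (t *\<^sub>R b1 + \<sigma>1 *v v) \<le> S0 * (h + r)"
    by (auto simp: distrib_left intro!: norm_triangle_le)
qed

text \<open>One factor \<open>CB + 1\<close> turns the free motion during a mesh into the
  oscillation of \<open>Z\<close>; the other adds the distance between scheme and path, which is
  \<open>CB\<close> times this oscillation.\<close>

definition C1 :: real where "C1 = (CB + 1)^2 * S0"

lemma C1_pos: "0 < C1"
  using CB_pos S0(1) by (simp add: C1_def)

lemma path_modulus:
  assumes p: "path_sol w z y j" and a: "0 \<le> a"
    and w: "\<And>t. a \<le> t \<Longrightarrow> t \<le> e \<Longrightarrow> norm (w t - w a) \<le> r" and t: "a \<le> t" "t \<le> e"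
  shows "norm (z t - z a) \<le> (CB + 1) * (S0 * ((e - a) + r))" "norm (y t - y a) \<le> CB * (S0 * ((e - a) + r))"
proof -
  have X: "norm ((z u - y u) - (z a - y a)) \<le> S0 * ((e - a) + r)" if "a \<le> u" "u \<le> e" for u
  proof -
    have eq: "(z u - y u) - (z a - y a) = (u - a) *\<^sub>R b0 + \<sigma> *v (w u - w a)"
      using path_solD(3)[OF p a, of u] that a by simp
    show ?thesis unfolding eq using w[OF that] that by (intro drift_bound(1)) auto
  qed
  show "norm (z t - z a) \<le> (CB + 1) * (S0 * ((e - a) + r))" "norm (y t - y a) \<le> CB * (S0 * ((e - a) + r))"
    using skorokhod_modulus[OF path_solD(2)[OF p a] X t] by auto
qed

text \<open>With a common Brownian path the driving paths differ by the constant
  \<open>z 0 - z' 0\<close>. Subtracting the initial pushes lets both pushes start at 0.\<close>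

lemma path_lipschitz:
  assumes p: "path_sol w z y j" "path_sol w z' y' j'" and t: "0 \<le> t"
  shows "norm (z t - z' t) \<le> (CB + 1) * norm (z 0 - z' 0)"
proof -
  have sh: "skorokhod_sol 0 t z (\<lambda>u. y u - y 0)" "skorokhod_sol 0 t z' (\<lambda>u. y' u - y' 0)"
    using path_solD(2)[OF p(1), of 0 t] path_solD(2)[OF p(2), of 0 t] by (auto simp: skorokhod_sol_def)
  have eq: "(z u - (y u - y 0)) - (z' u - (y' u - y' 0)) = z 0 - z' 0" if "0 \<le> u" for u
  proof -
    have "(z u - y u) - (z 0 - y 0) = (z' u - y' u) - (z' 0 - y' 0)"
      using path_solD(3)[OF p(1) order.refl that] path_solD(3)[OF p(2) order.refl that] by simp
    then show ?thesis by (simp add: algebra_simps)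
  qed
  have *: "norm ((y t - y 0) - (y' t - y' 0)) \<le> CB * norm (z 0 - z' 0)"
    using t by (intro skorokhod_lipschitz[OF sh]) (auto simp: eq)
  have "z t - z' t = ((y t - y 0) - (y' t - y' 0)) + (z 0 - z' 0)"
    using eq[OF t] by (simp add: algebra_simps)
  then have "norm (z t - z' t) \<le> norm ((y t - y 0) - (y' t - y' 0)) + norm (z 0 - z' 0)"
    by (metis norm_triangle_ineq)
  then show ?thesis using * by (simp add: distrib_right)
qed

lemma path_no_hit:
  assumes p: "path_sol w z y j" and a: "0 \<le> a" "a \<le> e" and nh: "\<And>t i. a < t \<Longrightarrow> t \<le> e \<Longrightarrow> z t \<bullet> n i \<noteq> 0"
  shows "z e = z a + (e - a) *\<^sub>R b0 + \<sigma> *v (w e - w a)"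
proof (cases "a = e")
  case False
  have "hits z a e = {}" using nh by (auto simp: hits_def)
  then have "y e - y a = 0"
    using skorokhod_solD(3)[OF path_solD(2)[OF p a(1)], of a e e] False a by simp
  then show ?thesis using path_solD(3)[OF p a(1), of e] a by (simp add: algebra_simps)
qed simp

text \<open>\<open>derivative_near\<close> with the displacement of the driver bounded by drift,
  noise and, through \<open>path_modulus\<close>, push.\<close>

lemma path_near:
  assumes p: "path_sol w z y j" and e: "0 < e"
    and w: "\<And>t. 0 \<le> t \<Longrightarrow> t \<le> e \<Longrightarrow> norm (w t - w 0) \<le> r"
    and y: "\<And>t i. 0 \<le> t \<Longrightarrow> t \<le> e \<Longrightarrow> z t \<bullet> n i = 0 \<Longrightarrow> x \<bullet> n i = 0"
  shows "norm (j e - x) \<le> (CB + 1) * (C1 * S0 * (e + r) + S0 * (e + r) + norm (j 0 - x))"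
proof -
  have S: "0 < S0" using S0(1) by simp
  have r: "0 \<le> r" using w[of 0] e by (metis diff_self less_eq_real_def norm_zero)
  let ?c = "C1 * S0 * (e + r) + S0 * (e + r)"
  have "norm (j e - x) \<le> (CB + 1) * (?c + norm (j 0 - x))"
  proof (rule derivative_near[OF e _ _ _ _ _ y, where \<psi> = "driver w y"])
    show "continuous_on {0..e} z" by (rule skorokhod_solD(1)[OF path_solD(2)[OF p]]) simp
    show "0 < ?c" using e r S C1_pos by (simp add: add_nonneg_pos)
    fix t assume t: "0 \<le> t" "t \<le> e"
    have "driver w y t - driver w y 0 = (t *\<^sub>R b1 + \<sigma>1 *v (w t - w 0)) + Q *v (y t - y 0)"
      by (simp add: driver_def matrix_vector_mult_diff_distrib)
    moreover have "norm (t *\<^sub>R b1 + \<sigma>1 *v (w t - w 0)) \<le> S0 * (e + r)"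
      using t w by (intro drift_bound(2)) auto
    moreover have "norm (Q *v (y t - y 0)) \<le> C1 * S0 * (e + r)"
    proof -
      have "norm (y t - y 0) \<le> CB * (S0 * ((e - 0) + r))"
        by (rule path_modulus(2)[OF p order.refl _ t]) (use w in auto)
      also have "\<dots> \<le> (CB + 1)^2 * (S0 * (e + r))"
        using CB_pos S e r by (intro mult_mono) (auto simp: power2_eq_square algebra_simps)
      finally have "S0 * norm (y t - y 0) \<le> S0 * ((CB + 1)^2 * (S0 * (e + r)))"
        using S by (intro mult_left_mono) auto
      then show ?thesis using S0(4)[of "y t - y 0"] by (simp add: C1_def mult_ac)
    qed
    ultimately show "norm (driver w y t - driver w y 0) \<le> ?c"
      by (metis add.commute norm_triangle_mono)
  qed (use p path_solD in auto)
  then show ?thesis .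
qed

text \<open>The threshold \<delta> has to satisfy two opposite demands: at least \<open>C1\<close>
  times mesh plus modulus, to catch all faces hit during a step, and at most \<eta>, to catch no
  distant ones. The number \<eta> may depend on the path.\<close>

lemma euler_converges:
  assumes p: "path_sol w z y j" and a: "0 \<le> a" "a < e" and \<epsilon>: "0 < \<epsilon>"
  obtains \<eta> where "0 < \<eta>" "\<And>N \<delta> r. \<lbrakk>0 < N; (e - a) / real N \<le> \<eta>; \<delta> \<le> \<eta>;
      \<And>u v. a \<le> u \<Longrightarrow> u \<le> v \<Longrightarrow> v \<le> e \<Longrightarrow> v - u \<le> (e - a) / real N \<Longrightarrow> norm (w v - w u) \<le> r;
      C1 * ((e - a) / real N + r) \<le> \<delta>\<rbrakk> \<Longrightarrow>
      norm (euler ((e - a) / real N) \<delta> (\<lambda>k. w (grid a e N (Suc k)) - w (grid a e N k)) (z a, j a) N - (z e, j e)) \<le> \<epsilon>"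
proof -
  have S: "1 \<le> S0" by (rule S0(1))
  have sk: "skorokhod_sol a e z y" by (rule path_solD(2)[OF p a(1)])
  obtain \<eta>0 where \<eta>0: "0 < \<eta>0"
    "\<And>N Jd \<psi>d I. \<lbrakk>0 < N; (e - a) / real N \<le> \<eta>0; Jd 0 - \<psi>d 0 = j a - driver w y a;
      \<And>k. k < N \<Longrightarrow> (Jd (Suc k) - \<psi>d (Suc k)) - (Jd k - \<psi>d k) \<in> span (d ` I k);
      \<And>k i. k < N \<Longrightarrow> i \<in> I k \<Longrightarrow> Jd (Suc k) \<bullet> n i = 0;
      \<And>k. k < N \<Longrightarrow> norm (\<psi>d (Suc k) - driver w y (grid a e N (Suc k))) \<le> \<eta>0;
      \<And>k. k < N \<Longrightarrow> hits z (grid a e N k) (grid a e N (Suc k)) \<subseteq> I k;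
      \<And>k i. k < N \<Longrightarrow> i \<in> I k \<Longrightarrow> z (grid a e N (Suc k)) \<bullet> n i \<le> \<eta>0\<rbrakk>
      \<Longrightarrow> norm (Jd N - j e) \<le> \<epsilon> / 2"
  proof (rule derivative_scheme_converges[OF a(2) skorokhod_solD(1)[OF sk], where J = j and \<psi> = "driver w y" and \<epsilon> = "\<epsilon> / 2"])
    show "0 \<le> z t \<bullet> n i" if "a \<le> t" "t \<le> e" for t i
      using path_solD(7)[OF p, of t i] that a by simp
    show "(j \<longlongrightarrow> j t) (at_right t)" if "a \<le> t" "t < e" for t
      using path_solD(4)[OF p, of t] that a by simp
    show "j t \<bullet> n i = 0" if "a \<le> t" "t \<le> e" "z t \<bullet> n i = 0" for t i
      using path_solD(5)[OF p _ that(3)] that a by simp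
    show "j t - driver w y t - (j s - driver w y s) \<in> span (d ` hits z s t)" if "a \<le> s" "s < t" "t \<le> e" for s t
      using path_solD(6)[OF p _ that(2)] that a by simp
    show "0 < \<epsilon> / 2" using \<epsilon> by simp
  qed blast
  \<comment> \<open>The driver of the scheme is off by \<open>Q\<close> applied to the error of the
    push, hence by at most \<open>S0 * \<eta>\<close>. Each component gets half of
    \<epsilon>.\<close>
  define \<eta> where "\<eta> = min (\<eta>0 / (2 * S0)) (\<epsilon> / 2)"
  have \<eta>: "0 < \<eta>" "S0 * \<eta> \<le> \<eta>0 / 2" "\<eta> \<le> \<epsilon> / 2"
  proof -
    show "0 < \<eta>" "\<eta> \<le> \<epsilon> / 2" using \<eta>0(1) \<epsilon> S by (auto simp: \<eta>_def)
    have "S0 * \<eta> \<le> S0 * (\<eta>0 / (2 * S0))" using S by (intro mult_left_mono) (auto simp: \<eta>_def)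
    then show "S0 * \<eta> \<le> \<eta>0 / 2" using S by simp
  qed
  have \<eta>': "\<eta> \<le> \<eta>0 / 2" using \<eta>(2) mult_right_mono[OF S, of \<eta>] \<eta>(1) by linarith
  show thesis
  proof (rule that[OF \<eta>(1)])
    fix N :: nat and \<delta> r
    define h where "h = (e - a) / real N"
    let ?t = "grid a e N"
    assume N: "0 < N" and mesh: "(e - a) / real N \<le> \<eta>" and \<delta>: "\<delta> \<le> \<eta>"
      and w: "\<And>u v. a \<le> u \<Longrightarrow> u \<le> v \<Longrightarrow> v \<le> e \<Longrightarrow> v - u \<le> (e - a) / real N \<Longrightarrow> norm (w v - w u) \<le> r"
      and C1\<delta>: "C1 * ((e - a) / real N + r) \<le> \<delta>"
    have h: "0 < h" using N a by (simp add: h_def)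
    have r0: "0 \<le> r"
    proof -
      have "norm (w a - w a) \<le> r" using a h h_def by (intro w) auto
      then show ?thesis by simp
    qed
    \<comment> \<open>The oscillation of \<open>z\<close> over one mesh; \<open>C1\<close> is made
      such that \<open>(CB + 1) * \<kappa> \<le> \<delta>\<close>.\<close>
    define \<kappa> where "\<kappa> = (CB + 1) * (S0 * (h + r))"
    have \<kappa>: "0 < \<kappa>" using CB_pos S h r0 by (simp add: \<kappa>_def)
    have \<kappa>\<delta>: "(CB + 1) * \<kappa> \<le> \<delta>"
      using C1\<delta> by (simp add: \<kappa>_def C1_def h_def power2_eq_square mult_ac)
    have \<kappa>\<delta>': "CB * \<kappa> + \<kappa> \<le> \<delta>" using \<kappa>\<delta> by (simp add: distrib_right)
    have in1: "a \<le> ?t k" "?t k \<le> e" if "k \<le> N" for k using grid_in[of a e k N] that a N by auto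
    have tS: "?t (Suc k) = ?t k + h" for k by (simp add: grid_Suc h_def)
    have osc: "norm (z (?t (Suc k)) - z u) \<le> \<kappa>" if "k < N" "?t k < u" "u \<le> ?t (Suc k)" for k u
    proof -
      have k: "a \<le> ?t k" "?t (Suc k) \<le> e" using in1[of k] in1[of "Suc k"] that(1) by auto
      have "norm (z (?t (Suc k)) - z u) \<le> (CB + 1) * (S0 * ((?t (Suc k) - u) + r))"
      proof (rule path_modulus(1)[OF p])
        fix t assume "u \<le> t" "t \<le> ?t (Suc k)"
        then show "norm (w t - w u) \<le> r" using that k h_def tS[of k] by (intro w) auto
      qed (use that k a in auto)
      also have "\<dots> \<le> \<kappa>"
        unfolding \<kappa>_def using CB_pos S that tS[of k] by (intro mult_left_mono) auto
      finally show ?thesis .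
    qed
    define dw where "dw k = w (?t (Suc k)) - w (?t k)" for k
    define E where "E = euler h \<delta> dw (z a, j a)"
    define Zd where "Zd k = fst (E k)" for k
    define Jd where "Jd k = snd (E k)" for k
    \<comment> \<open>The two terms \<open>y a\<close> cancel. The push of the scheme is read off
      from the requirement that \<open>Zd - Yd\<close> agrees with \<open>z - y\<close> at the grid
      times, as \<open>euler_skorokhod\<close> demands.\<close>
    define Yd where "Yd k = y a + (Zd k - (z (?t k) - y (?t k))) - y a" for k
    have E0: "Zd 0 = z a" "Jd 0 = j a" by (simp_all add: E_def Zd_def Jd_def)
    have dX: "h *\<^sub>R b0 + \<sigma> *v dw k = (z (?t (Suc k)) - y (?t (Suc k))) - (z (?t k) - y (?t k))" if "k < N" for k
      using path_solD(3)[OF p, of "?t k" "?t (Suc k)"] in1[of k] in1[of "Suc k"] that a tS[of k] by (simp add: dw_def)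
    have Zd_Suc: "Zd (Suc k) = \<pi> (Zd k + h *\<^sub>R b0 + \<sigma> *v dw k)" for k
      by (simp add: Zd_def E_def step_def Let_def)
    have dY: "Zd (Suc k) - (Zd k + h *\<^sub>R b0 + \<sigma> *v dw k) = Yd (Suc k) - Yd k" if "k < N" for k
      using dX[OF that] by (simp add: Yd_def algebra_simps)
    define I where "I k = {i. Zd (Suc k) \<bullet> n i \<le> \<delta>}" for k
    have Jd_Suc: "Jd (Suc k) = oblique_proj (I k) (Jd k + h *\<^sub>R b1 + \<sigma>1 *v dw k + Q *v (Yd (Suc k) - Yd k))"
      if "k < N" for k
      unfolding dY[OF that, symmetric]
      by (simp add: Jd_def I_def Zd_def E_def step_def Let_def)
    have Ynear: "norm (Yd k - y (?t k)) \<le> CB * \<kappa>" if "k \<le> N" for k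
    proof (rule euler_skorokhod[OF sk a(2) N \<kappa> _ _ _ _ osc that])
      show "Yd 0 = y a" by (simp add: Yd_def E0)
      fix k assume k: "k < N"
      show "Zd (Suc k) - Yd (Suc k) = z (?t (Suc k)) - y (?t (Suc k))" by (simp add: Yd_def)
      show "0 \<le> Zd (Suc k) \<bullet> n i" for i by (simp add: Zd_Suc proj_cone)
      show "Yd (Suc k) - Yd k \<in> convex_cone hull d ` {i. Zd (Suc k) \<bullet> n i = 0}"
        unfolding dY[OF k, symmetric] unfolding Zd_Suc by (rule proj_push)
    qed auto
    have Zeq: "Zd k - z (?t k) = Yd k - y (?t k)" for k by (simp add: Yd_def)
    have Znear: "norm (Zd k - z (?t k)) \<le> CB * \<kappa>" if "k \<le> N" for k
      unfolding Zeq using that by (rule Ynear)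
    have inn: "\<bar>Zd k \<bullet> n i - z (?t k) \<bullet> n i\<bar> \<le> CB * \<kappa>" if "k \<le> N" for k i
      using Cauchy_Schwarz_ineq2[of "Zd k - z (?t k)" "n i"] Znear[OF that] n_unit[of i] by (simp add: inner_diff_left)
    define \<psi>d where "\<psi>d k = ?t k *\<^sub>R b1 + \<sigma>1 *v w (?t k) + Q *v Yd k" for k
    have d\<psi>: "\<psi>d (Suc k) - \<psi>d k = h *\<^sub>R b1 + \<sigma>1 *v dw k + Q *v (Yd (Suc k) - Yd k)" for k
      by (simp add: \<psi>d_def dw_def tS matrix_vector_mult_diff_distrib scaleR_add_left)
    have J: "norm (Jd N - j e) \<le> \<epsilon> / 2"
    proof (rule \<eta>0(2)[where \<psi>d = \<psi>d and I = I])
      show "(e - a) / real N \<le> \<eta>0" using mesh \<eta>' \<eta>0(1) by linarith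
      show "Jd 0 - \<psi>d 0 = j a - driver w y a" by (simp add: E0 \<psi>d_def driver_def Yd_def)
      fix k assume k: "k < N"
      have eq: "Jd (Suc k) = oblique_proj (I k) (Jd k + (\<psi>d (Suc k) - \<psi>d k))"
        using Jd_Suc[OF k] by (simp add: d\<psi> add.assoc)
      show "Jd (Suc k) - \<psi>d (Suc k) - (Jd k - \<psi>d k) \<in> span (d ` I k)"
        using oblique_proj(2)[of "I k" "Jd k + (\<psi>d (Suc k) - \<psi>d k)"] unfolding eq by (simp add: algebra_simps)
      show "Jd (Suc k) \<bullet> n i = 0" if "i \<in> I k" for i
        unfolding eq by (rule oblique_proj(3)[OF that])
      have "\<psi>d (Suc k) - driver w y (?t (Suc k)) = Q *v (Yd (Suc k) - y (?t (Suc k)))"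
        by (simp add: \<psi>d_def driver_def matrix_vector_mult_diff_distrib)
      then have "norm (\<psi>d (Suc k) - driver w y (?t (Suc k))) \<le> S0 * norm (Yd (Suc k) - y (?t (Suc k)))"
        using S0(4) by simp
      also have "\<dots> \<le> S0 * \<eta>"
        using Ynear[of "Suc k"] k S \<kappa> \<kappa>\<delta>' \<delta> by (intro mult_left_mono) auto
      finally show "norm (\<psi>d (Suc k) - driver w y (?t (Suc k))) \<le> \<eta>0" using \<eta>(2) \<eta>0(1) by simp
      \<comment> \<open>A face hit is within \<kappa> of \<open>z\<close> at the end of the step,
        hence within \<open>CB * \<kappa> + \<kappa>\<close> of the scheme, which is at most
        \<delta>.\<close>
      show "hits z (?t k) (?t (Suc k)) \<subseteq> I k"
      proof
        fix i assume "i \<in> hits z (?t k) (?t (Suc k))"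
        then have "z (?t (Suc k)) \<bullet> n i \<le> \<kappa>" using hits_small osc[OF k] by blast
        then show "i \<in> I k" using inn[of "Suc k" i] k \<kappa>\<delta>' by (simp add: I_def)
      qed
      show "z (?t (Suc k)) \<bullet> n i \<le> \<eta>0" if "i \<in> I k" for i
        using that inn[of "Suc k" i] k \<kappa>\<delta>' \<kappa> \<delta> \<eta>' by (simp add: I_def)
    qed (use N in auto)
    have Z: "norm (Zd N - z e) \<le> \<epsilon> / 2"
      using Znear[of N] \<kappa>\<delta>' \<kappa> \<delta> \<eta>(3) grid_N[OF N, of a e] by simp
    have "norm (E N - (z e, j e)) \<le> norm (Zd N - z e) + norm (Jd N - j e)"
      by (simp add: norm_Pair2 Zd_def Jd_def norm_prod_def sqrt_sum_squares_le_sum)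
    then show "norm (euler ((e - a) / real N) \<delta> (\<lambda>k. w (?t (Suc k)) - w (?t k)) (z a, j a) N - (z e, j e)) \<le> \<epsilon>"
      using J Z unfolding E_def dw_def h_def by linarith
  qed
qed

end

section \<open>Transition operators of the Euler scheme\<close>

lemma abs_integral_le_integral:
  fixes f g :: "'a \<Rightarrow> real"
  assumes "integrable M f" "integrable M g" "AE x in M. \<bar>f x\<bar> \<le> g x"
  shows "\<bar>\<integral>x. f x \<partial>M\<bar> \<le> (\<integral>x. g x \<partial>M)"
  using assms by (intro order_trans[OF integral_abs_bound] integral_mono_AE) auto

lemma (in prob_space) abs_expectation_le:
  fixes f :: "'a \<Rightarrow> real"
  assumes "f \<in> borel_measurable M" "\<And>x. \<bar>f x\<bar> \<le> c"
  shows "integrable M f" "\<bar>\<integral>x. f x \<partial>M\<bar> \<le> c"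
proof -
  show i: "integrable M f" using assms by (intro integrable_const_bound[where B = c]) auto
  show "\<bar>\<integral>x. f x \<partial>M\<bar> \<le> c"
    using abs_integral_le_integral[OF i, of "\<lambda>_. c"] assms(2) by (simp add: prob_space)
qed

locale rbm_euler = euler_data n d B \<theta> b0 b1 \<sigma> \<sigma>1 Q \<pi> + prob_space M
  for n d :: "'n::finite \<Rightarrow> real^'n" and B \<theta> b0 b1 \<sigma> \<sigma>1 Q \<pi> and M :: "'w measure" +
  fixes F :: "real \<Rightarrow> 'w measure" and W :: "real \<Rightarrow> 'w \<Rightarrow> real^'n"
  assumes usual: "usual_conditions M F" and bm: "brownian_motion M F W"
    and sigma_pd: "pos_def_sym \<sigma>"
begin

lemma F_sub: "0 \<le> t \<Longrightarrow> subalgebra M (F t)"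
  using usual by (simp add: usual_conditions_def)

lemma F_mono: "0 \<le> s \<Longrightarrow> s \<le> t \<Longrightarrow> sets (F s) \<subseteq> sets (F t)"
proof -
  have "\<forall>s\<ge>0. \<forall>t\<ge>s. sets (F s) \<subseteq> sets (F t)"
    using usual unfolding usual_conditions_def by (elim conjE)
  then show "0 \<le> s \<Longrightarrow> s \<le> t \<Longrightarrow> sets (F s) \<subseteq> sets (F t)" by blast
qed

lemma F_space: "0 \<le> t \<Longrightarrow> space (F t) = space M"
  using F_sub by (simp add: subalgebra_def)

lemma F_measurable_mono:
  assumes "f \<in> measurable (F s) N" "0 \<le> s" "s \<le> t"
  shows "f \<in> measurable (F t) N"
  using assms F_mono[of s t] F_space[of s] F_space[of t] by (auto simp: measurable_def)

lemma F_measurable_M: "0 \<le> s \<Longrightarrow> f \<in> measurable (F s) N \<Longrightarrow> f \<in> measurable M N"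
  using F_sub measurable_from_subalg by blast

lemma W_F: "0 \<le> t \<Longrightarrow> W t \<in> borel_measurable (F t)"
  using bm by (simp add: brownian_motion_def adapted_def)

lemma W_M: "0 \<le> t \<Longrightarrow> W t \<in> borel_measurable M"
  using W_F F_measurable_M by blast

lemma dW_M: "0 \<le> s \<Longrightarrow> s \<le> t \<Longrightarrow> (\<lambda>\<omega>. W t \<omega> - W s \<omega>) \<in> borel_measurable M"
  using W_M[of s] W_M[of t] by simp

text \<open>Nothing is said about measurability of \<open>Y\<close>; quantities to be integrated are
  expressed by \<open>Z\<close>, \<open>D\<close> and \<open>W\<close>.\<close>

definition joint_solution :: "(real \<Rightarrow> 'w \<Rightarrow> real^'n) \<Rightarrow> (real \<Rightarrow> 'w \<Rightarrow> real^'n) \<Rightarrow> bool" where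
  "joint_solution Z D \<longleftrightarrow> adapted F Z \<and> adapted F D \<and>
     (\<exists>Y. AE \<omega> in M. path_sol (\<lambda>t. W t \<omega>) (\<lambda>t. Z t \<omega>) (\<lambda>t. Y t \<omega>) (\<lambda>t. D t \<omega>))"

text \<open>The freezing lemma: the pair of \<open>U\<close> and \<xi> is known at time
  \<open>s\<close> and independent of the increment, so the joint law is a product and Fubini's
  theorem integrates out the increment.\<close>

lemma indep_integral:
  fixes \<xi> :: "'w \<Rightarrow> 'x::{second_countable_topology, t2_space}" and g :: "'x \<times> (real^'n) \<Rightarrow> real"
  assumes s: "0 \<le> s" "s < t" and \<xi>: "\<xi> \<in> borel_measurable (F s)" and U: "U \<in> borel_measurable (F s)"
    and c: "\<And>\<omega>. \<bar>U \<omega>\<bar> \<le> c"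
    and g[measurable]: "g \<in> borel_measurable (borel \<Otimes>\<^sub>M borel)" and gc: "\<And>x. \<bar>g x\<bar> \<le> c'"
  shows "(\<integral>\<omega>. U \<omega> * g (\<xi> \<omega>, W t \<omega> - W s \<omega>) \<partial>M) =
    (\<integral>\<omega>. U \<omega> * (\<integral>v. g (\<xi> \<omega>, v) \<partial>distr M borel (\<lambda>\<omega>. W t \<omega> - W s \<omega>)) \<partial>M)"
proof -
  let ?V = "\<lambda>\<omega>. W t \<omega> - W s \<omega>"
  let ?X = "\<lambda>\<omega>. (U \<omega>, \<xi> \<omega>)"
  let ?N = "borel \<Otimes>\<^sub>M borel :: (real \<times> 'x) measure"
  have XF: "?X \<in> measurable (F s) ?N" using \<xi> U by simp
  have [measurable]: "U \<in> borel_measurable M" "\<xi> \<in> borel_measurable M"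
    by (rule F_measurable_M[OF s(1)], fact)+
  have Vm[measurable]: "?V \<in> borel_measurable M"
    using s by (intro dW_M) auto
  have X[measurable]: "?X \<in> measurable M ?N" by simp
  have ind: "indep_set (sets (F s)) (sets (vimage_algebra (space M) ?V borel))"
    using bm s unfolding brownian_motion_def by blast
  interpret X: prob_space "distr M ?N ?X" by (rule prob_space_distr) fact
  interpret V: prob_space "distr M borel ?V" by (rule prob_space_distr) simp
  interpret XV: pair_prob_space "distr M ?N ?X" "distr M borel ?V" ..
  have eq: "distr M ?N ?X \<Otimes>\<^sub>M distr M borel ?V = distr M (?N \<Otimes>\<^sub>M borel) (\<lambda>\<omega>. (?X \<omega>, ?V \<omega>))"
  proof (rule pair_measure_eqI)
    fix A B assume "A \<in> sets (distr M ?N ?X)" "B \<in> sets (distr M borel ?V)"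
    then have A[measurable]: "A \<in> sets ?N" and B[measurable]: "B \<in> sets borel" by auto
    have "?X -` A \<inter> space M \<in> sets (F s)"
      using measurable_sets[OF XF A] F_space[OF s(1)] by simp
    moreover have "?V -` B \<inter> space M \<in> sets (vimage_algebra (space M) ?V borel)"
      using B by (intro in_vimage_algebra)
    ultimately have "prob ((?X -` A \<inter> space M) \<inter> (?V -` B \<inter> space M))
      = prob (?X -` A \<inter> space M) * prob (?V -` B \<inter> space M)"
      by (rule indep_setD[OF ind])
    moreover have "(?X -` A \<inter> space M) \<inter> (?V -` B \<inter> space M) = (\<lambda>\<omega>. (?X \<omega>, ?V \<omega>)) -` (A \<times> B) \<inter> space M"
      by auto
    ultimately show "emeasure (distr M ?N ?X) A * emeasure (distr M borel ?V) B =
       emeasure (distr M (?N \<Otimes>\<^sub>M borel) (\<lambda>\<omega>. (?X \<omega>, ?V \<omega>))) (A \<times> B)"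
      by (simp add: emeasure_distr emeasure_eq_measure ennreal_mult' measure_nonneg)
  qed (simp_all add: X.sigma_finite_measure_axioms V.sigma_finite_measure_axioms cong: sets_pair_measure_cong)
  let ?h = "\<lambda>(p, v). fst p * g (snd p, v)"
  have h[measurable]: "?h \<in> borel_measurable (?N \<Otimes>\<^sub>M borel)" by measurable
  have c0: "0 \<le> c" "0 \<le> c'" using c[of undefined] gc[of undefined] by auto
  have mp: "(\<lambda>\<omega>. (?X \<omega>, ?V \<omega>)) \<in> measurable M (?N \<Otimes>\<^sub>M borel)"
    by (rule measurable_Pair[OF X Vm])
  have "(\<lambda>\<omega>. ?h (?X \<omega>, ?V \<omega>)) \<in> borel_measurable M"
    by (rule measurable_compose[OF mp h])
  moreover have "\<bar>?h (?X \<omega>, ?V \<omega>)\<bar> \<le> c * c'" for \<omega>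
    using mult_mono[OF c[of \<omega>] gc[of "(\<xi> \<omega>, ?V \<omega>)"] c0(1)] by (simp add: abs_mult)
  ultimately have "integrable (distr M (?N \<Otimes>\<^sub>M borel) (\<lambda>\<omega>. (?X \<omega>, ?V \<omega>))) ?h"
    unfolding integrable_distr_eq[OF mp h] by (rule abs_expectation_le(1))
  then have int: "integrable (distr M ?N ?X \<Otimes>\<^sub>M distr M borel ?V) ?h"
    unfolding eq .
  have inner: "(\<lambda>p. \<integral>v. ?h (p, v) \<partial>distr M borel ?V) \<in> borel_measurable ?N"
    using h by (intro V.borel_measurable_lebesgue_integral) (simp add: case_prod_beta' cong: measurable_cong_sets)
  have "(\<integral>\<omega>. U \<omega> * g (\<xi> \<omega>, ?V \<omega>) \<partial>M) = integral\<^sup>L (distr M (?N \<Otimes>\<^sub>M borel) (\<lambda>\<omega>. (?X \<omega>, ?V \<omega>))) ?h"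
    unfolding integral_distr[OF mp h] by simp
  also have "\<dots> = (\<integral>p. (\<integral>v. ?h (p, v) \<partial>distr M borel ?V) \<partial>distr M ?N ?X)"
    unfolding eq[symmetric] by (rule XV.integral_fst'[OF int, symmetric])
  also have "\<dots> = (\<integral>\<omega>. (\<integral>v. ?h (?X \<omega>, v) \<partial>distr M borel ?V) \<partial>M)"
    by (rule integral_distr[OF X inner])
  also have "\<dots> = (\<integral>\<omega>. U \<omega> * (\<integral>v. g (\<xi> \<omega>, v) \<partial>distr M borel ?V) \<partial>M)"
    by simp
  finally show ?thesis .
qed

text \<open>Lipschitz continuity in the derivative variable is measured in the gauge of \<open>B\<close>, because the
  oblique projections are nonexpansive in this gauge only.\<close>

definition lipschitz_gauge :: "real \<Rightarrow> ((real^'n) \<times> (real^'n) \<Rightarrow> real) \<Rightarrow> bool" where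
  "lipschitz_gauge L f \<longleftrightarrow> (\<forall>z y y' l. 0 < l \<longrightarrow> (y - y') /\<^sub>R l \<in> B \<longrightarrow> \<bar>f (z, y) - f (z, y')\<bar> \<le> L * l)"

text \<open>The face set takes finitely many values, each on a measurable set, and for a fixed face
  set the projection is continuous.\<close>

lemma measurable_oblique_proj:
  assumes [measurable]: "f \<in> borel_measurable N" "g \<in> borel_measurable N"
  shows "(\<lambda>x. oblique_proj {i. f x \<bullet> n i \<le> \<delta>} (g x)) \<in> borel_measurable N"
proof (rule measurable_compose_countable[where f = "\<lambda>I x. oblique_proj I (g x)" and g = "\<lambda>x. {i. f x \<bullet> n i \<le> \<delta>}"])
  fix I :: "'n set"
  have "continuous_on UNIV (oblique_proj I)"
    using oblique_proj(1) linear_continuous_on linear_linear by blast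
  then have [measurable]: "oblique_proj I \<in> borel_measurable borel"
    by (rule borel_measurable_continuous_onI)
  show "(\<lambda>x. oblique_proj I (g x)) \<in> borel_measurable N" by measurable
next
  show "(\<lambda>x. {i. f x \<bullet> n i \<le> \<delta>}) \<in> measurable N (count_space UNIV)"
  proof (subst measurable_count_space_eq2, simp, intro conjI ballI)
    fix I :: "'n set"
    have "(\<lambda>x. {i. f x \<bullet> n i \<le> \<delta>}) -` {I} \<inter> space N = {x \<in> space N. \<forall>i. (f x \<bullet> n i \<le> \<delta>) = (i \<in> I)}"
      by auto
    also have "\<dots> \<in> sets N" by measurable
    finally show "(\<lambda>x. {i. f x \<bullet> n i \<le> \<delta>}) -` {I} \<inter> space N \<in> sets N" .
  qed simp
qed

lemma measurable_mat [measurable]: "(*v) A \<in> borel_measurable borel" for A :: "real^'m^'k"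
  by (intro borel_measurable_continuous_onI linear_continuous_on) simp

lemma measurable_step:
  assumes [measurable]: "f \<in> borel_measurable N" "g \<in> borel_measurable N"
  shows "(\<lambda>x. step h \<delta> (f x) (g x)) \<in> borel_measurable N"
proof -
  have [measurable]: "\<pi> \<in> borel_measurable borel"
    by (rule borel_measurable_continuous_onI[OF continuous_proj])
  have [measurable]: "(\<lambda>x. fst (f x)) \<in> borel_measurable N" "(\<lambda>x. snd (f x)) \<in> borel_measurable N"
    by (rule measurable_compose[OF assms(1) borel_measurable_continuous_onI];
        intro continuous_intros)+
  show ?thesis
    unfolding step_def Let_def
    by (intro borel_measurable_Pair measurable_oblique_proj; measurable)
qed

text \<open>The position ignores the derivative variable, so both steps project along the same
  faces, and the difference of the results is the projection of the difference
  \<open>y - y'\<close>.\<close>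

lemma lipschitz_gauge_step:
  assumes "(y - y') /\<^sub>R l \<in> B" "0 < l"
  shows "fst (step h \<delta> (z, y) v) = fst (step h \<delta> (z, y') v)"
    "(snd (step h \<delta> (z, y) v) - snd (step h \<delta> (z, y') v)) /\<^sub>R l \<in> B"
proof -
  show "fst (step h \<delta> (z, y) v) = fst (step h \<delta> (z, y') v)" by (simp add: step_def Let_def)
  have "snd (step h \<delta> (z, y) v) - snd (step h \<delta> (z, y') v) =
    oblique_proj {i. \<pi> (z + h *\<^sub>R b0 + \<sigma> *v v) \<bullet> n i \<le> \<delta>} (y - y')"
    by (simp add: step_def Let_def linear_diff[OF oblique_proj(1), symmetric])
  then show "(snd (step h \<delta> (z, y) v) - snd (step h \<delta> (z, y') v)) /\<^sub>R l \<in> B"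
    using oblique_proj_in_B[OF assms] by simp
qed

lemma increasing_times:
  assumes "0 \<le> \<tau> 0" "\<And>k. k < N \<Longrightarrow> \<tau> k < \<tau> (Suc k)" and "k \<le> (N::nat)"
  shows "0 \<le> \<tau> k \<and> \<tau> 0 \<le> (\<tau> k :: real)"
  using assms(3)
proof (induction k)
  case (Suc k)
  then show ?case using assms(2)[of k] by auto
qed (simp add: assms(1))

lemma euler_measurable:
  assumes \<tau>: "0 \<le> \<tau> 0" "\<And>k. k < N \<Longrightarrow> \<tau> k < \<tau> (Suc k)" and \<xi>: "\<xi> \<in> borel_measurable (F (\<tau> 0))" and k: "k \<le> N"
  shows "(\<lambda>\<omega>. euler h \<delta> (\<lambda>k. W (\<tau> (Suc k)) \<omega> - W (\<tau> k) \<omega>) (\<xi> \<omega>) k) \<in> borel_measurable (F (\<tau> k))"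
  using k
proof (induction k)
  case 0
  show ?case unfolding euler.simps by (rule \<xi>)
next
  case (Suc k)
  have k: "k < N" using Suc.prems by simp
  have *: "0 \<le> \<tau> k" "\<tau> k \<le> \<tau> (Suc k)" "0 \<le> \<tau> (Suc k)"
    using increasing_times[of \<tau> N k, OF \<tau>] \<tau>(2)[OF k] k by auto
  have "(\<lambda>\<omega>. W (\<tau> (Suc k)) \<omega> - W (\<tau> k) \<omega>) \<in> borel_measurable (F (\<tau> (Suc k)))"
    by (intro borel_measurable_diff W_F[OF *(3)] F_measurable_mono[OF W_F[OF *(1)] *(1,2)])
  then show ?case unfolding euler.simps
    by (intro measurable_step F_measurable_mono[OF Suc.IH[OF less_imp_le[OF k]] *(1,2)])
qed

text \<open>The last increment is integrated out first, which replaces \<open>f\<close> by a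
  function of the same class; hence \<open>f\<close> is generalised in the induction.
  \<open>G\<close> is found before \<xi> and \<open>U\<close> are given.\<close>

lemma euler_transition:
  assumes \<tau>: "0 \<le> \<tau> 0" "\<And>k. k < N \<Longrightarrow> \<tau> k < \<tau> (Suc k)"
    and f: "f \<in> borel_measurable borel" "\<And>x. \<bar>f x\<bar> \<le> 1" "lipschitz_gauge L f"
  shows "\<exists>G. G \<in> borel_measurable borel \<and> (\<forall>x. \<bar>G x\<bar> \<le> 1) \<and> lipschitz_gauge L G \<and>
    (\<forall>\<xi> U c. \<xi> \<in> borel_measurable (F (\<tau> 0)) \<longrightarrow> U \<in> borel_measurable (F (\<tau> 0)) \<longrightarrow> (\<forall>\<omega>. \<bar>U \<omega>\<bar> \<le> c) \<longrightarrow>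
      (\<integral>\<omega>. U \<omega> * f (euler h \<delta> (\<lambda>k. W (\<tau> (Suc k)) \<omega> - W (\<tau> k) \<omega>) (\<xi> \<omega>) N) \<partial>M) = (\<integral>\<omega>. U \<omega> * G (\<xi> \<omega>) \<partial>M))"
  using \<tau>(2) f
proof (induction N arbitrary: f)
  case 0
  then show ?case by (intro exI[of _ f]) auto
next
  case (Suc N)
  note \<tau>2 = Suc.prems(1) and f = Suc.prems(2-4)
  let ?V = "\<lambda>\<omega>. W (\<tau> (Suc N)) \<omega> - W (\<tau> N) \<omega>"
  have \<tau>N: "0 \<le> \<tau> N" "\<tau> 0 \<le> \<tau> N" "\<tau> N < \<tau> (Suc N)"
    using increasing_times[of \<tau> "Suc N" N, OF \<tau>(1) \<tau>2] \<tau>2[of N] by auto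
  have V[measurable]: "?V \<in> borel_measurable M" using \<tau>N by (intro dW_M) auto
  \<comment> \<open>The one-step transition operator of the last step applied to
    \<open>f\<close>.\<close>
  define f' where "f' = (\<lambda>\<xi>. \<integral>v. f (step h \<delta> \<xi> v) \<partial>distr M borel ?V)"
  interpret V: prob_space "distr M borel ?V" by (rule prob_space_distr) (rule V)
  note f(1)[measurable]
  have st[measurable]: "(\<lambda>(\<xi>, v). step h \<delta> \<xi> v) \<in> borel_measurable (borel \<Otimes>\<^sub>M borel)"
    unfolding case_prod_beta by (rule measurable_step) simp_all
  have fst1: "(\<lambda>v. f (step h \<delta> \<xi> v)) \<in> borel_measurable (distr M borel ?V)" for \<xi>
    using measurable_step[of "\<lambda>_. \<xi>" borel "\<lambda>v. v" h \<delta>] by simp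
  have int: "integrable (distr M borel ?V) (\<lambda>v. f (step h \<delta> \<xi> v))" for \<xi>
    using f(2) by (intro V.integrable_const_bound[where B = 1] fst1) auto
  have 1: "f' \<in> borel_measurable borel"
    unfolding f'_def by (rule V.borel_measurable_lebesgue_integral)
      (use measurable_compose[OF st f(1)] in \<open>simp add: case_prod_beta' cong: measurable_cong_sets\<close>)
  have 2: "\<bar>f' x\<bar> \<le> 1" for x
    unfolding f'_def using f(2) by (intro V.abs_expectation_le(2) fst1) auto
  have 3: "lipschitz_gauge L f'"
    unfolding lipschitz_gauge_def
  proof (intro allI impI)
    fix z y y' l assume l: "0 < (l::real)" "(y - y') /\<^sub>R l \<in> B"
    have "\<bar>f (step h \<delta> (z, y) v) - f (step h \<delta> (z, y') v)\<bar> \<le> L * l" for v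
      using f(3) l(1) lipschitz_gauge_step[OF l(2,1), of h \<delta> z v] unfolding lipschitz_gauge_def by (metis prod.collapse)
    then have "\<bar>\<integral>v. f (step h \<delta> (z, y) v) - f (step h \<delta> (z, y') v) \<partial>distr M borel ?V\<bar> \<le> L * l"
      by (intro V.abs_expectation_le(2) borel_measurable_diff fst1)
    then show "\<bar>f' (z, y) - f' (z, y')\<bar> \<le> L * l"
      unfolding f'_def by (subst Bochner_Integration.integral_diff[OF int int, symmetric])
  qed
  have \<tau>2': "\<tau> k < \<tau> (Suc k)" if "k < N" for k
    using that by (intro \<tau>2) simp
  from Suc.IH[OF \<tau>2' 1 2 3] obtain G where G: "G \<in> borel_measurable borel" "\<forall>x. \<bar>G x\<bar> \<le> 1" "lipschitz_gauge L G"
    "\<And>\<xi> U c. \<xi> \<in> borel_measurable (F (\<tau> 0)) \<Longrightarrow> U \<in> borel_measurable (F (\<tau> 0)) \<Longrightarrow> (\<forall>\<omega>. \<bar>U \<omega>\<bar> \<le> c) \<Longrightarrow>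
      (\<integral>\<omega>. U \<omega> * f' (euler h \<delta> (\<lambda>k. W (\<tau> (Suc k)) \<omega> - W (\<tau> k) \<omega>) (\<xi> \<omega>) N) \<partial>M) = (\<integral>\<omega>. U \<omega> * G (\<xi> \<omega>) \<partial>M)"
    by blast
  show ?case
  proof (intro exI[of _ G] conjI G allI impI)
    fix \<xi> :: "'w \<Rightarrow> (real^'n) \<times> (real^'n)" and U :: "'w \<Rightarrow> real" and c
    assume \<xi>: "\<xi> \<in> borel_measurable (F (\<tau> 0))" and U: "U \<in> borel_measurable (F (\<tau> 0))" and c: "\<forall>\<omega>. \<bar>U \<omega>\<bar> \<le> c"
    let ?E = "\<lambda>\<omega>. euler h \<delta> (\<lambda>k. W (\<tau> (Suc k)) \<omega> - W (\<tau> k) \<omega>) (\<xi> \<omega>) N"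
    have EN: "?E \<in> borel_measurable (F (\<tau> N))"
      by (rule euler_measurable[OF \<tau>(1) \<tau>2 \<xi> le_SucI[OF order_refl]])
    have UN: "U \<in> borel_measurable (F (\<tau> N))" by (rule F_measurable_mono[OF U \<tau>(1) \<tau>N(2)])
    have gm: "(\<lambda>p. f (step h \<delta> (fst p) (snd p))) \<in> borel_measurable (borel \<Otimes>\<^sub>M borel)"
      using measurable_compose[OF st f(1)] by (simp only: case_prod_beta')
    have "(\<integral>\<omega>. U \<omega> * f (step h \<delta> (?E \<omega>) (?V \<omega>)) \<partial>M) = (\<integral>\<omega>. U \<omega> * f' (?E \<omega>) \<partial>M)"
      using indep_integral[OF \<tau>N(1,3) EN UN spec[OF c] gm f(2)] unfolding fst_conv snd_conv f'_def .
    then show "(\<integral>\<omega>. U \<omega> * f (euler h \<delta> (\<lambda>k. W (\<tau> (Suc k)) \<omega> - W (\<tau> k) \<omega>) (\<xi> \<omega>) (Suc N)) \<partial>M) = (\<integral>\<omega>. U \<omega> * G (\<xi> \<omega>) \<partial>M)"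
      unfolding G(4)[OF \<xi> U c, symmetric] euler.simps .
  qed
qed


section \<open>Uniform moduli of Brownian paths and convergence of the operators\<close>

lemma W_continuous: "AE \<omega> in M. continuous_on {0..} (\<lambda>t. W t \<omega>)"
  using bm by (simp add: brownian_motion_def)

text \<open>Almost every path is uniformly continuous, so a common modulus holds outside a set of
  small probability. The event is defined by rational times to be measurable; continuity extends the
  bound to all times.\<close>

lemma W_modulus:
  assumes a: "0 \<le> a" "a < e" and r: "0 < r" and \<epsilon>: "0 < \<epsilon>"
  obtains \<delta> E where "0 < \<delta>" "E \<in> events" "prob (space M - E) \<le> \<epsilon>"
    "AE \<omega> in M. \<omega> \<in> E \<longrightarrow> (\<forall>u v. a \<le> u \<longrightarrow> u \<le> v \<longrightarrow> v \<le> e \<longrightarrow> v - u < \<delta> \<longrightarrow> norm (W v \<omega> - W u \<omega>) \<le> r)"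
proof -
  define R where "R = {a<..<e} \<inter> \<rat>"
  have R: "countable R" "R \<subseteq> {a..e}"
    by (auto simp: R_def countable_rat)
  have clR: "closure R = {a..e}"
    using a closure_open_Int_superset[of "{a<..<e}" \<rat>] by (simp add: R_def Rats_closure_real)
  define A where "A m = {\<omega> \<in> space M. \<forall>u\<in>R. \<forall>v\<in>R. \<bar>v - u\<bar> < 1 / real (Suc m) \<longrightarrow> norm (W v \<omega> - W u \<omega>) \<le> r}" for m
  have A: "A m \<in> events" for m
  proof -
    have [measurable]: "W u \<in> borel_measurable M" if "u \<in> R" for u
      using R(2) that a by (intro W_M) auto
    let ?S = "\<lambda>u v. {\<omega> \<in> space M. \<bar>v - u\<bar> < 1 / real (Suc m) \<and> \<not> norm (W v \<omega> - W u \<omega>) \<le> r}"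
    have S: "?S u v \<in> events" if "u \<in> R" "v \<in> R" for u v
      using that by measurable
    have "(\<Union>v\<in>R. ?S u v) \<in> events" if "u \<in> R" for u
      by (rule sets.countable_UN'[OF R(1)]) (use S that in blast)
    then have "(\<Union>u\<in>R. \<Union>v\<in>R. ?S u v) \<in> events"
      by (rule sets.countable_UN'[OF R(1) image_subsetI])
    moreover have "A m = space M - (\<Union>u\<in>R. \<Union>v\<in>R. ?S u v)"
    proof (rule set_eqI)
      fix \<omega> show "\<omega> \<in> A m \<longleftrightarrow> \<omega> \<in> space M - (\<Union>u\<in>R. \<Union>v\<in>R. ?S u v)"
        unfolding A_def mem_Collect_eq Diff_iff UN_iff by blast
    qed
    ultimately show ?thesis by (simp only: sets.Diff sets.top)
  qed
  have "incseq A"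
  proof (rule monoI, rule subsetI)
    fix m m' :: nat and \<omega> assume "m \<le> m'" and \<omega>: "\<omega> \<in> A m"
    then have le: "1 / real (Suc m') \<le> 1 / real (Suc m)" by (simp add: frac_le)
    show "\<omega> \<in> A m'"
      unfolding A_def
    proof (intro CollectI conjI ballI impI)
      fix u v assume uv: "u \<in> R" "v \<in> R" "\<bar>v - u\<bar> < 1 / real (Suc m')"
      then have "\<bar>v - u\<bar> < 1 / real (Suc m)" using le by linarith
      then show "norm (W v \<omega> - W u \<omega>) \<le> r" using \<omega> uv unfolding A_def by blast
    qed (use \<omega> in \<open>simp add: A_def\<close>)
  qed
  have cont: "AE \<omega> in M. \<omega> \<in> space M \<and> continuous_on {a..e} (\<lambda>t. W t \<omega>)"
    using W_continuous
  proof (rule AE_mp, intro AE_I2 impI conjI)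
    fix \<omega> assume "continuous_on {0..} (\<lambda>t. W t \<omega>)"
    then show "continuous_on {a..e} (\<lambda>t. W t \<omega>)" using a by (auto elim: continuous_on_subset)
  qed
  have "AE \<omega> in M. \<omega> \<in> (\<Union>m. A m)"
    using cont
  proof (rule AE_mp, intro AE_I2 impI)
    fix \<omega> assume \<omega>: "\<omega> \<in> space M \<and> continuous_on {a..e} (\<lambda>t. W t \<omega>)"
    then have "uniformly_continuous_on {a..e} (\<lambda>t. W t \<omega>)" by (auto intro: compact_uniformly_continuous)
    then obtain \<delta> where \<delta>: "0 < \<delta>" "\<And>u v. u \<in> {a..e} \<Longrightarrow> v \<in> {a..e} \<Longrightarrow> dist v u < \<delta> \<Longrightarrow> dist (W v \<omega>) (W u \<omega>) < r"
      using r unfolding uniformly_continuous_on_def by blast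
    obtain m where m: "1 / real (Suc m) < \<delta>" using \<delta>(1) nat_approx_posE by blast
    have "\<omega> \<in> A m"
      unfolding A_def
    proof (intro CollectI conjI ballI impI)
      fix u v assume "u \<in> R" "v \<in> R" "\<bar>v - u\<bar> < 1 / real (Suc m)"
      then have "dist (W v \<omega>) (W u \<omega>) < r" using R(2) m by (intro \<delta>(2)) (auto simp: dist_real_def)
      then show "norm (W v \<omega> - W u \<omega>) \<le> r" by (simp add: dist_norm)
    qed (use \<omega> in simp)
    then show "\<omega> \<in> (\<Union>m. A m)" by blast
  qed
  then have "prob (\<Union>m. A m) = 1"
    using A by (subst prob_eq_1) auto
  then have "(\<lambda>m. prob (A m)) \<longlonglongrightarrow> 1"
    using finite_Lim_measure_incseq[of A] A \<open>incseq A\<close> by auto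
  then have "eventually (\<lambda>m. 1 - \<epsilon> < prob (A m)) sequentially"
    using \<epsilon> by (intro order_tendstoD(1)) auto
  then obtain m where m: "1 - \<epsilon> < prob (A m)" by (meson eventually_happens trivial_limit_sequentially)
  show thesis
  proof (rule that[of "1 / real (Suc m)" "A m"])
    show "prob (space M - A m) \<le> \<epsilon>" using m A[of m] by (simp add: prob_compl)
    show "AE \<omega> in M. \<omega> \<in> A m \<longrightarrow> (\<forall>u v. a \<le> u \<longrightarrow> u \<le> v \<longrightarrow> v \<le> e \<longrightarrow> v - u < 1 / real (Suc m) \<longrightarrow> norm (W v \<omega> - W u \<omega>) \<le> r)"
      using cont
    proof (rule AE_mp, intro AE_I2 impI allI)
      fix \<omega> u v
      assume \<omega>: "\<omega> \<in> space M \<and> continuous_on {a..e} (\<lambda>t. W t \<omega>)" "\<omega> \<in> A m"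
        and u: "a \<le> u" "u \<le> v" "v \<le> e" "v - u < 1 / real (Suc m)"
      obtain p where p: "\<And>k. p k \<in> R" "p \<longlonglongrightarrow> u"
        using closure_sequential[of u R] u by (auto simp: clR)
      obtain q where q: "\<And>k. q k \<in> R" "q \<longlonglongrightarrow> v"
        using closure_sequential[of v R] u by (auto simp: clR)
      have "(\<lambda>k. \<bar>q k - p k\<bar>) \<longlonglongrightarrow> \<bar>v - u\<bar>" by (intro tendsto_intros p q)
      then have "eventually (\<lambda>k. \<bar>q k - p k\<bar> < 1 / real (Suc m)) sequentially"
        using u by (intro order_tendstoD(2)) auto
      then have ev: "eventually (\<lambda>k. norm (W (q k) \<omega> - W (p k) \<omega>) \<le> r) sequentially"
        by eventually_elim (use \<omega>(2) p q in \<open>auto simp: A_def\<close>)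
      have pq: "\<forall>\<^sub>F k in sequentially. p k \<in> {a..e}" "\<forall>\<^sub>F k in sequentially. q k \<in> {a..e}"
        using p(1) q(1) R(2) by (blast intro: always_eventually)+
      have Wp: "(\<lambda>k. W (p k) \<omega>) \<longlonglongrightarrow> W u \<omega>"
        using \<omega>(1) u by (intro continuous_on_tendsto_compose[of "{a..e}" "\<lambda>t. W t \<omega>" p u] p(2) pq) auto
      have Wq: "(\<lambda>k. W (q k) \<omega>) \<longlonglongrightarrow> W v \<omega>"
        using \<omega>(1) u by (intro continuous_on_tendsto_compose[of "{a..e}" "\<lambda>t. W t \<omega>" q v] q(2) pq) auto
      have "(\<lambda>k. norm (W (q k) \<omega> - W (p k) \<omega>)) \<longlonglongrightarrow> norm (W v \<omega> - W u \<omega>)"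
        by (intro tendsto_intros Wp Wq)
      then show "norm (W v \<omega> - W u \<omega>) \<le> r" using ev by (intro tendsto_upperbound) auto
    qed
  qed (use A in auto)
qed

lemma joint_solution_measurable:
  assumes "joint_solution Z D" "0 \<le> t"
  shows "(\<lambda>\<omega>. (Z t \<omega>, D t \<omega>)) \<in> borel_measurable (F t)" "(\<lambda>\<omega>. (Z t \<omega>, D t \<omega>)) \<in> borel_measurable M"
proof -
  show "(\<lambda>\<omega>. (Z t \<omega>, D t \<omega>)) \<in> borel_measurable (F t)"
    using assms by (intro borel_measurable_Pair) (auto simp: joint_solution_def adapted_def)
  then show "(\<lambda>\<omega>. (Z t \<omega>, D t \<omega>)) \<in> borel_measurable M" by (rule F_measurable_M[OF assms(2)])
qed

text \<open>Mesh, threshold and exceptional event of the \<open>k\<close>-th scheme come from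
  \<open>W_modulus\<close>, that is, from the Brownian motion only. So \<open>G k\<close> is fixed
  before \<open>Z\<close>, \<open>D\<close> and \<open>U\<close>, although the rate of convergence
  depends on them.\<close>

lemma approx_transition:
  assumes a: "0 \<le> a" "a < e"
    and f: "f \<in> borel_measurable borel" "\<And>x. \<bar>f x\<bar> \<le> 1" and L: "0 \<le> L" "\<And>x y. \<bar>f x - f y\<bar> \<le> L * norm (x - y)"
  shows "\<exists>G :: nat \<Rightarrow> _ \<Rightarrow> real. (\<forall>k. G k \<in> borel_measurable borel) \<and> (\<forall>k x. \<bar>G k x\<bar> \<le> 1) \<and> (\<forall>k. lipschitz_gauge (L * RB) (G k)) \<and>
    (\<forall>Z D U c. joint_solution Z D \<longrightarrow> U \<in> borel_measurable (F a) \<longrightarrow> (\<forall>\<omega>. \<bar>U \<omega>\<bar> \<le> c) \<longrightarrow>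
      (\<lambda>k. \<integral>\<omega>. U \<omega> * G k (Z a \<omega>, D a \<omega>) \<partial>M) \<longlonglongrightarrow> (\<integral>\<omega>. U \<omega> * f (Z e \<omega>, D e \<omega>) \<partial>M))"
proof -
  define \<delta> where "\<delta> k = 1 / real (Suc k)" for k
  have \<delta>0: "0 < \<delta> k" for k by (simp add: \<delta>_def)
  have \<delta>lim: "\<delta> \<longlonglongrightarrow> 0"
    unfolding \<delta>_def using LIMSEQ_inverse_real_of_nat by (simp add: inverse_eq_divide)
  \<comment> \<open>With the mesh below \<open>r k\<close> as well, \<open>C1\<close> times mesh
    plus modulus is at most \<open>\<delta> k\<close>.\<close>
  define r where "r k = \<delta> k / (2 * C1)" for k
  have r0: "0 < r k" for k using C1_pos \<delta>0 by (simp add: r_def)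
  define P where "P k N E \<longleftrightarrow> 0 < N \<and> (e - a) / real N \<le> \<delta> k \<and> C1 * ((e - a) / real N + r k) \<le> \<delta> k \<and> E \<in> events \<and> prob (space M - E) \<le> \<delta> k \<and>
      (AE \<omega> in M. \<omega> \<in> E \<longrightarrow> (\<forall>u v. a \<le> u \<longrightarrow> u \<le> v \<longrightarrow> v \<le> e \<longrightarrow> v - u \<le> (e - a) / real N \<longrightarrow> norm (W v \<omega> - W u \<omega>) \<le> r k))" for k N E
  have "\<exists>N E. P k N E" for k
  proof -
    obtain m E where mE: "0 < m" "E \<in> events" "prob (space M - E) \<le> \<delta> k"
      "AE \<omega> in M. \<omega> \<in> E \<longrightarrow> (\<forall>u v. a \<le> u \<longrightarrow> u \<le> v \<longrightarrow> v \<le> e \<longrightarrow> v - u < m \<longrightarrow> norm (W v \<omega> - W u \<omega>) \<le> r k)"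
      by (rule W_modulus[OF a r0[of k] \<delta>0[of k]])
    obtain N where N: "0 < N" "(e - a) / real N < min m (min (r k) (\<delta> k))"
      using fine_grid[of "min m (min (r k) (\<delta> k))" "e - a"] mE(1) r0 \<delta>0 by auto
    have "C1 * ((e - a) / real N + r k) \<le> C1 * (r k + r k)"
      using N(2) C1_pos by (intro mult_left_mono) auto
    also have "\<dots> = \<delta> k" using C1_pos by (simp add: r_def)
    finally have "C1 * ((e - a) / real N + r k) \<le> \<delta> k" .
    moreover have "AE \<omega> in M. \<omega> \<in> E \<longrightarrow> (\<forall>u v. a \<le> u \<longrightarrow> u \<le> v \<longrightarrow> v \<le> e \<longrightarrow> v - u \<le> (e - a) / real N \<longrightarrow> norm (W v \<omega> - W u \<omega>) \<le> r k)"
      using mE(4)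
    proof eventually_elim
      case (elim \<omega>)
      have "(e - a) / real N < m" using N(2) by simp
      then show ?case using elim le_less_trans by blast
    qed
    ultimately show ?thesis using N mE unfolding P_def by (intro exI[of _ N] exI[of _ E] conjI) auto
  qed
  then obtain N E where "\<And>k. P k (N k) (E k)" by metis
  then have NE: "\<And>k. 0 < N k" "\<And>k. (e - a) / real (N k) \<le> \<delta> k" "\<And>k. C1 * ((e - a) / real (N k) + r k) \<le> \<delta> k"
    "\<And>k. E k \<in> events" "\<And>k. prob (space M - E k) \<le> \<delta> k"
    "\<And>k. AE \<omega> in M. \<omega> \<in> E k \<longrightarrow> (\<forall>u v. a \<le> u \<longrightarrow> u \<le> v \<longrightarrow> v \<le> e \<longrightarrow> v - u \<le> (e - a) / real (N k) \<longrightarrow> norm (W v \<omega> - W u \<omega>) \<le> r k)"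
    by (auto simp: P_def)
  define eul where "eul k \<xi> \<omega> = euler ((e - a) / real (N k)) (\<delta> k)
    (\<lambda>j. W (grid a e (N k) (Suc j)) \<omega> - W (grid a e (N k) j) \<omega>) (\<xi> \<omega>) (N k)" for k and \<xi> :: "'w \<Rightarrow> (real^'n) \<times> (real^'n)" and \<omega>
  have lf: "lipschitz_gauge (L * RB) f"
    unfolding lipschitz_gauge_def
  proof (intro allI impI)
    fix z y y' l assume l: "0 < (l::real)" "(y - y') /\<^sub>R l \<in> B"
    have "\<bar>f (z, y) - f (z, y')\<bar> \<le> L * norm (y - y')" using L(2)[of "(z, y)" "(z, y')"] by (simp add: norm_Pair)
    also have "\<dots> \<le> L * (RB * l)" using in_B_norm[OF l(2,1)] L(1) by (rule mult_left_mono)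
    finally show "\<bar>f (z, y) - f (z, y')\<bar> \<le> L * RB * l" by (simp add: mult_ac)
  qed
  have gr1: "0 \<le> grid a e (N k) 0" for k using a by simp
  have gr2: "grid a e (N k) j < grid a e (N k) (Suc j)" if "j < N k" for j k
    using a that by (intro grid_less)
  define R where "R k G \<longleftrightarrow> G \<in> borel_measurable borel \<and> (\<forall>x. \<bar>G x\<bar> \<le> 1) \<and> lipschitz_gauge (L * RB) G \<and>
    (\<forall>\<xi> U c. \<xi> \<in> borel_measurable (F a) \<longrightarrow> U \<in> borel_measurable (F a) \<longrightarrow> (\<forall>\<omega>. \<bar>U \<omega>\<bar> \<le> c) \<longrightarrow>
      (\<integral>\<omega>. U \<omega> * f (eul k \<xi> \<omega>) \<partial>M) = (\<integral>\<omega>. U \<omega> * G (\<xi> \<omega>) \<partial>M))" for k G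
  have "\<exists>G. R k G" for k
    using euler_transition[OF gr1[of k] gr2[of _ k] f lf, where h = "(e - a) / real (N k)" and \<delta> = "\<delta> k"] unfolding R_def eul_def grid_0 .
  then obtain G where "\<And>k. R k (G k)" by metis
  then have G: "\<And>k. G k \<in> borel_measurable borel" "\<And>k x. \<bar>G k x\<bar> \<le> 1" "\<And>k. lipschitz_gauge (L * RB) (G k)"
    "\<And>k \<xi> U c. \<xi> \<in> borel_measurable (F a) \<Longrightarrow> U \<in> borel_measurable (F a) \<Longrightarrow> (\<And>\<omega>. \<bar>U \<omega>\<bar> \<le> c) \<Longrightarrow>
      (\<integral>\<omega>. U \<omega> * f (eul k \<xi> \<omega>) \<partial>M) = (\<integral>\<omega>. U \<omega> * G k (\<xi> \<omega>) \<partial>M)"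
    unfolding R_def by blast+
  show ?thesis
  proof (intro exI[of _ G] conjI allI impI G(1,2,3))
    fix Z D :: "real \<Rightarrow> 'w \<Rightarrow> real^'n" and U :: "'w \<Rightarrow> real" and c :: real
    assume J: "joint_solution Z D" and U: "U \<in> borel_measurable (F a)" and "\<forall>\<omega>. \<bar>U \<omega>\<bar> \<le> c"
    then have c: "\<And>\<omega>. \<bar>U \<omega>\<bar> \<le> c" by simp
    let ?\<xi> = "\<lambda>\<omega>. (Z a \<omega>, D a \<omega>)" and ?\<zeta> = "\<lambda>\<omega>. (Z e \<omega>, D e \<omega>)"
    have c0: "0 \<le> c" using c[of undefined] by linarith
    have e0: "0 \<le> e" using a by simp
    have [measurable]: "U \<in> borel_measurable M" by (rule F_measurable_M[OF a(1) U])
    note [measurable] = f(1) NE(4)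
    have xi: "?\<xi> \<in> borel_measurable (F (grid a e (N k) 0))" for k
      using joint_solution_measurable(1)[OF J a(1)] by simp
    have eulM: "eul k ?\<xi> \<in> borel_measurable M" for k
    proof (rule F_measurable_M[OF e0])
      show "eul k ?\<xi> \<in> borel_measurable (F e)"
        using euler_measurable[where N = "N k" and \<tau> = "grid a e (N k)" and k = "N k" and \<xi> = ?\<xi>
            and h = "(e - a) / real (N k)" and \<delta> = "\<delta> k"] gr1[of k] gr2[of _ k] xi[of k]
        unfolding eul_def grid_N[OF NE(1)[of k]] by blast
    qed
    have m1[measurable]: "(\<lambda>\<omega>. f (eul k ?\<xi> \<omega>)) \<in> borel_measurable M" for k
      by (rule measurable_compose[OF eulM f(1)])
    have m2[measurable]: "(\<lambda>\<omega>. f (?\<zeta> \<omega>)) \<in> borel_measurable M"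
      by (rule measurable_compose[OF joint_solution_measurable(2)[OF J e0] f(1)])
    \<comment> \<open>A path need not belong to \<open>E k\<close> for all large \<open>k\<close>;
      the indicator makes \<open>X k\<close> tend to 0 anyway. Outside \<open>E k\<close> the error
      is at most 2 and weighted by a probability of at most \<open>\<delta> k\<close>.\<close>
    define X where "X k \<omega> = indicator (E k) \<omega> * \<bar>f (eul k ?\<xi> \<omega>) - f (?\<zeta> \<omega>)\<bar>" for k \<omega>
    have Xm[measurable]: "X k \<in> borel_measurable M" for k unfolding X_def by measurable
    have X2: "\<bar>X k \<omega>\<bar> \<le> 2" for k \<omega>
      using f(2)[of "eul k ?\<xi> \<omega>"] f(2)[of "?\<zeta> \<omega>"] by (auto simp: X_def indicator_def)
    obtain Y where Y: "AE \<omega> in M. path_sol (\<lambda>t. W t \<omega>) (\<lambda>t. Z t \<omega>) (\<lambda>t. Y t \<omega>) (\<lambda>t. D t \<omega>)"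
      using J by (auto simp: joint_solution_def)
    have mod: "AE \<omega> in M. \<forall>k. \<omega> \<in> E k \<longrightarrow> (\<forall>u v. a \<le> u \<longrightarrow> u \<le> v \<longrightarrow> v \<le> e \<longrightarrow> v - u \<le> (e - a) / real (N k) \<longrightarrow> norm (W v \<omega> - W u \<omega>) \<le> r k)"
      using NE(6) by (simp add: AE_all_countable)
    have "AE \<omega> in M. (\<lambda>k. X k \<omega>) \<longlonglongrightarrow> 0"
      using Y mod
    proof eventually_elim
      case (elim \<omega>)
      show ?case
      proof (rule LIMSEQ_I)
        fix \<epsilon> :: real assume \<epsilon>: "0 < \<epsilon>"
        define s where "s = L + 1"
        have s: "0 < s" "L \<le> s" using L(1) by (auto simp: s_def)
        define \<epsilon>' where "\<epsilon>' = \<epsilon> / (2 * s)"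
        have \<epsilon>': "0 < \<epsilon>'" "L * \<epsilon>' < \<epsilon>"
        proof -
          show "0 < \<epsilon>'" using \<epsilon> s by (simp add: \<epsilon>'_def)
          then have "L * \<epsilon>' \<le> s * \<epsilon>'" using s by (intro mult_right_mono) auto
          also have "\<dots> = \<epsilon> / 2" using s by (simp add: \<epsilon>'_def)
          finally show "L * \<epsilon>' < \<epsilon>" using \<epsilon> by simp
        qed
        obtain \<eta> where \<eta>: "0 < \<eta>" "\<And>N \<delta> r. \<lbrakk>0 < N; (e - a) / real N \<le> \<eta>; \<delta> \<le> \<eta>;
          \<And>u v. a \<le> u \<Longrightarrow> u \<le> v \<Longrightarrow> v \<le> e \<Longrightarrow> v - u \<le> (e - a) / real N \<Longrightarrow> norm (W v \<omega> - W u \<omega>) \<le> r;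
          C1 * ((e - a) / real N + r) \<le> \<delta>\<rbrakk> \<Longrightarrow>
          norm (euler ((e - a) / real N) \<delta> (\<lambda>k. W (grid a e N (Suc k)) \<omega> - W (grid a e N k) \<omega>) (Z a \<omega>, D a \<omega>) N - (Z e \<omega>, D e \<omega>)) \<le> \<epsilon>'"
          using euler_converges[OF elim(1) a \<epsilon>'(1)] by blast
        obtain k0 where k0: "\<And>k. k0 \<le> k \<Longrightarrow> \<delta> k < \<eta>"
          using order_tendstoD(2)[OF \<delta>lim \<eta>(1)] by (auto simp: eventually_sequentially)
        show "\<exists>k0. \<forall>k\<ge>k0. norm (X k \<omega> - 0) < \<epsilon>"
        proof (intro exI[of _ k0] allI impI)
          fix k assume k: "k0 \<le> k"
          show "norm (X k \<omega> - 0) < \<epsilon>"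
          proof (cases "\<omega> \<in> E k")
            case True
            have "norm (eul k ?\<xi> \<omega> - ?\<zeta> \<omega>) \<le> \<epsilon>'"
              unfolding eul_def
              using k0[OF k] NE(2)[of k] elim(2) True by (intro \<eta>(2)[OF NE(1) _ _ _ NE(3)]) auto
            then have "L * norm (eul k ?\<xi> \<omega> - ?\<zeta> \<omega>) \<le> L * \<epsilon>'" using L(1) by (rule mult_left_mono)
            then have "\<bar>f (eul k ?\<xi> \<omega>) - f (?\<zeta> \<omega>)\<bar> < \<epsilon>"
              using L(2)[of "eul k ?\<xi> \<omega>" "?\<zeta> \<omega>"] \<epsilon>'(2) by linarith
            then show ?thesis using True by (simp add: X_def)
          qed (use \<epsilon> in \<open>simp add: X_def\<close>)
        qed
      qed
    qed
    then have "(\<lambda>k. \<integral>\<omega>. X k \<omega> \<partial>M) \<longlonglongrightarrow> (\<integral>\<omega>. 0 \<partial>M)"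
      using X2 by (intro integral_dominated_convergence[where w = "\<lambda>_. 2"]) auto
    then have "(\<lambda>k. c * (\<integral>\<omega>. X k \<omega> \<partial>M) + c * (2 * \<delta> k)) \<longlonglongrightarrow> c * (\<integral>\<omega>. 0 \<partial>M) + c * (2 * 0)"
      by (intro tendsto_intros \<delta>lim)
    then have lim0: "(\<lambda>k. c * (\<integral>\<omega>. X k \<omega> \<partial>M) + c * (2 * \<delta> k)) \<longlonglongrightarrow> 0" by simp
    have bd: "norm ((\<integral>\<omega>. U \<omega> * G k (?\<xi> \<omega>) \<partial>M) - (\<integral>\<omega>. U \<omega> * f (?\<zeta> \<omega>) \<partial>M)) \<le> c * (\<integral>\<omega>. X k \<omega> \<partial>M) + c * (2 * \<delta> k)" for k
    proof -
      have Uf: "\<bar>U \<omega> * f x\<bar> \<le> c * 1" for \<omega> x unfolding abs_mult by (intro mult_mono c f(2)) (use c0 in auto)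
      have i1: "integrable M (\<lambda>\<omega>. U \<omega> * f (eul k ?\<xi> \<omega>))" "integrable M (\<lambda>\<omega>. U \<omega> * f (?\<zeta> \<omega>))"
        by (rule abs_expectation_le(1)[OF _ Uf]; measurable)+
      have i2: "integrable M (X k)" by (rule abs_expectation_le(1)[OF Xm X2])
      have i3: "integrable M (\<lambda>\<omega>. indicator (space M - E k) \<omega> :: real)"
        by (rule abs_expectation_le(1)[where c = 1]) (auto simp: indicator_def)
      have "(\<integral>\<omega>. U \<omega> * G k (?\<xi> \<omega>) \<partial>M) = (\<integral>\<omega>. U \<omega> * f (eul k ?\<xi> \<omega>) \<partial>M)"
        by (rule G(4)[OF joint_solution_measurable(1)[OF J a(1)] U c, symmetric])
      then have "\<bar>(\<integral>\<omega>. U \<omega> * G k (?\<xi> \<omega>) \<partial>M) - (\<integral>\<omega>. U \<omega> * f (?\<zeta> \<omega>) \<partial>M)\<bar>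
        = \<bar>\<integral>\<omega>. U \<omega> * f (eul k ?\<xi> \<omega>) - U \<omega> * f (?\<zeta> \<omega>) \<partial>M\<bar>"
        by (simp only: Bochner_Integration.integral_diff[OF i1])
      also have "\<dots> \<le> (\<integral>\<omega>. c * X k \<omega> + c * (2 * indicator (space M - E k) \<omega>) \<partial>M)"
      proof (rule abs_integral_le_integral)
        show "AE \<omega> in M. \<bar>U \<omega> * f (eul k ?\<xi> \<omega>) - U \<omega> * f (?\<zeta> \<omega>)\<bar> \<le> c * X k \<omega> + c * (2 * indicator (space M - E k) \<omega>)"
        proof (rule AE_I2)
          fix \<omega> assume \<omega>: "\<omega> \<in> space M"
          have "\<bar>U \<omega> * f (eul k ?\<xi> \<omega>) - U \<omega> * f (?\<zeta> \<omega>)\<bar> = \<bar>U \<omega>\<bar> * \<bar>f (eul k ?\<xi> \<omega>) - f (?\<zeta> \<omega>)\<bar>"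
            by (simp add: right_diff_distrib[symmetric] abs_mult)
          also have "\<dots> \<le> c * (X k \<omega> + 2 * indicator (space M - E k) \<omega>)"
            using \<omega> f(2)[of "eul k ?\<xi> \<omega>"] f(2)[of "?\<zeta> \<omega>"]
            by (intro mult_mono c c0) (auto simp: X_def indicator_def)
          finally show "\<bar>U \<omega> * f (eul k ?\<xi> \<omega>) - U \<omega> * f (?\<zeta> \<omega>)\<bar> \<le> c * X k \<omega> + c * (2 * indicator (space M - E k) \<omega>)"
            by (simp add: distrib_left)
        qed
      qed (intro Bochner_Integration.integrable_diff i1 Bochner_Integration.integrable_add integrable_mult_right i2 i3)+
      also have "\<dots> = c * (\<integral>\<omega>. X k \<omega> \<partial>M) + c * (2 * prob (space M - E k))"
        by (subst Bochner_Integration.integral_add)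
          (auto intro!: integrable_mult_right i2 i3 simp: Int_absorb2)
      also have "\<dots> \<le> c * (\<integral>\<omega>. X k \<omega> \<partial>M) + c * (2 * \<delta> k)"
        using NE(5)[of k] c0 by (intro add_left_mono mult_left_mono) auto
      finally show ?thesis by simp
    qed
    show "(\<lambda>k. \<integral>\<omega>. U \<omega> * G k (?\<xi> \<omega>) \<partial>M) \<longlonglongrightarrow> (\<integral>\<omega>. U \<omega> * f (?\<zeta> \<omega>) \<partial>M)"
      by (rule LIM_zero_cancel, rule Lim_null_comparison[OF _ lim0]) (use bd in auto)
  qed
qed

end

section \<open>The Markov property\<close>

text \<open>Indicators of closed sets are limits of the truncated functions
  \<open>1 - real k * infdist x C\<close>, and closed sets form an intersection-stable
  generator.\<close>

lemma measure_eqI_lipschitz: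
  fixes N1 N2 :: "'a::metric_space measure"
  assumes sets: "sets N1 = sets borel" "sets N2 = sets borel" and fin: "finite_measure N1" "finite_measure N2"
    and eq: "\<And>(f :: 'a \<Rightarrow> real) L. f \<in> borel_measurable borel \<Longrightarrow> (\<And>x. \<bar>f x\<bar> \<le> 1) \<Longrightarrow> 0 \<le> L \<Longrightarrow>
      (\<And>x y. \<bar>f x - f y\<bar> \<le> L * dist x y) \<Longrightarrow> integral\<^sup>L N1 f = integral\<^sup>L N2 f"
  shows "N1 = N2"
proof -
  interpret N1: finite_measure N1 by (rule fin)
  interpret N2: finite_measure N2 by (rule fin)
  have sp: "space N1 = UNIV" "space N2 = UNIV" using sets_eq_imp_space_eq[OF sets(1)] sets_eq_imp_space_eq[OF sets(2)] by auto
  have closed_eq: "measure N1 C = measure N2 C" if C: "closed C" for C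
  proof (cases "C = {}")
    case False
    define f where "f k x = max 0 (1 - real k * infdist x C)" for k :: nat and x
    have f1: "\<bar>f k x\<bar> \<le> 1" for k x by (simp add: f_def infdist_nonneg)
    have f2: "\<bar>f k x - f k y\<bar> \<le> real k * dist x y" for k x y
    proof -
      have "\<bar>infdist x C - infdist y C\<bar> \<le> dist x y" by (rule infdist_triangle_abs)
      then have "\<bar>real k * infdist x C - real k * infdist y C\<bar> \<le> real k * dist x y"
        unfolding right_diff_distrib[symmetric] abs_mult by (simp add: mult_left_mono)
      then show ?thesis by (auto simp: f_def max_def)
    qed
    have fm: "f k \<in> borel_measurable borel" for k
      unfolding f_def by (intro borel_measurable_continuous_onI continuous_intros)
    have lim: "(\<lambda>k. f k x) \<longlonglongrightarrow> indicator C x" for x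
    proof (cases "x \<in> C")
      case True
      then show ?thesis by (simp add: f_def)
    next
      case x: False
      then have pos: "0 < infdist x C"
        using in_closed_iff_infdist_zero[OF C False, of x] x infdist_nonneg[of x C] by linarith
      obtain K :: nat where "1 / infdist x C < real K" using reals_Archimedean2 by blast
      then have K: "1 < real K * infdist x C" using pos by (simp add: pos_divide_less_eq)
      have "f k x = 0" if "K \<le> k" for k
      proof -
        have "real K * infdist x C \<le> real k * infdist x C" using that pos by (intro mult_right_mono) auto
        then show ?thesis using K by (simp add: f_def)
      qed
      then have "eventually (\<lambda>k. f k x = 0) sequentially" by (auto simp: eventually_sequentially)
      then show ?thesis using x by (simp add: tendsto_eventually)
    qed
    have "(\<lambda>k. integral\<^sup>L N1 (f k)) \<longlonglongrightarrow> (\<integral>x. indicator C x \<partial>N1)"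
      using fm f1 lim C sets by (intro integral_dominated_convergence[where w = "\<lambda>_. 1"])
        (auto cong: measurable_cong_sets)
    moreover have "(\<lambda>k. integral\<^sup>L N2 (f k)) \<longlonglongrightarrow> (\<integral>x. indicator C x \<partial>N2)"
      using fm f1 lim C sets by (intro integral_dominated_convergence[where w = "\<lambda>_. 1"])
        (auto cong: measurable_cong_sets)
    moreover have "integral\<^sup>L N1 (f k) = integral\<^sup>L N2 (f k)" for k
      by (rule eq[OF fm f1 _ f2]) simp
    ultimately have "(\<integral>x. indicator C x \<partial>N1) = (\<integral>x. indicator C x \<partial>N2 :: real)"
      using LIMSEQ_unique by auto
    then show ?thesis using sp by simp
  qed simp
  show ?thesis
  proof (rule measure_eqI_generator_eq[where E = "Collect closed" and A = "\<lambda>_. UNIV" and \<Omega> = UNIV])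
    show "sets N1 = sigma_sets UNIV (Collect closed)" "sets N2 = sigma_sets UNIV (Collect closed)"
      unfolding sets borel_eq_closed by simp_all
    show "emeasure N1 X = emeasure N2 X" if "X \<in> Collect closed" for X
      using closed_eq that by (simp add: N1.emeasure_eq_measure N2.emeasure_eq_measure)
  qed (auto simp: Int_stable_def N1.emeasure_eq_measure)
qed

context rbm_euler
begin

text \<open>For an event \<open>A\<close> known at time \<open>a\<close>, let \<open>P\<close> be
  its conditional probability given the state at \<open>a\<close>. Weighting by \<open>A\<close> or
  by \<open>P\<close> gives the same integral of \<open>G k\<close> of that state, hence in the
  limit the same integral of any test function of the state at \<open>e\<close>. Averaging the
  latter against \<open>P\<close> involves only its conditional expectation
  \<open>h\<close>.\<close>

lemma joint_solution_markov:
  assumes J: "joint_solution Z D" and a: "0 \<le> a" "a < e" and g: "g \<in> borel_measurable borel" "\<And>x. \<bar>g x\<bar> \<le> c"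
  shows "AE \<omega> in M. real_cond_exp M (F a) (\<lambda>\<omega>. g (Z e \<omega>, D e \<omega>)) \<omega> =
    real_cond_exp M (vimage_algebra (space M) (\<lambda>\<omega>. (Z a \<omega>, D a \<omega>)) borel) (\<lambda>\<omega>. g (Z e \<omega>, D e \<omega>)) \<omega>"
proof -
  let ?\<xi> = "\<lambda>\<omega>. (Z a \<omega>, D a \<omega>)" and ?\<zeta> = "\<lambda>\<omega>. (Z e \<omega>, D e \<omega>)"
  define V where "V = vimage_algebra (space M) ?\<xi> borel"
  have e0: "0 \<le> e" using a by simp
  have xiF: "?\<xi> \<in> borel_measurable (F a)" by (rule joint_solution_measurable(1)[OF J a(1)])
  have xiM: "?\<xi> \<in> borel_measurable M" by (rule joint_solution_measurable(2)[OF J a(1)])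
  have [measurable]: "?\<zeta> \<in> borel_measurable M" by (rule joint_solution_measurable(2)[OF J e0])
  have spV: "space V = space M" by (simp add: V_def)
  have VF: "sets V \<subseteq> sets (F a)"
  proof
    fix A assume "A \<in> sets V"
    then obtain A' where "A = ?\<xi> -` A' \<inter> space M" "A' \<in> sets borel"
      unfolding V_def by (auto simp: sets_vimage_algebra2)
    then show "A \<in> sets (F a)" using measurable_sets[OF xiF, of A'] F_space[OF a(1)] by simp
  qed
  have FM: "sets (F a) \<subseteq> events" using F_sub[OF a(1)] by (simp add: subalgebra_def)
  have subV: "subalgebra M V" using VF FM spV by (auto simp: subalgebra_def)
  interpret V: finite_measure_subalgebra M V
    by (standard, rule subV)
  interpret FA: finite_measure_subalgebra M "F a"
    by (standard, rule F_sub[OF a(1)])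
  have VF_meas: "u \<in> borel_measurable (F a)" if "u \<in> borel_measurable V" for u :: "'w \<Rightarrow> real"
    using that VF spV F_space[OF a(1)] by (auto simp: measurable_def)
  have VM_meas: "u \<in> borel_measurable M" if "u \<in> borel_measurable V" for u :: "'w \<Rightarrow> real"
    using measurable_from_subalg[OF subV that] .
  have xiV: "?\<xi> \<in> borel_measurable V" unfolding V_def by (rule measurable_vimage_algebra1) simp
  note [measurable] = g(1)
  have gm[measurable]: "(\<lambda>\<omega>. g (?\<zeta> \<omega>)) \<in> borel_measurable M" by measurable
  have gi: "integrable M (\<lambda>\<omega>. g (?\<zeta> \<omega>))" by (rule abs_expectation_le(1)[OF gm g(2)])
  define h where "h = real_cond_exp M V (\<lambda>\<omega>. g (?\<zeta> \<omega>))"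
  have hV: "h \<in> borel_measurable V" unfolding h_def by simp
  have hi: "integrable M h" unfolding h_def by (rule V.real_cond_exp_int(1)[OF gi])
  show ?thesis
    unfolding V_def[symmetric] h_def[symmetric]
  proof (rule FA.real_cond_exp_charact[OF _ gi hi VF_meas[OF hV]])
    fix A assume A: "A \<in> sets (F a)"
    then have AM[measurable]: "A \<in> events" using FM by blast
    have ind_i: "integrable M (indicator A :: 'w \<Rightarrow> real)"
      by (rule abs_expectation_le(1)[where c = 1]) (auto simp: indicator_def)
    define R where "R = real_cond_exp M V (indicator A :: 'w \<Rightarrow> real)"
    \<comment> \<open>Truncation changes \<open>R\<close> on a null set only, but makes
      \<open>P\<close> bounded everywhere, as required of a weight \<open>U\<close>, and
      nonnegative, as required of a density.\<close>
    define P where "P \<omega> = max 0 (min 1 (R \<omega>))" for \<omega>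
    have RV[measurable]: "R \<in> borel_measurable V" unfolding R_def by simp
    have PV: "P \<in> borel_measurable V" unfolding P_def by measurable
    have [measurable]: "P \<in> borel_measurable M" "R \<in> borel_measurable M" by (rule VM_meas; fact)+
    have PR: "AE \<omega> in M. P \<omega> = R \<omega>"
      using V.real_cond_exp_ge_c[OF ind_i, of 0] V.real_cond_exp_le_c[OF ind_i, of 1]
      unfolding R_def[symmetric] by (auto simp: P_def)
    have P01: "0 \<le> P \<omega>" "P \<omega> \<le> 1" for \<omega> by (auto simp: P_def)
    have Pabs: "\<bar>P \<omega>\<bar> \<le> 1" for \<omega> using P01[of \<omega>] by simp
    have Iabs: "\<bar>indicator A \<omega> :: real\<bar> \<le> 1" for \<omega> by (simp add: indicator_def)
    have PF: "P \<in> borel_measurable (F a)" by (rule VF_meas[OF PV])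
    have IF: "(indicator A :: 'w \<Rightarrow> real) \<in> borel_measurable (F a)" using A by simp
    \<comment> \<open>The defining property of the conditional probability, tested with functions of
      the state at time \<open>a\<close>.\<close>
    have key: "(\<integral>\<omega>. indicator A \<omega> * u \<omega> \<partial>M) = (\<integral>\<omega>. P \<omega> * u \<omega> \<partial>M)"
      if u: "u \<in> borel_measurable V" and iu: "integrable M u" for u
    proof -
      have [measurable]: "u \<in> borel_measurable M" by (rule VM_meas[OF u])
      have "integrable M (\<lambda>\<omega>. u \<omega> * indicator A \<omega>)"
        using iu AM by (rule integrable_real_mult_indicator[rotated])
      then have "(\<integral>\<omega>. u \<omega> * R \<omega> \<partial>M) = (\<integral>\<omega>. u \<omega> * indicator A \<omega> \<partial>M)"
        unfolding R_def using u by (intro V.real_cond_exp_intg(2)) auto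
      moreover have "(\<integral>\<omega>. u \<omega> * R \<omega> \<partial>M) = (\<integral>\<omega>. u \<omega> * P \<omega> \<partial>M)"
        using PR by (intro integral_cong_AE) auto
      ultimately show ?thesis by (simp add: mult.commute)
    qed
    \<comment> \<open>\<open>approx_transition\<close> handles Lipschitz functions only; equality of
      these two laws of the later state extends the identity to the given \<open>g\<close>.\<close>
    define N1 where "N1 = distr (density M (\<lambda>\<omega>. ennreal (indicator A \<omega>))) borel ?\<zeta>"
    define N2 where "N2 = distr (density M (\<lambda>\<omega>. ennreal (P \<omega>))) borel ?\<zeta>"
    have int: "integral\<^sup>L N1 f = (\<integral>\<omega>. indicator A \<omega> * f (?\<zeta> \<omega>) \<partial>M)" "integral\<^sup>L N2 f = (\<integral>\<omega>. P \<omega> * f (?\<zeta> \<omega>) \<partial>M)"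
      if [measurable]: "f \<in> borel_measurable borel" for f :: "_ \<Rightarrow> real"
      unfolding N1_def N2_def using P01 by (simp_all add: integral_distr integral_real_density)
    have "N1 = N2"
    proof (rule measure_eqI_lipschitz)
      have "finite_measure (density M (\<lambda>\<omega>. ennreal (u \<omega>)))" if [measurable]: "u \<in> borel_measurable M" and u: "\<And>\<omega>. u \<omega> \<le> 1" for u
      proof (rule finite_measureI)
        have "emeasure (density M (\<lambda>\<omega>. ennreal (u \<omega>))) (space M) = (\<integral>\<^sup>+\<omega>. ennreal (u \<omega>) * indicator (space M) \<omega> \<partial>M)"
          by (rule emeasure_density) auto
        also have "\<dots> \<le> (\<integral>\<^sup>+\<omega>. 1 \<partial>M)"
          by (rule nn_integral_mono) (use u in \<open>simp add: ennreal_le_1\<close>)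
        also have "\<dots> < \<infinity>" by (simp add: emeasure_space_1)
        finally show "emeasure (density M (\<lambda>\<omega>. ennreal (u \<omega>))) (space (density M (\<lambda>\<omega>. ennreal (u \<omega>)))) \<noteq> \<infinity>" by simp
      qed
      then show "finite_measure N1" "finite_measure N2"
        unfolding N1_def N2_def using P01 by (auto intro!: finite_measure.finite_measure_distr simp: indicator_def)
      fix f :: "(real^'n) \<times> (real^'n) \<Rightarrow> real" and L
      assume f: "f \<in> borel_measurable borel" "\<And>x. \<bar>f x\<bar> \<le> 1" and L: "0 \<le> L" "\<And>x y. \<bar>f x - f y\<bar> \<le> L * dist x y"
      have L': "\<bar>f x - f y\<bar> \<le> L * norm (x - y)" for x y using L(2)[of x y] by (simp add: dist_norm)
      obtain G where G: "\<forall>k. G k \<in> borel_measurable borel" "\<forall>k x. \<bar>G k x\<bar> \<le> 1"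
        "\<forall>Z D U c. joint_solution Z D \<longrightarrow> U \<in> borel_measurable (F a) \<longrightarrow> (\<forall>\<omega>. \<bar>U \<omega>\<bar> \<le> c) \<longrightarrow>
          (\<lambda>k::nat. \<integral>\<omega>. U \<omega> * G k (Z a \<omega>, D a \<omega>) \<partial>M) \<longlonglongrightarrow> (\<integral>\<omega>. U \<omega> * f (Z e \<omega>, D e \<omega>) \<partial>M)"
        using approx_transition[OF a f L(1) L'] by (elim exE conjE)
      have lims: "(\<lambda>k. \<integral>\<omega>. indicator A \<omega> * G k (?\<xi> \<omega>) \<partial>M) \<longlonglongrightarrow> (\<integral>\<omega>. indicator A \<omega> * f (?\<zeta> \<omega>) \<partial>M)"
        "(\<lambda>k. \<integral>\<omega>. P \<omega> * G k (?\<xi> \<omega>) \<partial>M) \<longlonglongrightarrow> (\<integral>\<omega>. P \<omega> * f (?\<zeta> \<omega>) \<partial>M)"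
        using G(3) J IF PF Iabs Pabs by blast+
      have "(\<integral>\<omega>. indicator A \<omega> * G k (?\<xi> \<omega>) \<partial>M) = (\<integral>\<omega>. P \<omega> * G k (?\<xi> \<omega>) \<partial>M)" for k
      proof (rule key)
        show "(\<lambda>\<omega>. G k (?\<xi> \<omega>)) \<in> borel_measurable V" using G(1) measurable_compose[OF xiV] by blast
        then show "integrable M (\<lambda>\<omega>. G k (?\<xi> \<omega>))" using G(2) by (intro abs_expectation_le(1)[where c = 1] VM_meas) auto
      qed
      then show "integral\<^sup>L N1 f = integral\<^sup>L N2 f"
        unfolding int[OF f(1)] using lims LIMSEQ_unique by simp
    qed (simp_all add: N1_def N2_def)
    then have "(\<integral>\<omega>. indicator A \<omega> * g (?\<zeta> \<omega>) \<partial>M) = (\<integral>\<omega>. P \<omega> * g (?\<zeta> \<omega>) \<partial>M)"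
      using int[OF g(1)] by simp
    also have "\<dots> = (\<integral>\<omega>. P \<omega> * h \<omega> \<partial>M)"
      unfolding h_def
    proof (rule V.real_cond_exp_intg(2)[OF _ PV gm, symmetric])
      have "\<bar>P \<omega> * g (?\<zeta> \<omega>)\<bar> \<le> 1 * c" for \<omega>
        unfolding abs_mult by (intro mult_mono Pabs g(2)) auto
      then show "integrable M (\<lambda>\<omega>. P \<omega> * g (?\<zeta> \<omega>))" by (intro abs_expectation_le(1)) measurable
    qed
    also have "\<dots> = (\<integral>\<omega>. indicator A \<omega> * h \<omega> \<partial>M)"
      by (rule key[OF hV hi, symmetric])
    finally show "(\<integral>\<omega>\<in>A. g (?\<zeta> \<omega>) \<partial>M) = (\<integral>\<omega>\<in>A. h \<omega> \<partial>M)"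
      by (simp add: set_lebesgue_integral_def)
  qed
qed


section \<open>Small boundary probabilities\<close>

text \<open>By symmetry of \<sigma>, the noise normal to the face is the Brownian increment in this
  direction; positive definiteness makes the direction nonzero.\<close>

definition face_dir :: "'n \<Rightarrow> real^'n" where "face_dir i = \<sigma> *v n i"

lemma face_dir: "n i \<bullet> (\<sigma> *v v) = face_dir i \<bullet> v" "face_dir i \<noteq> 0"
proof -
  have sym: "transpose \<sigma> = \<sigma>" using sigma_pd by (simp add: pos_def_sym_def)
  then show "n i \<bullet> (\<sigma> *v v) = face_dir i \<bullet> v"
    unfolding symmetric_iff face_dir_def by simp
  have "n i \<noteq> 0" using n_unit[of i] by auto
  then have "0 < n i \<bullet> (\<sigma> *v n i)" using sigma_pd by (simp add: pos_def_sym_def)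
  then show "face_dir i \<noteq> 0" by (auto simp: face_dir_def)
qed

text \<open>The projection of the increment is normal with deviation
  \<open>norm a * sqrt (t - s)\<close>, and a normal density is at most the reciprocal of twice its
  deviation, since \<open>2 * pi\<close> exceeds 4.\<close>

lemma increment_anticoncentration:
  assumes s: "0 \<le> s" "s < t" and \<kappa>: "0 \<le> \<kappa>" and a: "a \<noteq> 0"
  shows "prob {\<omega> \<in> space M. \<bar>a \<bullet> (W t \<omega> - W s \<omega>)\<bar> \<le> \<kappa>} \<le> \<kappa> / (norm a * sqrt (t - s))"
proof -
  let ?V = "\<lambda>\<omega>. W t \<omega> - W s \<omega>"
  \<comment> \<open>Vanishing coordinates are dropped because a normal variable scaled by 0 has no
    density.\<close>
  define I where "I = {k. a $ k \<noteq> 0}"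
  have I: "finite I" "I \<noteq> {}" using a by (auto simp: I_def vec_eq_iff)
  have iv: "indep_vars (\<lambda>_. borel) (\<lambda>k \<omega>. ?V \<omega> $ k) UNIV"
    and nd: "\<And>k. distributed M lborel (\<lambda>\<omega>. ?V \<omega> $ k) (normal_density 0 (sqrt (t - s)))"
    using bm s unfolding brownian_motion_def by blast+
  have "indep_vars (\<lambda>_. borel) (\<lambda>k \<omega>. a $ k * (?V \<omega> $ k)) UNIV"
    by (rule indep_vars_compose2[OF iv]) simp
  then have 1: "indep_vars (\<lambda>_. borel) (\<lambda>k \<omega>. a $ k * (?V \<omega> $ k)) I"
    by (rule indep_vars_subset) simp
  have 2: "distributed M lborel (\<lambda>\<omega>. a $ k * (?V \<omega> $ k)) (normal_density 0 (\<bar>a $ k\<bar> * sqrt (t - s)))" if "k \<in> I" for k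
    using normal_density_affine[OF nd[of k], of "a $ k" 0] that s by (simp add: I_def)
  have 3: "distributed M lborel (\<lambda>\<omega>. \<Sum>k\<in>I. a $ k * (?V \<omega> $ k))
      (normal_density (\<Sum>k\<in>I. 0) (sqrt (\<Sum>k\<in>I. (\<bar>a $ k\<bar> * sqrt (t - s))\<^sup>2)))"
    using s by (intro sum_indep_normal[OF I 1 _ 2]) (auto simp: I_def)
  have "(\<Sum>k\<in>I. (\<bar>a $ k\<bar> * sqrt (t - s))\<^sup>2) = (\<Sum>k\<in>I. (a $ k)\<^sup>2) * (t - s)"
    using s by (simp add: power_mult_distrib sum_distrib_right)
  also have "(\<Sum>k\<in>I. (a $ k)\<^sup>2) = (\<Sum>k\<in>UNIV. (a $ k)\<^sup>2)"
    by (intro sum.mono_neutral_left) (auto simp: I_def)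
  also have "\<dots> = (norm a)\<^sup>2"
    by (simp add: norm_vec_def L2_set_def sum_nonneg)
  finally have eq1: "sqrt (\<Sum>k\<in>I. (\<bar>a $ k\<bar> * sqrt (t - s))\<^sup>2) = norm a * sqrt (t - s)"
    by (simp add: real_sqrt_mult)
  have eq2: "(\<Sum>k\<in>I. a $ k * (v $ k)) = a \<bullet> v" for v
    unfolding inner_vec_def by (intro sum.mono_neutral_cong_left) (auto simp: I_def)
  define s0 where "s0 = norm a * sqrt (t - s)"
  have s0: "0 < s0" using a s by (simp add: s0_def)
  have D: "distributed M lborel (\<lambda>\<omega>. a \<bullet> ?V \<omega>) (normal_density 0 s0)"
    using 3 unfolding eq1 eq2 s0_def by simp
  have nd_le: "normal_density 0 s0 x \<le> 1 / (2 * s0)" for x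
  proof -
    have "2 * s0 = sqrt (4 * s0\<^sup>2)" using s0 by (simp add: real_sqrt_mult)
    also have "\<dots> \<le> sqrt (2 * pi * s0\<^sup>2)" using pi_gt3 by (intro real_sqrt_le_mono mult_right_mono) auto
    finally have "1 / sqrt (2 * pi * s0\<^sup>2) \<le> 1 / (2 * s0)" using s0 by (intro divide_left_mono) auto
    moreover have "exp (- (x - 0)\<^sup>2 / (2 * s0\<^sup>2)) \<le> 1" by simp
    ultimately have "1 / sqrt (2 * pi * s0\<^sup>2) * exp (- (x - 0)\<^sup>2 / (2 * s0\<^sup>2)) \<le> 1 / (2 * s0) * 1"
      using s0 by (intro mult_mono) auto
    then show ?thesis by (simp add: normal_density_def)
  qed
  have "emeasure M ((\<lambda>\<omega>. a \<bullet> ?V \<omega>) -` {-\<kappa>..\<kappa>} \<inter> space M) = (\<integral>\<^sup>+x. ennreal (normal_density 0 s0 x) * indicator {-\<kappa>..\<kappa>} x \<partial>lborel)"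
    by (rule distributed_emeasure[OF D]) simp
  also have "\<dots> \<le> (\<integral>\<^sup>+x. ennreal (1 / (2 * s0)) * indicator {-\<kappa>..\<kappa>} x \<partial>lborel)"
    using nd_le by (intro nn_integral_mono mult_right_mono ennreal_leI) auto
  also have "\<dots> = ennreal (1 / (2 * s0)) * ennreal (2 * \<kappa>)"
    using \<kappa> by (subst nn_integral_cmult_indicator) auto
  also have "\<dots> = ennreal (\<kappa> / s0)"
    using s0 \<kappa> by (subst ennreal_mult[symmetric]) auto
  finally have "prob ((\<lambda>\<omega>. a \<bullet> ?V \<omega>) -` {-\<kappa>..\<kappa>} \<inter> space M) \<le> \<kappa> / s0"
    using s0 \<kappa> by (simp add: emeasure_eq_measure)
  moreover have "(\<lambda>\<omega>. a \<bullet> ?V \<omega>) -` {-\<kappa>..\<kappa>} \<inter> space M = {\<omega> \<in> space M. \<bar>a \<bullet> ?V \<omega>\<bar> \<le> \<kappa>}"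
    by (auto simp: abs_le_iff)
  ultimately show ?thesis by (simp add: s0_def)
qed

text \<open>A linear functional equal to 1 on each direction exists by independence. On the cone it
  adds up the coefficients, so along a solution it gives the total local time, which is monotone and
  dominates the push.\<close>

lemma push_functional:
  obtains lf :: "real^'n \<Rightarrow> real" and C where "linear lf" "0 < C"
    "\<And>A v. v \<in> convex_cone hull (d ` A) \<Longrightarrow> norm v \<le> C * lf v"
proof -
  obtain lf :: "real^'n \<Rightarrow> real" where lf: "linear lf" "\<And>i. lf (d i) = 1"
    using linear_independent_extend[of "range d" "\<lambda>_. 1 :: real"] d_indep by (auto simp: lin_indep_family_def)
  define C where "C = (\<Sum>i\<in>UNIV. norm (d i)) + 1"
  have C: "0 < C" by (simp add: C_def sum_nonneg add_nonneg_pos)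
  have "norm v \<le> C * lf v" if v: "v \<in> convex_cone hull (d ` A)" for A v
  proof -
    have "convex_cone hull (d ` A) \<subseteq> {v. norm v \<le> C * lf v}"
    proof (rule hull_minimal)
      show "d ` A \<subseteq> {v. norm v \<le> C * lf v}"
      proof clarify
        fix i
        have "norm (d i) \<le> (\<Sum>i\<in>UNIV. norm (d i))" by (intro member_le_sum) auto
        then show "norm (d i) \<le> C * lf (d i)" by (simp add: C_def lf)
      qed
      show "convex_cone {v. norm v \<le> C * lf v}"
        unfolding convex_cone_iff
      proof (intro conjI ballI allI impI)
        fix x y assume "x \<in> {v. norm v \<le> C * lf v}" "y \<in> {v. norm v \<le> C * lf v}"
        then show "x + y \<in> {v. norm v \<le> C * lf v}"
          using norm_triangle_ineq[of x y] by (simp add: linear_add[OF lf(1)] distrib_left)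
      next
        fix x and c :: real assume "x \<in> {v. norm v \<le> C * lf v}" "0 \<le> c"
        then show "c *\<^sub>R x \<in> {v. norm v \<le> C * lf v}"
          using mult_left_mono[of "norm x" "C * lf x" c] by (simp add: linear_scale[OF lf(1)] mult_ac)
      qed (simp add: linear_0[OF lf(1)])
    qed
    then show ?thesis using v by auto
  qed
  with lf(1) C show thesis using that by blast
qed

text \<open>Pairing the minimum with each other element already suffices.\<close>

lemma card_le_pairs:
  assumes "finite (S :: nat set)"
  shows "card S \<le> Suc (card {(l, m). l \<in> S \<and> m \<in> S \<and> l < m})"
proof (cases "S = {}")
  case False
  let ?P = "{(l, m). l \<in> S \<and> m \<in> S \<and> l < m}"
  have "?P \<subseteq> S \<times> S" by auto
  then have fin: "finite ?P" using assms finite_subset by blast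
  have "(\<lambda>m. (Min S, m)) ` (S - {Min S}) \<subseteq> ?P"
    using assms Min_in[OF assms False] by (auto simp: order.strict_iff_order)
  then have "card ((\<lambda>m. (Min S, m)) ` (S - {Min S})) \<le> card ?P"
    using fin by (intro card_mono)
  moreover have "card ((\<lambda>m. (Min S, m)) ` (S - {Min S})) = card S - 1"
    using assms False by (subst card_image) (auto simp: inj_on_def)
  ultimately show ?thesis by simp
qed simp

lemma tail_small:
  assumes [measurable]: "X \<in> borel_measurable M" and \<epsilon>: "0 < \<epsilon>"
  obtains v :: real where "0 \<le> v" "prob {\<omega> \<in> space M. v < X \<omega>} < \<epsilon>"
proof -
  define A where "A m = {\<omega> \<in> space M. real m < X \<omega>}" for m
  have "(\<lambda>m. prob (A m)) \<longlonglongrightarrow> prob (\<Inter>m. A m)"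
    by (rule finite_Lim_measure_decseq) (auto simp: A_def decseq_def)
  moreover have "(\<Inter>m. A m) = {}"
  proof -
    have "\<omega> \<notin> (\<Inter>m. A m)" for \<omega>
    proof -
      obtain m :: nat where "X \<omega> < real m" using reals_Archimedean2 by blast
      then have "\<omega> \<notin> A m" by (simp add: A_def)
      then show ?thesis by blast
    qed
    then show ?thesis by blast
  qed
  ultimately have "eventually (\<lambda>m. prob (A m) < \<epsilon>) sequentially"
    using \<epsilon> by (intro order_tendstoD(2)) auto
  then obtain m where "prob (A m) < \<epsilon>" by (auto simp: eventually_sequentially)
  then show thesis using that[of "real m"] by (simp add: A_def)
qed

text \<open>A pigeonhole argument in expectation: the number of times spent on a face is at most one
  plus the number of pairs of such times. If \<open>N\<close> times are each on the boundary with
  probability \<epsilon> and \<open>N * \<epsilon>\<close> exceeds the number of faces, some pair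
  must share a face.\<close>

lemma sum_prob_pairs:
  fixes A :: "nat \<Rightarrow> 'n \<Rightarrow> 'w set"
  assumes A: "\<And>l i. A l i \<in> events" and p: "\<And>l. l < N \<Longrightarrow> \<epsilon> \<le> prob (\<Union>i. A l i)"
  shows "real N * \<epsilon> \<le> real CARD('n) + (\<Sum>i\<in>UNIV. \<Sum>(l, m)\<in>{(l, m). l < m \<and> m < N}. prob (A l i \<inter> A m i))"
proof -
  let ?PS = "{(l, m). l < m \<and> m < N}"
  have "?PS \<subseteq> {..<N} \<times> {..<N}" by auto
  then have fin: "finite ?PS" using finite_subset by blast
  have AU: "(\<Union>i. A l i) \<in> events" for l using A by auto
  have ii: "integrable M (\<lambda>\<omega>. indicator E \<omega> :: real)" if "E \<in> events" for E
    using that by (intro abs_expectation_le(1)[where c = 1]) (auto simp: indicator_def)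
  have path: "(\<Sum>l<N. indicator (\<Union>i. A l i) \<omega>) \<le> real CARD('n) + (\<Sum>i\<in>UNIV. \<Sum>p\<in>?PS. indicator (A (fst p) i \<inter> A (snd p) i) \<omega>)" for \<omega>
  proof -
    have "(\<Sum>l<N. indicator (\<Union>i. A l i) \<omega>) \<le> (\<Sum>l<N. \<Sum>i\<in>UNIV. indicator (A l i) \<omega> :: real)"
    proof (rule sum_mono)
      fix l
      show "indicator (\<Union>i. A l i) \<omega> \<le> (\<Sum>i\<in>UNIV. indicator (A l i) \<omega> :: real)"
      proof (cases "\<omega> \<in> (\<Union>i. A l i)")
        case True
        then obtain i where "\<omega> \<in> A l i" by auto
        then have "(1::real) \<le> (\<Sum>i\<in>UNIV. indicator (A l i) \<omega>)"
          using member_le_sum[of i UNIV "\<lambda>i. indicator (A l i) \<omega> :: real"] by simp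
        then show ?thesis using True by simp
      qed (simp add: sum_nonneg)
    qed
    also have "\<dots> = (\<Sum>i\<in>UNIV. \<Sum>l<N. indicator (A l i) \<omega>)" by (rule sum.swap)
    also have "\<dots> \<le> (\<Sum>i\<in>UNIV. 1 + (\<Sum>p\<in>?PS. indicator (A (fst p) i \<inter> A (snd p) i) \<omega>))"
    proof (rule sum_mono)
      fix i
      define S where "S = {l. l < N \<and> \<omega> \<in> A l i}"
      have "(\<Sum>l<N. indicator (A l i) \<omega> :: real) = real (card S)"
      proof -
        have "(\<Sum>l<N. indicator (A l i) \<omega> :: real) = (\<Sum>l\<in>S. 1)"
          by (rule sum.mono_neutral_cong_right) (auto simp: S_def indicator_def)
        then show ?thesis by simp
      qed
      moreover have "(\<Sum>p\<in>?PS. indicator (A (fst p) i \<inter> A (snd p) i) \<omega> :: real) = real (card {(l, m). l \<in> S \<and> m \<in> S \<and> l < m})"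
      proof -
        have "(\<Sum>p\<in>?PS. indicator (A (fst p) i \<inter> A (snd p) i) \<omega> :: real) = (\<Sum>p\<in>{(l, m). l \<in> S \<and> m \<in> S \<and> l < m}. 1)"
          by (rule sum.mono_neutral_cong_right[OF fin]) (auto simp: S_def indicator_def)
        then show ?thesis by simp
      qed
      moreover have "finite S" by (simp add: S_def)
      ultimately show "(\<Sum>l<N. indicator (A l i) \<omega>) \<le> 1 + (\<Sum>p\<in>?PS. indicator (A (fst p) i \<inter> A (snd p) i) \<omega> :: real)"
        using card_le_pairs[of S] by linarith
    qed
    finally show ?thesis by (simp add: sum.distrib)
  qed
  have "real N * \<epsilon> = (\<Sum>l<N. \<epsilon>)" by simp
  also have "\<dots> \<le> (\<Sum>l<N. prob (\<Union>i. A l i))" using p by (intro sum_mono) auto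
  also have "\<dots> = (\<integral>\<omega>. (\<Sum>l<N. indicator (\<Union>i. A l i) \<omega>) \<partial>M)"
    using AU by (subst Bochner_Integration.integral_sum) (auto intro!: ii simp: sets.Int_space_eq1 sets.Int_space_eq2)
  also have "\<dots> \<le> (\<integral>\<omega>. real CARD('n) + (\<Sum>i\<in>UNIV. \<Sum>p\<in>?PS. indicator (A (fst p) i \<inter> A (snd p) i) \<omega>) \<partial>M)"
    using A AU path by (intro integral_mono Bochner_Integration.integrable_add Bochner_Integration.integrable_sum ii) auto
  also have "\<dots> = real CARD('n) + (\<Sum>i\<in>UNIV. \<Sum>p\<in>?PS. prob (A (fst p) i \<inter> A (snd p) i))"
    using A by (subst Bochner_Integration.integral_add)
      (auto intro!: Bochner_Integration.integrable_sum ii simp: Bochner_Integration.integral_sum ii sets.Int_space_eq1 sets.Int_space_eq2 prob_space)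
  finally show ?thesis by (simp add: case_prod_beta')
qed

text \<open>Otherwise, among \<open>N\<close> times in a short block two lie with positive probability on the same face. Then
  either the pushing over the block is large, which happens for few blocks since the pushing is monotone,
  or the Brownian increment normal to the face is \<open>O(h)\<close> over a time gap of at least \<open>h\<close>, which has
  probability \<open>O(sqrt h)\<close>.\<close>

lemma boundary_prob_small:
  assumes J: "joint_solution Z D" and T: "0 < T" and \<epsilon>: "0 < \<epsilon>"
  obtains s where "0 < s" "s < T" "prob {\<omega> \<in> space M. \<exists>i. Z s \<omega> \<bullet> n i = 0} < \<epsilon>"
proof -
  have "\<exists>s. 0 < s \<and> s < T \<and> prob {\<omega> \<in> space M. \<exists>i. Z s \<omega> \<bullet> n i = 0} < \<epsilon>"
  proof (rule ccontr)
    assume "\<nexists>s. 0 < s \<and> s < T \<and> prob {\<omega> \<in> space M. \<exists>i. Z s \<omega> \<bullet> n i = 0} < \<epsilon>"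
    then have big: "\<epsilon> \<le> prob {\<omega> \<in> space M. \<exists>i. Z s \<omega> \<bullet> n i = 0}" if "0 < s" "s < T" for s
      using that not_le by blast
    have ZM[measurable]: "Z s \<in> borel_measurable M" if "0 \<le> s" for s
      using J that F_measurable_M[OF that] by (auto simp: joint_solution_def adapted_def)
    define A where "A s i = {\<omega> \<in> space M. Z s \<omega> \<bullet> n i = 0}" for s i
    have A: "A s i \<in> events" if "0 \<le> s" for s i
      unfolding A_def using that by measurable
    \<comment> \<open>Large enough that the pairs in one block contribute at least 1 in
      \<open>sum_prob_pairs\<close>.\<close>
    obtain N :: nat where N: "real CARD('n) + 1 < real N * \<epsilon>"
    proof -
      obtain N :: nat where "(real CARD('n) + 1) / \<epsilon> < real N" using reals_Archimedean2 by blast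
      then show thesis using that[of N] \<epsilon> by (simp add: pos_divide_less_eq)
    qed
    have N0: "0 < N" using N by (cases N) auto
    let ?PS = "{(l, m). l < m \<and> m < N}"
    have "?PS \<subseteq> {..<N} \<times> {..<N}" by auto
    then have finPS: "finite ?PS" using finite_subset by blast
    define c2 where "c2 = real (CARD('n) * card ?PS) + 1"
    have c2: "1 \<le> c2" by (simp add: c2_def)
    obtain lf :: "real^'n \<Rightarrow> real" and C where lf: "linear lf" "0 < C"
      "\<And>A v. v \<in> convex_cone hull (d ` A) \<Longrightarrow> norm v \<le> C * lf v"
      using push_functional by blast
    have [measurable]: "lf \<in> borel_measurable borel"
      using lf(1) by (intro borel_measurable_continuous_onI linear_continuous_on) (simp add: linear_linear)
    \<comment> \<open>Its increments are the total push, but it is written with \<open>Z\<close> and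
      \<open>W\<close>, which are measurable, in place of \<open>Y\<close>.\<close>
    define V where "V t \<omega> = lf (Z t \<omega> - t *\<^sub>R b0 - \<sigma> *v W t \<omega>)" for t \<omega>
    have VM[measurable]: "V t \<in> borel_measurable M" if "0 \<le> t" for t
    proof -
      note [measurable] = ZM[OF that] W_M[OF that]
      show ?thesis unfolding V_def by measurable
    qed
    obtain Y where Y: "AE \<omega> in M. path_sol (\<lambda>t. W t \<omega>) (\<lambda>t. Z t \<omega>) (\<lambda>t. Y t \<omega>) (\<lambda>t. D t \<omega>)"
      using J by (auto simp: joint_solution_def)
    have Vinc: "norm (Y t \<omega> - Y s \<omega>) \<le> C * (V t \<omega> - V s \<omega>)" "V s \<omega> \<le> V t \<omega>"
      if p: "path_sol (\<lambda>t. W t \<omega>) (\<lambda>t. Z t \<omega>) (\<lambda>t. Y t \<omega>) (\<lambda>t. D t \<omega>)" and s: "0 \<le> s" "s < t" for s t \<omega>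
    proof -
      have "Y t \<omega> - Y s \<omega> = (Z t \<omega> - t *\<^sub>R b0 - \<sigma> *v W t \<omega>) - (Z s \<omega> - s *\<^sub>R b0 - \<sigma> *v W s \<omega>)"
        using path_solD(3)[OF p s(1), of t] s by (simp add: algebra_simps matrix_vector_mult_diff_distrib)
      then have "lf (Y t \<omega> - Y s \<omega>) = V t \<omega> - V s \<omega>" unfolding V_def by (simp only: linear_diff[OF lf(1)])
      then show 1: "norm (Y t \<omega> - Y s \<omega>) \<le> C * (V t \<omega> - V s \<omega>)"
        using lf(3)[OF skorokhod_solD(3)[OF path_solD(2)[OF p s(1)], of s t t]] s by simp
      have "0 \<le> C * (V t \<omega> - V s \<omega>)" using 1 norm_ge_zero order_trans by blast
      then show "V s \<omega> \<le> V t \<omega>" using lf(2) by (simp add: zero_le_mult_iff)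
    qed
    define VT where "VT \<omega> = V T \<omega> - V 0 \<omega>" for \<omega>
    have [measurable]: "VT \<in> borel_measurable M" unfolding VT_def using T by (intro borel_measurable_diff VM) auto
    obtain v where v: "0 \<le> v" "prob {\<omega> \<in> space M. v < VT \<omega>} < 1 / (4 * c2)"
      using tail_small[of VT "1 / (4 * c2)"] c2 by auto
    define A0 where "A0 = (\<Sum>i\<in>UNIV. 1 / norm (face_dir i))"
    have A0: "1 / norm (face_dir i) \<le> A0" "0 \<le> A0" for i
      unfolding A0_def by (auto intro!: member_le_sum sum_nonneg)
    \<comment> \<open>The number of blocks with a large push and the number of all blocks both grow
      like \<open>1 / h\<close>, so the first term of \<open>K\<close> has to beat their ratio
      beforehand; the second term absorbs the drift. Only then is \<open>h\<close> made
      small.\<close>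
    define K where "K = 16 * c2 * C * v * real N / T + 2 * norm b0 * real N + 1"
    have K: "1 \<le> K" "2 * norm b0 * real N \<le> K" "16 * c2 * C * v * real N / T \<le> K"
      using c2 lf(2) v(1) T by (auto simp: K_def)
    define \<delta> where "\<delta> = (1 / (4 * c2 * (K * A0 + 1)))\<^sup>2"
    have KA: "0 \<le> K * A0" using K(1) A0(2) by simp
    have \<delta>: "0 < \<delta>" using c2 KA by (simp add: \<delta>_def)
    obtain M0 where M0: "0 < M0" "T / real M0 < \<delta>" using fine_grid[OF \<delta>] by blast
    \<comment> \<open>There are \<open>M0\<close> blocks of \<open>N\<close> times with gap
      \<open>h\<close>; the added 1 in the denominator keeps the last of them below
      \<open>T\<close>.\<close>
    define h where "h = T / (real (M0 * N) + 1)"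
    have h: "0 < h" using T by (simp add: h_def add_nonneg_pos)
    have hT: "real (M0 * N) * h < T" using T by (simp add: h_def field_simps add_pos_nonneg)
    have h\<delta>: "h < \<delta>"
    proof -
      have "real M0 \<le> real (M0 * N) + 1" using N0 by (cases N) auto
      then have "h \<le> T / real M0" unfolding h_def using T M0(1) by (intro divide_left_mono) (auto simp: add_pos_nonneg)
      then show ?thesis using M0(2) by simp
    qed
    have hM: "1 / h \<le> 2 * real M0 * real N / T"
    proof -
      have "1 \<le> real M0 * real N" using M0(1) N0 by (metis mult_pos_pos of_nat_1 of_nat_le_iff of_nat_mult Suc_leI One_nat_def)
      then show ?thesis unfolding h_def using T by (simp add: divide_right_mono)
    qed
    have small1: "K * A0 * sqrt h \<le> 1 / (4 * c2)"
    proof -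
      have "sqrt h \<le> sqrt \<delta>" using h\<delta> by simp
      also have "\<dots> = 1 / (4 * c2 * (K * A0 + 1))" using c2 KA by (simp add: \<delta>_def)
      finally have "(K * A0) * sqrt h \<le> (K * A0) * (1 / (4 * c2 * (K * A0 + 1)))" using KA by (rule mult_left_mono)
      also have "\<dots> \<le> (K * A0 + 1) * (1 / (4 * c2 * (K * A0 + 1)))" using c2 KA by (intro mult_right_mono) auto
      also have "\<dots> = 1 / (4 * c2)" using KA by simp
      finally show ?thesis .
    qed
    \<comment> \<open>A total push of at most \<open>q\<close> gives a push vector of norm at most
      \<open>C * q\<close>, which is half of \<open>K * h\<close>; the drift takes the other
      half.\<close>
    define q where "q = K * h / (2 * C)"
    have q: "0 < q" using K(1) h lf(2) by (simp add: q_def)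
    \<comment> \<open>The \<open>l\<close>-th time of block \<open>j\<close>; the added 1 puts it
      strictly after the start of the block, so that time 0 is avoided.\<close>
    define u where "u j l = h * (real j * real N + real l + 1)" for j l :: nat
    define b where "b j = h * (real j * real N)" for j :: nat
    define \<phi> where "\<phi> j = {\<omega> \<in> space M. q < V (b (Suc j)) \<omega> - V (b j) \<omega>}" for j
    have b0': "0 \<le> b j" for j using h by (simp add: b_def)
    have \<phi>M: "\<phi> j \<in> events" for j unfolding \<phi>_def using b0' by measurable
    have ub: "b j < u j l" "u j l \<le> b (Suc j)" "0 < u j l" if "l < N" for j l
    proof -
      show 1: "b j < u j l" using h by (simp add: b_def u_def)
      then show "0 < u j l" using b0'[of j] by linarith
      have "real l + 1 \<le> real N" using that by simp
      then show "u j l \<le> b (Suc j)" using h unfolding b_def u_def by (intro mult_left_mono) (auto simp: distrib_right)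
    qed
    have bT: "b j < T" if "j \<le> M0" for j
    proof -
      have "b j \<le> h * (real M0 * real N)" unfolding b_def using h that by (intro mult_left_mono mult_right_mono) auto
      then show ?thesis using hT by (simp add: mult_ac)
    qed
    \<comment> \<open>At both times the normal component of \<open>Z\<close> is 0, so noise, drift
      and push cancel in it. Unless the push of the block is large, the noise is at most
      \<open>K * h\<close> over a gap of at least \<open>h\<close>.\<close>
    have pair: "prob (A (u j l) i \<inter> A (u j m) i) \<le> K * A0 * sqrt h + prob (\<phi> j)" if lm: "l < m" "m < N" for i j l m
    proof -
      let ?s = "u j l" and ?t = "u j m"
      have st: "?t - ?s = h * (real m - real l)" by (simp add: u_def algebra_simps)
      have lm': "1 \<le> real m - real l" "real m - real l \<le> real N" using lm by auto
      have gap: "h \<le> ?t - ?s" "?t - ?s \<le> h * real N"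
        unfolding st using h mult_left_mono[OF lm'(1), of h] mult_left_mono[OF lm'(2), of h] by auto
      have s0: "0 \<le> ?s" "?s < ?t" "0 \<le> ?t" using ub(3)[of l j] lm gap h by auto
      note [measurable] = W_M[OF s0(1)] W_M[OF s0(3)]
      define E where "E = {\<omega> \<in> space M. \<bar>face_dir i \<bullet> (W ?t \<omega> - W ?s \<omega>)\<bar> \<le> K * h}"
      have EM: "E \<in> events" unfolding E_def by measurable
      have "AE \<omega> in M. \<omega> \<in> A ?s i \<inter> A ?t i \<longrightarrow> \<omega> \<in> E \<union> \<phi> j"
        using Y
      proof eventually_elim
        case (elim \<omega>)
        show ?case
        proof
          assume \<omega>: "\<omega> \<in> A ?s i \<inter> A ?t i"
          show "\<omega> \<in> E \<union> \<phi> j"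
          proof (cases "\<omega> \<in> \<phi> j")
            case False
            then have small: "V (b (Suc j)) \<omega> - V (b j) \<omega> \<le> q" using \<omega> by (auto simp: \<phi>_def A_def)
            have "V (b j) \<omega> \<le> V ?s \<omega>" using ub(1)[of l j] lm by (intro Vinc(2)[OF elim b0']) auto
            moreover have "V ?t \<omega> \<le> V (b (Suc j)) \<omega>"
              using ub(2)[of m j] lm Vinc(2)[OF elim s0(3), of "b (Suc j)"] by (cases "?t = b (Suc j)") auto
            ultimately have "V ?t \<omega> - V ?s \<omega> \<le> q" using small by linarith
            then have "C * (V ?t \<omega> - V ?s \<omega>) \<le> C * q" using lf(2) by simp
            also have "\<dots> = K * h / 2" using lf(2) by (simp add: q_def)
            finally have Yb: "norm (Y ?t \<omega> - Y ?s \<omega>) \<le> K * h / 2" using Vinc(1)[OF elim s0(1,2)] by linarith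
            have "n i \<bullet> ((Z ?t \<omega> - Y ?t \<omega>) - (Z ?s \<omega> - Y ?s \<omega>)) = (?t - ?s) * (n i \<bullet> b0) + face_dir i \<bullet> (W ?t \<omega> - W ?s \<omega>)"
              unfolding path_solD(3)[OF elim s0(1,3)] by (simp add: inner_add_right face_dir(1))
            moreover have "n i \<bullet> Z ?t \<omega> = 0" "n i \<bullet> Z ?s \<omega> = 0" using \<omega> by (auto simp: A_def inner_commute)
            ultimately have eq: "face_dir i \<bullet> (W ?t \<omega> - W ?s \<omega>) = - (n i \<bullet> (Y ?t \<omega> - Y ?s \<omega>)) - (?t - ?s) * (n i \<bullet> b0)"
              by (simp add: inner_diff_right)
            have "\<bar>n i \<bullet> (Y ?t \<omega> - Y ?s \<omega>)\<bar> \<le> K * h / 2"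
              using Cauchy_Schwarz_ineq2[of "n i" "Y ?t \<omega> - Y ?s \<omega>"] n_unit[of i] Yb by simp
            moreover have "\<bar>(?t - ?s) * (n i \<bullet> b0)\<bar> \<le> K * h / 2"
            proof -
              have "\<bar>n i \<bullet> b0\<bar> \<le> norm b0" using Cauchy_Schwarz_ineq2[of "n i" b0] n_unit[of i] by simp
              then have "\<bar>(?t - ?s) * (n i \<bullet> b0)\<bar> \<le> (h * real N) * norm b0"
                unfolding abs_mult using gap h by (intro mult_mono) auto
              also have "\<dots> \<le> K * h / 2" using mult_right_mono[OF K(2), of h] h by (simp add: mult_ac)
              finally show ?thesis .
            qed
            ultimately have "\<bar>face_dir i \<bullet> (W ?t \<omega> - W ?s \<omega>)\<bar> \<le> K * h" unfolding eq by linarith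
            then show ?thesis using \<omega> by (auto simp: E_def A_def)
          qed simp
        qed
      qed
      then have "prob (A ?s i \<inter> A ?t i) \<le> prob (E \<union> \<phi> j)"
        using EM \<phi>M by (intro finite_measure_mono_AE) auto
      also have "\<dots> \<le> prob E + prob (\<phi> j)" using EM \<phi>M by (intro measure_Un_le)
      also have "prob E \<le> K * A0 * sqrt h"
      proof -
        have "prob E \<le> K * h / (norm (face_dir i) * sqrt (?t - ?s))"
          unfolding E_def using K(1) h by (intro increment_anticoncentration s0 face_dir) auto
        also have "\<dots> \<le> K * h / (norm (face_dir i) * sqrt h)"
          using K(1) h gap face_dir(2)[of i] by (intro divide_left_mono mult_left_mono) auto
        also have "\<dots> = K * (1 / norm (face_dir i)) * (h / sqrt h)" by simp
        also have "h / sqrt h = sqrt h" using h by (simp add: real_div_sqrt)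
        also have "K * (1 / norm (face_dir i)) * sqrt h \<le> K * A0 * sqrt h"
          using K(1) A0(1)[of i] h by (intro mult_right_mono mult_left_mono) auto
        finally show ?thesis .
      qed
      finally show ?thesis by simp
    qed
    have block: "1 \<le> c2 * (K * A0 * sqrt h + prob (\<phi> j))" if j: "j < M0" for j
    proof -
      have pos: "0 \<le> K * A0 * sqrt h + prob (\<phi> j)" using KA h by simp
      have "real N * \<epsilon> \<le> real CARD('n) + (\<Sum>i\<in>UNIV. \<Sum>(l, m)\<in>?PS. prob (A (u j l) i \<inter> A (u j m) i))"
      proof (rule sum_prob_pairs)
        show "A (u j l) i \<in> events" for l i using h by (intro A) (simp add: u_def)
        fix l assume l: "l < N"
        have "(\<Union>i. A (u j l) i) = {\<omega> \<in> space M. \<exists>i. Z (u j l) \<omega> \<bullet> n i = 0}" by (auto simp: A_def)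
        then show "\<epsilon> \<le> prob (\<Union>i. A (u j l) i)"
          using big[of "u j l"] ub[OF l, of j] bT[of "Suc j"] j by auto
      qed
      also have "(\<Sum>i\<in>UNIV. \<Sum>(l, m)\<in>?PS. prob (A (u j l) i \<inter> A (u j m) i)) \<le> (\<Sum>i\<in>(UNIV :: 'n set). \<Sum>p\<in>?PS. K * A0 * sqrt h + prob (\<phi> j))"
        using pair by (intro sum_mono) auto
      also have "\<dots> = real (CARD('n) * card ?PS) * (K * A0 * sqrt h + prob (\<phi> j))" by simp
      also have "\<dots> \<le> c2 * (K * A0 * sqrt h + prob (\<phi> j))"
        using pos unfolding c2_def by (intro mult_right_mono) auto
      finally show ?thesis using N by linarith
    qed
    \<comment> \<open>The pushes over disjoint blocks add up to at most the push until
      \<open>T\<close>. When this is at most \<open>v\<close>, no more than \<open>v / q\<close>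
      blocks can exceed \<open>q\<close>.\<close>
    have sum\<phi>: "(\<Sum>j<M0. prob (\<phi> j)) \<le> real M0 * prob {\<omega> \<in> space M. v < VT \<omega>} + v / q"
    proof -
      let ?B = "{\<omega> \<in> space M. v < VT \<omega>}"
      have ii: "integrable M (\<lambda>\<omega>. indicator E \<omega> :: real)" if "E \<in> events" for E
        using that by (intro abs_expectation_le(1)[where c = 1]) (auto simp: indicator_def)
      have BM: "?B \<in> events" by measurable
      have "AE \<omega> in M. (\<Sum>j<M0. indicator (\<phi> j) \<omega>) \<le> real M0 * indicator ?B \<omega> + v / q"
        using Y AE_space
      proof eventually_elim
        case (elim \<omega>)
        have bb: "b j < b (Suc j)" for j using h N0 by (simp add: b_def)
        show ?case
        proof (cases "\<omega> \<in> ?B")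
          case True
          have "(\<Sum>j<M0. indicator (\<phi> j) \<omega> :: real) \<le> (\<Sum>j<M0. 1)" by (intro sum_mono) (auto simp: indicator_def)
          moreover have "0 \<le> v / q" using v q by simp
          ultimately show ?thesis using True by simp
        next
          case False
          have "q * (\<Sum>j<M0. indicator (\<phi> j) \<omega>) = (\<Sum>j<M0. q * indicator (\<phi> j) \<omega>)" by (rule sum_distrib_left)
          also have "\<dots> \<le> (\<Sum>j<M0. V (b (Suc j)) \<omega> - V (b j) \<omega>)"
            using Vinc(2)[OF elim(1) b0' bb] by (intro sum_mono) (auto simp: \<phi>_def indicator_def)
          also have "\<dots> = V (b M0) \<omega> - V (b 0) \<omega>" by (rule sum_lessThan_telescope)
          also have "\<dots> \<le> VT \<omega>"
            using Vinc(2)[OF elim(1) b0'[of M0] bT[of M0]] by (simp add: VT_def b_def)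
          also have "\<dots> \<le> v" using False elim(2) by auto
          finally have "(\<Sum>j<M0. indicator (\<phi> j) \<omega>) \<le> v / q" using q by (simp add: pos_le_divide_eq mult.commute)
          then show ?thesis using False by simp
        qed
      qed
      then have "(\<integral>\<omega>. (\<Sum>j<M0. indicator (\<phi> j) \<omega>) \<partial>M) \<le> (\<integral>\<omega>. real M0 * indicator ?B \<omega> + v / q \<partial>M)"
        using \<phi>M BM by (intro integral_mono_AE Bochner_Integration.integrable_add Bochner_Integration.integrable_sum integrable_mult_right ii) auto
      moreover have "(\<integral>\<omega>. (\<Sum>j<M0. indicator (\<phi> j) \<omega>) \<partial>M) = (\<Sum>j<M0. prob (\<phi> j))"
        using \<phi>M by (subst Bochner_Integration.integral_sum) (auto intro!: ii simp: sets.Int_space_eq1 sets.Int_space_eq2)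
      moreover have "(\<integral>\<omega>. real M0 * indicator ?B \<omega> + v / q \<partial>M) = real M0 * prob ?B + v / q"
        using BM by (subst Bochner_Integration.integral_add) (auto intro!: integrable_mult_right ii simp: sets.Int_space_eq1 sets.Int_space_eq2 prob_space)
      ultimately show ?thesis by simp
    qed
    have vq: "v / q \<le> real M0 * (1 / (4 * c2))"
    proof -
      have "v / q = (2 * C * v / K) * (1 / h)" using K(1) h by (simp add: q_def)
      also have "\<dots> \<le> (2 * C * v / K) * (2 * real M0 * real N / T)"
        using hM lf(2) v(1) K(1) by (intro mult_left_mono) auto
      also have "\<dots> = real M0 * ((16 * c2 * C * v * real N / T) / K) * (1 / (4 * c2))" using c2 by simp
      also have "\<dots> \<le> real M0 * 1 * (1 / (4 * c2))"
      proof (intro mult_right_mono mult_left_mono)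
        show "(16 * c2 * C * v * real N / T) / K \<le> 1"
          using K(1) by (intro divide_le_eq_1_pos[THEN iffD2] K(3)) linarith
      qed (use c2 in auto)
      finally show ?thesis by simp
    qed
    \<comment> \<open>Summing \<open>block\<close> over all blocks: the noise, the event that the
      push until \<open>T\<close> exceeds \<open>v\<close>, and the blocks with a large push each
      account for at most a quarter of \<open>M0\<close>.\<close>
    have "real M0 = (\<Sum>j<M0. 1)" by simp
    also have "\<dots> \<le> (\<Sum>j<M0. c2 * (K * A0 * sqrt h + prob (\<phi> j)))" using block by (intro sum_mono) auto
    also have "\<dots> = c2 * (real M0 * (K * A0 * sqrt h) + (\<Sum>j<M0. prob (\<phi> j)))"
      by (simp add: sum_distrib_left[symmetric] sum.distrib)
    also have "\<dots> \<le> c2 * (real M0 * (1 / (4 * c2)) + (real M0 * (1 / (4 * c2)) + real M0 * (1 / (4 * c2))))"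
    proof (rule mult_left_mono, rule add_mono)
      show "(\<Sum>j<M0. prob (\<phi> j)) \<le> real M0 * (1 / (4 * c2)) + real M0 * (1 / (4 * c2))"
        using sum\<phi> vq mult_left_mono[OF less_imp_le[OF v(2)], of "real M0"] by linarith
      show "real M0 * (K * A0 * sqrt h) \<le> real M0 * (1 / (4 * c2))" using small1 by (intro mult_left_mono) auto
    qed (use c2 in auto)
    also have "\<dots> = real M0 * (3 / 4)" using c2 by (simp add: field_simps)
    finally show False using M0(1) by simp
  qed
  then show thesis using that by blast
qed

end

section \<open>The Feller property\<close>

text \<open>Pointwise convergence of probability densities implies convergence in the mean, by
  Scheffe's lemma.\<close>

lemma normal_shift_L1:
  assumes s: "0 < s" and a: "a \<longlonglongrightarrow> (0::real)"
  shows "(\<lambda>k. \<integral>y. \<bar>normal_density (a k) s y - normal_density 0 s y\<bar> \<partial>lborel) \<longlonglongrightarrow> 0"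
proof -
  have nn: "(\<integral>\<^sup>+y. norm (normal_density m s y) \<partial>lborel) = 1" for m
    using nn_integral_eq_integral[OF integrable_normal_density[OF s, of m]] s by simp
  have "(\<lambda>k. \<integral>\<^sup>+y. norm (normal_density (a k) s y - normal_density 0 s y) \<partial>lborel) \<longlonglongrightarrow> 0"
  proof (rule Scheffe_lemma2)
    show "AE y in lborel. (\<lambda>k. normal_density (a k) s y) \<longlonglongrightarrow> normal_density 0 s y"
    proof (rule AE_I2)
      fix y
      have "(\<lambda>k. 1 / sqrt (2 * pi * s\<^sup>2) * exp (- (y - a k)\<^sup>2 / (2 * s\<^sup>2))) \<longlonglongrightarrow> 1 / sqrt (2 * pi * s\<^sup>2) * exp (- (y - 0)\<^sup>2 / (2 * s\<^sup>2))"
        using s by (intro tendsto_intros a) auto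
      then show "(\<lambda>k. normal_density (a k) s y) \<longlonglongrightarrow> normal_density 0 s y" by (simp add: normal_density_def)
    qed
  qed (use s nn in auto)
  moreover have "(\<integral>\<^sup>+y. norm (normal_density m s y - normal_density 0 s y) \<partial>lborel) =
      ennreal (\<integral>y. \<bar>normal_density m s y - normal_density 0 s y\<bar> \<partial>lborel)" for m
    unfolding real_norm_def
    using s by (intro nn_integral_eq_integral integrable_abs Bochner_Integration.integrable_diff integrable_normal_density) auto
  ultimately have "(\<lambda>k. ennreal (\<integral>y. \<bar>normal_density (a k) s y - normal_density 0 s y\<bar> \<partial>lborel)) \<longlonglongrightarrow> ennreal 0"
    by simp
  then show ?thesis by (subst (asm) tendsto_ennreal_iff) (auto intro!: integral_nonneg_AE)
qed

text \<open>A substitution moves the shift from the test function to the density; the bound is then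
  uniform over all measurable functions bounded by 1.\<close>

lemma normal_shift:
  assumes s: "0 < s" and \<epsilon>: "0 < \<epsilon>"
  obtains \<delta> where "0 < \<delta>" "\<And>a (g :: real \<Rightarrow> real). \<bar>a\<bar> < \<delta> \<Longrightarrow> g \<in> borel_measurable borel \<Longrightarrow> (\<And>x. \<bar>g x\<bar> \<le> 1) \<Longrightarrow>
    \<bar>(\<integral>y. g (y + a) \<partial>density lborel (normal_density 0 s)) - (\<integral>y. g y \<partial>density lborel (normal_density 0 s))\<bar> \<le> \<epsilon>"
proof -
  define \<kappa> where "\<kappa> a = (\<integral>y. \<bar>normal_density a s y - normal_density 0 s y\<bar> \<partial>lborel)" for a
  have "\<exists>\<delta>>0. \<forall>a. \<bar>a\<bar> < \<delta> \<longrightarrow> \<kappa> a \<le> \<epsilon>"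
  proof (rule ccontr)
    assume "\<not> ?thesis"
    then have "\<forall>k. \<exists>a. \<bar>a\<bar> < 1 / real (Suc k) \<and> \<epsilon> < \<kappa> a"
      by (metis not_le of_nat_0_less_iff zero_less_Suc zero_less_divide_1_iff)
    then obtain a where a: "\<And>k. \<bar>a k\<bar> < 1 / real (Suc k)" "\<And>k. \<epsilon> < \<kappa> (a k)" by metis
    have "a \<longlonglongrightarrow> 0"
    proof (rule Lim_null_comparison)
      show "\<forall>\<^sub>F k in sequentially. norm (a k) \<le> 1 / real (Suc k)" using a(1) by (simp add: less_imp_le)
      show "(\<lambda>k. 1 / real (Suc k)) \<longlonglongrightarrow> 0" using LIMSEQ_inverse_real_of_nat by (simp add: inverse_eq_divide)
    qed
    then have "(\<lambda>k. \<kappa> (a k)) \<longlonglongrightarrow> 0" unfolding \<kappa>_def by (rule normal_shift_L1[OF s])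
    then have "\<forall>\<^sub>F k in sequentially. \<kappa> (a k) < \<epsilon>" using \<epsilon> by (rule order_tendstoD)
    then obtain k where "\<kappa> (a k) < \<epsilon>" by (auto simp: eventually_sequentially)
    then show False using a(2)[of k] by simp
  qed
  then obtain \<delta> where \<delta>: "0 < \<delta>" "\<And>a. \<bar>a\<bar> < \<delta> \<Longrightarrow> \<kappa> a \<le> \<epsilon>" by blast
  show thesis
  proof (rule that[OF \<delta>(1)])
    fix a and g :: "real \<Rightarrow> real"
    assume a: "\<bar>a\<bar> < \<delta>" and g[measurable]: "g \<in> borel_measurable borel" and g1: "\<And>x. \<bar>g x\<bar> \<le> 1"
    have int: "integrable lborel (\<lambda>y. normal_density m s y * g y)" for m
    proof (rule Bochner_Integration.integrable_bound[OF integrable_normal_density[OF s, of m]])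
      show "AE y in lborel. norm (normal_density m s y * g y) \<le> norm (normal_density m s y)"
        using mult_left_mono[OF g1] by (intro AE_I2) (auto simp: abs_mult)
    qed measurable
    have "(\<integral>y. g (y + a) \<partial>density lborel (normal_density 0 s)) = (\<integral>y. normal_density 0 s y * g (y + a) \<partial>lborel)"
      by (subst integral_real_density) auto
    also have "\<dots> = (\<integral>y. normal_density a s y * g y \<partial>lborel)"
    proof -
      have "normal_density 0 s (- a + 1 * y) * g (- a + 1 * y + a) = normal_density a s y * g y" for y
        by (simp add: normal_density_def)
      from lborel_integral_real_affine[of 1 "\<lambda>y. normal_density 0 s y * g (y + a)" "- a", unfolded this]
      show ?thesis by simp
    qed
    moreover have "(\<integral>y. g y \<partial>density lborel (normal_density 0 s)) = (\<integral>y. normal_density 0 s y * g y \<partial>lborel)"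
      by (subst integral_real_density) auto
    ultimately have "\<bar>(\<integral>y. g (y + a) \<partial>density lborel (normal_density 0 s)) - (\<integral>y. g y \<partial>density lborel (normal_density 0 s))\<bar>
      = \<bar>\<integral>y. normal_density a s y * g y - normal_density 0 s y * g y \<partial>lborel\<bar>"
      by (simp add: Bochner_Integration.integral_diff[OF int int])
    also have "\<dots> \<le> \<kappa> a"
      unfolding \<kappa>_def
    proof (rule abs_integral_le_integral)
      show "AE y in lborel. \<bar>normal_density a s y * g y - normal_density 0 s y * g y\<bar> \<le> \<bar>normal_density a s y - normal_density 0 s y\<bar>"
        using mult_left_mono[OF g1] by (intro AE_I2) (auto simp: left_diff_distrib[symmetric] abs_mult)
    qed (use s in \<open>auto intro!: int\<close>)
    also have "\<dots> \<le> \<epsilon>" by (rule \<delta>(2)[OF a])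
    finally show "\<bar>(\<integral>y. g (y + a) \<partial>density lborel (normal_density 0 s)) - (\<integral>y. g y \<partial>density lborel (normal_density 0 s))\<bar> \<le> \<epsilon>" .
  qed
qed

text \<open>The coordinates are shifted one at a time. Integrating the newly shifted coordinate
  innermost reduces each step to the assumption on one dimension, because the partly shifted
  function is again measurable and bounded by 1.\<close>

lemma product_shift:
  fixes N :: "real measure" and f :: "('i \<Rightarrow> real) \<Rightarrow> real"
  assumes N: "prob_space N" "sets N = sets borel" and I: "finite I" and S: "finite S" "S \<subseteq> I"
    and shift: "\<And>i g. i \<in> I \<Longrightarrow> g \<in> borel_measurable borel \<Longrightarrow> (\<And>x. \<bar>g x\<bar> \<le> 1) \<Longrightarrow> \<bar>(\<integral>y. g (y + w i) \<partial>N) - (\<integral>y. g y \<partial>N)\<bar> \<le> \<epsilon>"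
    and f: "f \<in> borel_measurable (Pi\<^sub>M I (\<lambda>_. N))" "\<And>x. \<bar>f x\<bar> \<le> 1"
  shows "\<bar>(\<integral>x. f (\<lambda>i\<in>I. x i + (if i \<in> S then w i else 0)) \<partial>Pi\<^sub>M I (\<lambda>_. N)) - (\<integral>x. f x \<partial>Pi\<^sub>M I (\<lambda>_. N))\<bar> \<le> real (card S) * \<epsilon>"
  using S
proof (induction S rule: finite_induct)
  case empty
  have "(\<integral>x. f (\<lambda>i\<in>I. x i) \<partial>Pi\<^sub>M I (\<lambda>_. N)) = (\<integral>x. f x \<partial>Pi\<^sub>M I (\<lambda>_. N))"
    by (intro Bochner_Integration.integral_cong) (auto simp: space_PiM PiE_def extensional_restrict)
  then show ?case by (simp only: empty_iff if_False add_0_right) simp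
next
  case (insert i S)
  interpret N: prob_space N by (rule N(1))
  interpret P: product_sigma_finite "\<lambda>_ :: 'i. N" by standard
  note [measurable_cong] = N(2)
  let ?P = "Pi\<^sub>M I (\<lambda>_. N)" and ?R = "Pi\<^sub>M (I - {i}) (\<lambda>_. N)"
  interpret PP: prob_space ?P by (intro prob_space_PiM N(1))
  interpret RR: prob_space ?R by (intro prob_space_PiM N(1))
  have iI: "i \<in> I" and ins: "insert i (I - {i}) = I" using insert.prems by auto
  define sh where "sh S x = (\<lambda>j\<in>I. x j + (if j \<in> S then w j else 0))" for S and x :: "'i \<Rightarrow> real"
  have sh_m: "sh S \<in> measurable ?P ?P" for S
    unfolding sh_def by (rule measurable_restrict) measurable
  define f' where "f' x = f (sh S x)" for x
  have f'm: "f' \<in> borel_measurable ?P" unfolding f'_def by (rule measurable_compose[OF sh_m f(1)])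
  have f'1: "\<bar>f' x\<bar> \<le> 1" for x by (simp add: f'_def f(2))
  define F1 where "F1 x = f (sh (insert i S) x)" for x
  have F1m: "F1 \<in> borel_measurable ?P" unfolding F1_def by (rule measurable_compose[OF sh_m f(1)])
  have F11: "\<bar>F1 x\<bar> \<le> 1" for x by (simp add: F1_def f(2))
  have eq: "F1 (x(i := y)) = f' (x(i := y + w i))" for x y
    unfolding f'_def F1_def using insert.hyps(2) iI
    by (intro arg_cong[where f = f]) (auto simp: sh_def fun_eq_iff)
  have fub: "(\<integral>x. u x \<partial>?P) = (\<integral>x. (\<integral>y. u (x(i := y)) \<partial>N) \<partial>?R)"
    and fubm: "(\<lambda>x. \<integral>y. u (x(i := y)) \<partial>N) \<in> borel_measurable ?R"
    and inm: "x \<in> space ?R \<Longrightarrow> (\<lambda>y. u (x(i := y))) \<in> borel_measurable borel"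
    if u: "u \<in> borel_measurable ?P" "\<And>x. \<bar>u x\<bar> \<le> 1" for u :: "_ \<Rightarrow> real" and x
  proof -
    have u': "u \<in> borel_measurable (Pi\<^sub>M (insert i (I - {i})) (\<lambda>_. N))" using u(1) by (simp only: ins)
    have "integrable (Pi\<^sub>M (insert i (I - {i})) (\<lambda>_. N)) u"
      using PP.abs_expectation_le(1)[OF u] by (simp only: ins)
    then show "(\<integral>x. u x \<partial>?P) = (\<integral>x. (\<integral>y. u (x(i := y)) \<partial>N) \<partial>?R)"
      using P.product_integral_insert[of "I - {i}" i u] I by (simp only: ins finite_Diff) simp
    have "(\<lambda>(x, y). u (x(i := y))) \<in> borel_measurable (?R \<Otimes>\<^sub>M N)"
      using measurable_compose[OF measurable_add_dim u'] by (simp only: case_prod_beta')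
    then show "(\<lambda>x. \<integral>y. u (x(i := y)) \<partial>N) \<in> borel_measurable ?R"
      by (rule N.borel_measurable_lebesgue_integral)
    show "(\<lambda>y. u (x(i := y))) \<in> borel_measurable borel" if x: "x \<in> space ?R"
      using measurable_compose[OF measurable_component_update[OF x] u'] by (simp cong: measurable_cong_sets)
  qed
  have inb: "\<bar>\<integral>y. u (x(i := y)) \<partial>N\<bar> \<le> 1" if "u \<in> borel_measurable ?P" "\<And>x. \<bar>u x\<bar> \<le> 1" "x \<in> space ?R" for u :: "_ \<Rightarrow> real" and x
    using inm[OF that] that(2) by (intro N.abs_expectation_le(2)) (auto cong: measurable_cong_sets)
  have ini: "integrable ?R (\<lambda>x. \<integral>y. u (x(i := y)) \<partial>N)" if u: "u \<in> borel_measurable ?P" "\<And>x. \<bar>u x\<bar> \<le> 1" for u :: "_ \<Rightarrow> real"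
    by (rule RR.integrable_const_bound[where B = 1, OF AE_I2 fubm[OF u]]) (simp add: inb[OF u])
  have "\<bar>(\<integral>x. F1 x \<partial>?P) - (\<integral>x. f' x \<partial>?P)\<bar> = \<bar>\<integral>x. (\<integral>y. F1 (x(i := y)) \<partial>N) - (\<integral>y. f' (x(i := y)) \<partial>N) \<partial>?R\<bar>"
    unfolding fub[OF F1m F11] fub[OF f'm f'1]
    by (simp only: Bochner_Integration.integral_diff[OF ini[OF F1m F11] ini[OF f'm f'1]])
  also have "\<dots> \<le> (\<integral>x. \<epsilon> \<partial>?R)"
  proof (rule abs_integral_le_integral)
    show "AE x in ?R. \<bar>(\<integral>y. F1 (x(i := y)) \<partial>N) - (\<integral>y. f' (x(i := y)) \<partial>N)\<bar> \<le> \<epsilon>"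
      unfolding eq using inm[OF f'm f'1] f'1 by (intro AE_I2 shift[OF iI]) auto
  qed (auto intro!: Bochner_Integration.integrable_diff ini F1m F11 f'm f'1)
  also have "\<dots> = \<epsilon>" by (simp add: RR.prob_space)
  finally have 1: "\<bar>(\<integral>x. F1 x \<partial>?P) - (\<integral>x. f' x \<partial>?P)\<bar> \<le> \<epsilon>" .
  have 2: "\<bar>(\<integral>x. f' x \<partial>?P) - (\<integral>x. f x \<partial>?P)\<bar> \<le> real (card S) * \<epsilon>"
    using insert.IH insert.prems unfolding f'_def sh_def by blast
  have "real (card (insert i S)) * \<epsilon> = \<epsilon> + real (card S) * \<epsilon>"
    using insert.hyps by (simp add: distrib_right)
  then show ?case using 1 2 unfolding F1_def sh_def by linarith
qed

context rbm_euler
begin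

text \<open>Independence of the components makes the law of the increment a product. That \<delta>
  does not depend on \<open>h\<close> is essential: \<open>h\<close> will come from functions
  without any known continuity in the position.\<close>

lemma gaussian_shift:
  assumes s: "0 \<le> s" "s < t" and \<epsilon>: "0 < \<epsilon>"
  obtains \<delta> where "0 < \<delta>" "\<And>v (h :: real^'n \<Rightarrow> real). norm v < \<delta> \<Longrightarrow> h \<in> borel_measurable borel \<Longrightarrow> (\<And>x. \<bar>h x\<bar> \<le> 1) \<Longrightarrow>
    \<bar>(\<integral>\<omega>. h (W t \<omega> - W s \<omega> + v) \<partial>M) - (\<integral>\<omega>. h (W t \<omega> - W s \<omega>) \<partial>M)\<bar> \<le> \<epsilon>"
proof -
  let ?V = "\<lambda>\<omega>. W t \<omega> - W s \<omega>"
  define N where "N = density lborel (normal_density 0 (sqrt (t - s)))"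
  have s0: "0 < sqrt (t - s)" using s by simp
  have N: "prob_space N" "sets N = sets borel" using prob_space_normal_density[OF s0] by (auto simp: N_def)
  have iv: "indep_vars (\<lambda>_. borel) (\<lambda>k \<omega>. ?V \<omega> $ k) UNIV"
    and nd: "\<And>k. distributed M lborel (\<lambda>\<omega>. ?V \<omega> $ k) (normal_density 0 (sqrt (t - s)))"
    using bm s unfolding brownian_motion_def by blast+
  have dk: "distr M borel (\<lambda>\<omega>. ?V \<omega> $ k) = N" for k
  proof -
    have "distr M borel (\<lambda>\<omega>. ?V \<omega> $ k) = distr M lborel (\<lambda>\<omega>. ?V \<omega> $ k)" by (intro distr_cong) auto
    then show ?thesis unfolding N_def using distributed_distr_eq_density[OF nd] by simp
  qed
  have Vm: "?V \<in> borel_measurable M" using s by (intro dW_M) auto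
  have rv: "(\<lambda>\<omega>. ?V \<omega> $ k) \<in> borel_measurable M" for k
    by (rule measurable_compose[OF Vm]) (intro borel_measurable_continuous_onI continuous_intros)
  let ?X = "\<lambda>\<omega>. \<lambda>k\<in>UNIV. ?V \<omega> $ k"
  have law: "distr M (\<Pi>\<^sub>M k\<in>UNIV. borel) ?X = (\<Pi>\<^sub>M k\<in>(UNIV :: 'n set). N)"
    using indep_vars_iff_distr_eq_PiM[THEN iffD1, OF UNIV_not_empty rv iv] unfolding dk .
  have Xm: "?X \<in> measurable M (\<Pi>\<^sub>M k\<in>UNIV. borel)"
    by (rule measurable_restrict) (rule rv)
  define \<epsilon>' where "\<epsilon>' = \<epsilon> / real CARD('n)"
  have \<epsilon>': "0 < \<epsilon>'" using \<epsilon> by (simp add: \<epsilon>'_def)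
  obtain \<delta> where \<delta>: "0 < \<delta>" "\<And>a (g :: real \<Rightarrow> real). \<bar>a\<bar> < \<delta> \<Longrightarrow> g \<in> borel_measurable borel \<Longrightarrow> (\<And>x. \<bar>g x\<bar> \<le> 1) \<Longrightarrow>
    \<bar>(\<integral>y. g (y + a) \<partial>N) - (\<integral>y. g y \<partial>N)\<bar> \<le> \<epsilon>'"
    unfolding N_def using normal_shift[OF s0 \<epsilon>'] by blast
  show thesis
  proof (rule that[OF \<delta>(1)])
    fix v :: "real^'n" and h :: "real^'n \<Rightarrow> real"
    assume v: "norm v < \<delta>" and h: "h \<in> borel_measurable borel" and h1: "\<And>x. \<bar>h x\<bar> \<le> 1"
    define vec where "vec x = (\<Sum>k\<in>UNIV. x k *\<^sub>R axis k (1::real))" for x :: "'n \<Rightarrow> real"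
    have vec_nth: "vec x $ k = x k" for x k
      unfolding vec_def by (simp add: axis_def if_distrib cong: if_cong)
    have vecm: "vec \<in> borel_measurable (\<Pi>\<^sub>M k\<in>(UNIV :: 'n set). borel)" unfolding vec_def by measurable
    define f where "f x = h (vec x)" for x
    have fm: "f \<in> borel_measurable (\<Pi>\<^sub>M k\<in>(UNIV :: 'n set). borel)"
      unfolding f_def by (rule measurable_compose[OF vecm h])
    have setsP: "sets (\<Pi>\<^sub>M k\<in>(UNIV :: 'n set). borel) = sets (\<Pi>\<^sub>M k\<in>(UNIV :: 'n set). N)"
      using N(2) by (intro sets_PiM_cong) auto
    have fm': "f \<in> borel_measurable (\<Pi>\<^sub>M k\<in>(UNIV :: 'n set). N)"
      using fm by (simp add: measurable_cong_sets[OF setsP refl])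
    let ?sh = "\<lambda>x. \<lambda>k\<in>UNIV. x k + (if k \<in> UNIV then v $ k else 0)"
    have fsm: "(\<lambda>x. f (?sh x)) \<in> borel_measurable (\<Pi>\<^sub>M k\<in>(UNIV :: 'n set). borel)"
      by (rule measurable_compose[OF _ fm]) (rule measurable_restrict, measurable)
    have "\<bar>(\<integral>x. f (?sh x) \<partial>(\<Pi>\<^sub>M k\<in>(UNIV :: 'n set). N)) - (\<integral>x. f x \<partial>(\<Pi>\<^sub>M k\<in>(UNIV :: 'n set). N))\<bar> \<le> real (card (UNIV :: 'n set)) * \<epsilon>'"
    proof (rule product_shift[OF N _ _ _ _ fm'])
      fix i :: 'n and g :: "real \<Rightarrow> real"
      assume "g \<in> borel_measurable borel" "\<And>x. \<bar>g x\<bar> \<le> 1"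
      moreover have "\<bar>v $ i\<bar> < \<delta>" using component_le_norm_cart[of v i] v by linarith
      ultimately show "\<bar>(\<integral>y. g (y + v $ i) \<partial>N) - (\<integral>y. g y \<partial>N)\<bar> \<le> \<epsilon>'" by (intro \<delta>(2))
    qed (auto simp: f_def h1)
    moreover have "real (card (UNIV :: 'n set)) * \<epsilon>' = \<epsilon>" by (simp add: \<epsilon>'_def)
    moreover have "(\<integral>x. f (?sh x) \<partial>(\<Pi>\<^sub>M k\<in>(UNIV :: 'n set). N)) = (\<integral>\<omega>. f (?sh (?X \<omega>)) \<partial>M)"
      unfolding law[symmetric] by (rule integral_distr[OF Xm fsm])
    moreover have "f (?sh (?X \<omega>)) = h (?V \<omega> + v)" for \<omega>
      unfolding f_def by (intro arg_cong[where f = h]) (simp add: vec_eq_iff vec_nth)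
    moreover have "(\<integral>x. f x \<partial>(\<Pi>\<^sub>M k\<in>(UNIV :: 'n set). N)) = (\<integral>\<omega>. f (?X \<omega>) \<partial>M)"
      unfolding law[symmetric] by (rule integral_distr[OF Xm fm])
    moreover have "f (?X \<omega>) = h (?V \<omega>)" for \<omega>
      unfolding f_def by (intro arg_cong[where f = h]) (simp add: vec_eq_iff vec_nth)
    ultimately show "\<bar>(\<integral>\<omega>. h (?V \<omega> + v) \<partial>M) - (\<integral>\<omega>. h (?V \<omega>) \<partial>M)\<bar> \<le> \<epsilon>"
      by (simp only:)
  qed
qed

end

lemma (in prob_space) expectation_close:
  fixes f g :: "'a \<Rightarrow> real"
  assumes m: "f \<in> borel_measurable M" "g \<in> borel_measurable M" and b: "\<And>x. \<bar>f x\<bar> \<le> 1" "\<And>x. \<bar>g x\<bar> \<le> 1"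
    and E: "E \<in> events" and p: "prob (space M - E) \<le> p" and \<eta>: "0 \<le> \<eta>" and ae: "AE x in M. x \<in> E \<longrightarrow> \<bar>f x - g x\<bar> \<le> \<eta>"
  shows "\<bar>(\<integral>x. f x \<partial>M) - (\<integral>x. g x \<partial>M)\<bar> \<le> \<eta> + 2 * p"
proof -
  have i: "integrable M f" "integrable M g" using m b by (auto intro: abs_expectation_le(1))
  have ii: "integrable M (\<lambda>x. indicator (space M - E) x :: real)"
    using E by (intro abs_expectation_le(1)[where c = 1]) (auto simp: indicator_def)
  have "\<bar>(\<integral>x. f x \<partial>M) - (\<integral>x. g x \<partial>M)\<bar> = \<bar>\<integral>x. f x - g x \<partial>M\<bar>" by (simp add: i)
  also have "\<dots> \<le> (\<integral>x. \<eta> + 2 * indicator (space M - E) x \<partial>M)"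
  proof (rule abs_integral_le_integral)
    show "AE x in M. \<bar>f x - g x\<bar> \<le> \<eta> + 2 * indicator (space M - E) x"
      using ae AE_space
    proof eventually_elim
      case (elim x)
      show ?case
      proof (cases "x \<in> E")
        case False
        have "\<bar>f x - g x\<bar> \<le> 2" using b(1)[of x] b(2)[of x] by linarith
        then show ?thesis using False elim(2) \<eta> by simp
      qed (use elim in auto)
    qed
  qed (auto intro!: i ii)
  also have "\<dots> = \<eta> + 2 * prob (space M - E)"
    using E ii by (subst Bochner_Integration.integral_add) (auto simp: prob_space Int_absorb2)
  finally show ?thesis using p by linarith
qed

context euler_data
begin

text \<open>For a short time only faces active at \<open>x\<close> can be hit, even from nearby
  starting points, and \<open>y\<close> is tangent to these. So \<open>path_near\<close> applies
  with \<open>y\<close> itself as reference.\<close>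

lemma small_time:
  assumes x: "\<And>i. 0 \<le> x \<bullet> n i" and y: "\<And>i. x \<bullet> n i = 0 \<Longrightarrow> y \<bullet> n i = 0" and \<eta>: "0 < \<eta>"
  obtains \<delta> where "0 < \<delta>" "\<And>w z yy j e. path_sol w z yy j \<Longrightarrow> 0 < e \<Longrightarrow> e \<le> \<delta> \<Longrightarrow>
    (\<And>t. 0 \<le> t \<Longrightarrow> t \<le> e \<Longrightarrow> norm (w t - w 0) \<le> \<delta>) \<Longrightarrow> norm (z 0 - x) \<le> \<delta> \<Longrightarrow> norm (j 0 - y) \<le> \<delta> \<Longrightarrow> norm (j e - y) \<le> \<eta>"
proof -
  define \<rho> where "\<rho> = Min (insert 1 ((\<lambda>i. x \<bullet> n i) ` {i. x \<bullet> n i \<noteq> 0}))"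
  have "0 < v" if "v \<in> insert 1 ((\<lambda>i. x \<bullet> n i) ` {i. x \<bullet> n i \<noteq> 0})" for v
    using that x by (auto simp: order.strict_iff_order)
  then have \<rho>: "0 < \<rho>" unfolding \<rho>_def by (subst Min_gr_iff) auto
  have \<rho>le: "\<rho> \<le> x \<bullet> n i" if "x \<bullet> n i \<noteq> 0" for i
    unfolding \<rho>_def using that by (intro Min_le) auto
  \<comment> \<open>With time, noise and initial errors all at most \<delta>, the position moves at
    most \<open>c * \<delta>\<close> away from \<open>x\<close>; \<open>c'\<close> is the
    corresponding factor in \<open>path_near\<close>.\<close>
  define c where "c = 1 + 2 * ((CB + 1) * S0)"
  define c' where "c' = (CB + 1) * (2 * (C1 * S0) + 2 * S0 + 1)"
  have S: "0 < S0" using S0(1) by simp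
  have c: "0 < c" "0 < c'"
    using S CB_pos C1_pos by (auto simp: c_def c'_def add_pos_pos)
  define \<delta> where "\<delta> = min (\<rho> / (2 * c)) (\<eta> / c')"
  have \<delta>: "0 < \<delta>" using \<rho> c \<eta> by (simp add: \<delta>_def)
  have \<delta>1: "c * \<delta> \<le> \<rho> / 2"
  proof -
    have "c * \<delta> \<le> c * (\<rho> / (2 * c))" using c by (intro mult_left_mono) (auto simp: \<delta>_def)
    then show ?thesis using c by simp
  qed
  have \<delta>2: "c' * \<delta> \<le> \<eta>"
  proof -
    have "c' * \<delta> \<le> c' * (\<eta> / c')" using c by (intro mult_left_mono) (auto simp: \<delta>_def)
    then show ?thesis using c by simp
  qed
  show thesis
  proof (rule that[OF \<delta>])
    fix w z yy j :: "real \<Rightarrow> real^'n" and e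
    assume p: "path_sol w z yy j" and e: "0 < e" "e \<le> \<delta>" and w: "\<And>t. 0 \<le> t \<Longrightarrow> t \<le> e \<Longrightarrow> norm (w t - w 0) \<le> \<delta>"
      and z0: "norm (z 0 - x) \<le> \<delta>" and j0: "norm (j 0 - y) \<le> \<delta>"
    have yz: "y \<bullet> n i = 0" if t: "0 \<le> t" "t \<le> e" "z t \<bullet> n i = 0" for t i
    proof (rule ccontr)
      assume "y \<bullet> n i \<noteq> 0"
      then have "\<rho> \<le> x \<bullet> n i" using y \<rho>le by blast
      have "norm (z t - z 0) \<le> (CB + 1) * (S0 * ((e - 0) + \<delta>))"
        by (rule path_modulus(1)[OF p order.refl w t(1,2)])
      also have "\<dots> \<le> (CB + 1) * (S0 * (\<delta> + \<delta>))"
        using CB_pos S e by (intro mult_left_mono) auto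
      finally have "norm (z t - z 0) + norm (z 0 - x) \<le> c * \<delta>"
        using z0 by (simp add: c_def algebra_simps)
      moreover have "norm (z t - x) \<le> norm (z t - z 0) + norm (z 0 - x)"
        using norm_triangle_ineq[of "z t - z 0" "z 0 - x"] by simp
      ultimately have "norm (z t - x) \<le> \<rho> / 2" using \<delta>1 by linarith
      moreover have "\<bar>(z t - x) \<bullet> n i\<bar> \<le> norm (z t - x)"
        using Cauchy_Schwarz_ineq2[of "z t - x" "n i"] n_unit[of i] by simp
      ultimately show False using t(3) \<open>\<rho> \<le> x \<bullet> n i\<close> \<rho> by (simp add: inner_diff_left)
    qed
    have "norm (j e - y) \<le> (CB + 1) * (C1 * S0 * (e + \<delta>) + S0 * (e + \<delta>) + norm (j 0 - y))"
      by (rule path_near[OF p e(1) w yz])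
    also have "\<dots> \<le> (CB + 1) * (C1 * S0 * (\<delta> + \<delta>) + S0 * (\<delta> + \<delta>) + \<delta>)"
      using CB_pos C1_pos S e j0 by (intro mult_left_mono add_mono) auto
    also have "\<dots> = c' * \<delta>" by (simp add: c'_def algebra_simps)
    finally show "norm (j e - y) \<le> \<eta>" using \<delta>2 by linarith
  qed
qed

end

context rbm_euler
begin

lemma sigma_inverse:
  "\<exists>(\<tau> :: real^'n^'n) c. 0 < c \<and> (\<forall>v. norm (\<tau> *v v) \<le> c * norm v) \<and> (\<forall>v. \<sigma> *v (\<tau> *v v) = v)"
proof -
  have "inj ((*v) \<sigma>)"
  proof (subst linear_injective_0)
    show "\<forall>x. \<sigma> *v x = 0 \<longrightarrow> x = 0"
      using sigma_pd by (metis inner_zero_right less_irrefl pos_def_sym_def)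
  qed simp
  then obtain \<tau> where "\<tau> ** \<sigma> = mat 1" using matrix_left_invertible_injective by blast
  then have "\<sigma> ** \<tau> = mat 1" using matrix_left_right_inverse by blast
  then have 1: "\<sigma> *v (\<tau> *v v) = v" for v by (simp add: matrix_vector_mul_assoc)
  obtain c where "0 < c" "\<And>v. norm (\<tau> *v v) \<le> norm v * c"
    using bounded_linear.pos_bounded[OF matrix_vector_mul_bounded_linear[of \<tau>]] by blast
  then show ?thesis using 1 by (intro exI[of _ \<tau>] exI[of _ c]) (simp add: mult.commute)
qed

text \<open>Continuity from above: the events of being closer than \<open>1 / real (Suc m)\<close>
  to some face decrease almost surely to that of being on the boundary.\<close>

lemma interior_margin:
  assumes J: "joint_solution Z D" and s: "0 \<le> s" and p: "prob {\<omega> \<in> space M. \<exists>i. Z s \<omega> \<bullet> n i = 0} < \<epsilon>"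
  obtains \<rho> where "0 < \<rho>" "prob {\<omega> \<in> space M. \<exists>i. Z s \<omega> \<bullet> n i < \<rho>} < \<epsilon>"
proof -
  have [measurable]: "Z s \<in> borel_measurable M"
    using J s F_measurable_M[OF s] by (auto simp: joint_solution_def adapted_def)
  define A where "A m = {\<omega> \<in> space M. \<exists>i. Z s \<omega> \<bullet> n i < 1 / real (Suc m)}" for m
  have A: "A m \<in> events" for m unfolding A_def by measurable
  have "decseq A"
  proof (rule decseq_SucI, rule subsetI)
    fix m \<omega> assume "\<omega> \<in> A (Suc m)"
    moreover have "1 / real (Suc (Suc m)) \<le> 1 / real (Suc m)" by (simp add: frac_le)
    ultimately show "\<omega> \<in> A m" unfolding A_def using less_le_trans by blast
  qed
  then have lim: "(\<lambda>m. prob (A m)) \<longlonglongrightarrow> prob (\<Inter>m. A m)"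
    using A by (intro finite_Lim_measure_decseq) auto
  have "prob (\<Inter>m. A m) \<le> prob {\<omega> \<in> space M. \<exists>i. Z s \<omega> \<bullet> n i = 0}"
  proof (rule finite_measure_mono_AE)
    obtain Y where "AE \<omega> in M. path_sol (\<lambda>t. W t \<omega>) (\<lambda>t. Z t \<omega>) (\<lambda>t. Y t \<omega>) (\<lambda>t. D t \<omega>)"
      using J by (auto simp: joint_solution_def)
    then show "AE \<omega> in M. \<omega> \<in> (\<Inter>m. A m) \<longrightarrow> \<omega> \<in> {\<omega> \<in> space M. \<exists>i. Z s \<omega> \<bullet> n i = 0}"
    proof eventually_elim
      case (elim \<omega>)
      show ?case
      proof (rule impI, rule ccontr)
        assume \<omega>: "\<omega> \<in> (\<Inter>m. A m)" and no: "\<omega> \<notin> {\<omega> \<in> space M. \<exists>i. Z s \<omega> \<bullet> n i = 0}"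
        have "\<omega> \<in> space M" using \<omega> by (auto simp: A_def)
        then have pos: "0 < Z s \<omega> \<bullet> n i" for i
          using no path_solD(7)[OF elim s, of i] by (auto simp: order.strict_iff_order)
        define m0 where "m0 = Min (range (\<lambda>i. Z s \<omega> \<bullet> n i))"
        have m0: "0 < m0" unfolding m0_def using pos by (subst Min_gr_iff) auto
        obtain m where m: "1 / real (Suc m) < m0" using m0 nat_approx_posE by blast
        have "\<omega> \<in> A m" using \<omega> by blast
        then obtain i where "Z s \<omega> \<bullet> n i < 1 / real (Suc m)" by (auto simp: A_def)
        moreover have "m0 \<le> Z s \<omega> \<bullet> n i" unfolding m0_def by (intro Min_le) auto
        ultimately show False using m by linarith
      qed
    qed
    show "{\<omega> \<in> space M. \<exists>i. Z s \<omega> \<bullet> n i = 0} \<in> events" by measurable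
  qed
  then have "prob (\<Inter>m. A m) < \<epsilon>" using p by linarith
  with lim have "eventually (\<lambda>m. prob (A m) < \<epsilon>) sequentially"
    by (rule order_tendstoD(2))
  then obtain m where "prob (A m) < \<epsilon>" by (auto simp: eventually_sequentially)
  then show thesis using that[of "1 / real (Suc m)"] by (simp add: A_def)
qed

text \<open>The test function at time \<open>t\<close> is replaced by \<open>G m\<close> at a small
  time \<open>u\<close>. There the derivative is replaced by \<open>y\<close> and the position by
  the free motion started at an earlier time \<open>s\<close>; only a change of the starting point
  of a Gaussian remains. All bounds are uniform in \<open>m\<close>.\<close>

lemma feller_lipschitz:
  fixes xk yk :: "nat \<Rightarrow> real^'n"
  assumes J0: "joint_solution Z D" and init0: "AE \<omega> in M. Z 0 \<omega> = x" "AE \<omega> in M. D 0 \<omega> = y"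
    and Jk: "\<And>k. joint_solution (Zk k) (Dk k)" and initk: "\<And>k. AE \<omega> in M. Zk k 0 \<omega> = xk k" "\<And>k. AE \<omega> in M. Dk k 0 \<omega> = yk k"
    and x: "\<And>i. 0 \<le> x \<bullet> n i" and y: "\<And>i. x \<bullet> n i = 0 \<Longrightarrow> y \<bullet> n i = 0"
    and lim: "xk \<longlonglongrightarrow> x" "yk \<longlonglongrightarrow> y" and t: "0 < t"
    and f: "f \<in> borel_measurable borel" "\<And>p. \<bar>f p\<bar> \<le> 1" and L: "0 \<le> L" "\<And>p q. \<bar>f p - f q\<bar> \<le> L * norm (p - q)"
  shows "(\<lambda>k. \<integral>\<omega>. f (Zk k t \<omega>, Dk k t \<omega>) \<partial>M) \<longlonglongrightarrow> (\<integral>\<omega>. f (Z t \<omega>, D t \<omega>) \<partial>M)"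
proof (rule LIMSEQ_I)
  fix \<epsilon>0 :: real assume \<epsilon>0: "0 < \<epsilon>0"
  \<comment> \<open>The total is 15 times \<epsilon>: for each of the two solutions 3 for freezing
    the derivative and 4 for passing to the free motion, and 1 for the Gaussian shift.\<close>
  define \<epsilon> where "\<epsilon> = \<epsilon>0 / 16"
  have \<epsilon>: "0 < \<epsilon>" using \<epsilon>0 by (simp add: \<epsilon>_def)
  define \<Lambda> where "\<Lambda> = L * RB"
  have \<Lambda>: "0 \<le> \<Lambda>" using L(1) RB(1) by (simp add: \<Lambda>_def)
  \<comment> \<open>A derivative within \<eta> of \<open>y\<close> differs from it by an element of
    \<open>\<eta> / rB\<close> times \<open>B\<close>, which changes \<open>G m\<close> by at most
    \<epsilon>.\<close>
  define \<eta> where "\<eta> = \<epsilon> * rB / (\<Lambda> + 1)"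
  have \<eta>: "0 < \<eta>" using \<epsilon> rB(1) \<Lambda> by (simp add: \<eta>_def)
  have \<Lambda>\<eta>: "\<Lambda> * (\<eta> / rB) \<le> \<epsilon>"
  proof -
    have "\<Lambda> * (\<eta> / rB) = \<epsilon> * (\<Lambda> / (\<Lambda> + 1))" using rB(1) by (simp add: \<eta>_def)
    also have "\<dots> \<le> \<epsilon> * 1" using \<Lambda> \<epsilon> by (intro mult_left_mono) auto
    finally show ?thesis by simp
  qed
  obtain \<delta> where \<delta>: "0 < \<delta>" and \<delta>D: "\<And>w z yy j e. path_sol w z yy j \<Longrightarrow> 0 < e \<Longrightarrow> e \<le> \<delta> \<Longrightarrow>
    (\<And>t. 0 \<le> t \<Longrightarrow> t \<le> e \<Longrightarrow> norm (w t - w 0) \<le> \<delta>) \<Longrightarrow> norm (z 0 - x) \<le> \<delta> \<Longrightarrow> norm (j 0 - y) \<le> \<delta> \<Longrightarrow> norm (j e - y) \<le> \<eta>"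
    using small_time[OF x y \<eta>] by blast
  obtain \<delta>1 E1 where E1: "0 < \<delta>1" "E1 \<in> events" "prob (space M - E1) \<le> \<epsilon>"
    "AE \<omega> in M. \<omega> \<in> E1 \<longrightarrow> (\<forall>u v. 0 \<le> u \<longrightarrow> u \<le> v \<longrightarrow> v \<le> 1 \<longrightarrow> v - u < \<delta>1 \<longrightarrow> norm (W v \<omega> - W u \<omega>) \<le> \<delta>)"
    by (rule W_modulus[OF order.refl zero_less_one \<delta> \<epsilon>])
  define T0 where "T0 = min (min \<delta> \<delta>1) (min t 1)"
  have T0: "0 < T0" "T0 \<le> \<delta>" "T0 \<le> \<delta>1" "T0 \<le> t" "T0 \<le> 1" using \<delta> E1(1) t by (auto simp: T0_def)
  obtain s where s: "0 < s" "s < T0" "prob {\<omega> \<in> space M. \<exists>i. Z s \<omega> \<bullet> n i = 0} < \<epsilon>"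
    by (rule boundary_prob_small[OF J0 T0(1) \<epsilon>])
  have s0: "0 \<le> s" using s by simp
  obtain \<rho>2 where \<rho>2: "0 < \<rho>2" "prob {\<omega> \<in> space M. \<exists>i. Z s \<omega> \<bullet> n i < \<rho>2} < \<epsilon>"
    by (rule interior_margin[OF J0 s0 s(3)])
  \<comment> \<open>Half of the margin is for the distance of the nearby solution at time
    \<open>s\<close>, half for its motion until \<open>u\<close>.\<close>
  define \<rho> where "\<rho> = \<rho>2 / 2"
  have \<rho>: "0 < \<rho>" "\<rho>2 = 2 * \<rho>" using \<rho>2(1) by (auto simp: \<rho>_def)
  have S: "0 < S0" using S0(1) by simp
  define r where "r = \<rho> / (4 * ((CB + 1) * S0))"
  have r: "0 < r" "(CB + 1) * (S0 * (r + r)) < \<rho>"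
  proof -
    have pos: "0 < (CB + 1) * S0" using CB_pos S by simp
    then show "0 < r" using \<rho> unfolding r_def by simp
    have "(CB + 1) * (S0 * (r + r)) = 2 * (((CB + 1) * S0) * r)" by (simp add: algebra_simps)
    also have "((CB + 1) * S0) * r = \<rho> / 4"
    proof -
      have "c * (\<rho> / (4 * c)) = \<rho> / 4" if "0 < c" for c using that by simp
      from this[OF pos] show ?thesis by (simp only: r_def)
    qed
    finally show "(CB + 1) * (S0 * (r + r)) < \<rho>" using \<rho> by simp
  qed
  have ss1: "s < s + 1" by simp
  obtain \<delta>2 E2 where E2: "0 < \<delta>2" "E2 \<in> events" "prob (space M - E2) \<le> \<epsilon>"
    "AE \<omega> in M. \<omega> \<in> E2 \<longrightarrow> (\<forall>u v. s \<le> u \<longrightarrow> u \<le> v \<longrightarrow> v \<le> s + 1 \<longrightarrow> v - u < \<delta>2 \<longrightarrow> norm (W v \<omega> - W u \<omega>) \<le> r)"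
    by (rule W_modulus[OF s0 ss1 r(1) \<epsilon>])
  \<comment> \<open>Late enough to carry noise, early enough that from time \<open>s\<close> on no
    face is reached and that the derivative is still close to \<open>y\<close>.\<close>
  define u where "u = s + min (min r (\<delta>2 / 2)) ((T0 - s) / 2)"
  have u: "s < u" "u < T0" "u - s \<le> r" "u - s < \<delta>2" "u \<le> s + 1" "0 < u" "0 \<le> u"
    using r(1) E2(1) s T0(5) by (auto simp: u_def min_def field_simps)
  have ut: "u < t" using u T0 by linarith
  obtain \<tau> c\<tau> where \<tau>': "0 < c\<tau>" "\<forall>v. norm (\<tau> *v v) \<le> c\<tau> * norm v" "\<forall>v. \<sigma> *v (\<tau> *v v) = v"
    using sigma_inverse by (elim exE conjE)
  note \<tau> = \<tau>'(1) spec[OF \<tau>'(2)] spec[OF \<tau>'(3)]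
  obtain \<delta>3 where \<delta>3: "0 < \<delta>3" and \<delta>3D: "\<And>v (h :: real^'n \<Rightarrow> real). norm v < \<delta>3 \<Longrightarrow> h \<in> borel_measurable borel \<Longrightarrow> (\<And>x. \<bar>h x\<bar> \<le> 1) \<Longrightarrow>
    \<bar>(\<integral>\<omega>. h (W u \<omega> - W s \<omega> + v) \<partial>M) - (\<integral>\<omega>. h (W u \<omega> - W s \<omega>) \<partial>M)\<bar> \<le> \<epsilon>"
    using gaussian_shift[OF s0 u(1) \<epsilon>] by blast
  define E3 where "E3 = {\<omega> \<in> space M. \<exists>i. Z s \<omega> \<bullet> n i < 2 * \<rho>}"
  have ZM: "Z' v \<in> borel_measurable M" "Z' v \<in> borel_measurable (F v)" "D' v \<in> borel_measurable M" if "joint_solution Z' D'" "0 \<le> v" for Z' D' v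
    using that F_measurable_M[OF that(2)] by (auto simp: joint_solution_def adapted_def)
  note [measurable] = ZM(1)[OF J0 s0]
  have E3: "E3 \<in> events" "prob E3 < \<epsilon>" using \<rho>2 \<rho> by (auto simp: E3_def)
  define E4 where "E4 = E2 - E3"
  have E4: "E4 \<in> events" using E2(2) E3(1) by (auto simp: E4_def)
  have pE4: "prob (space M - E4) \<le> 2 * \<epsilon>"
  proof -
    have "space M - E4 \<subseteq> (space M - E2) \<union> E3" by (auto simp: E4_def)
    then have "prob (space M - E4) \<le> prob ((space M - E2) \<union> E3)"
      using E2(2) E3(1) by (intro finite_measure_mono) auto
    also have "\<dots> \<le> prob (space M - E2) + prob E3" using E2(2) E3(1) by (intro measure_Un_le) auto
    finally show ?thesis using E2(3) E3(2) by linarith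
  qed
  \<comment> \<open>The position at \<open>u\<close> if no face is hit after
    \<open>s\<close>.\<close>
  define X where "X Z' \<omega> = Z' s \<omega> + (u - s) *\<^sub>R b0 + \<sigma> *v (W u \<omega> - W s \<omega>)" for Z' :: "real \<Rightarrow> 'w \<Rightarrow> real^'n" and \<omega>
  note dWm[measurable] = dW_M[OF s0 less_imp_le[OF u(1)]]
  have XM: "X Z' \<in> borel_measurable M" if "joint_solution Z' D'" for Z' D'
  proof -
    note [measurable] = ZM(1)[OF that s0]
    show ?thesis unfolding X_def by measurable
  qed
  obtain Y where Y: "AE \<omega> in M. path_sol (\<lambda>t. W t \<omega>) (\<lambda>t. Z t \<omega>) (\<lambda>t. Y t \<omega>) (\<lambda>t. D t \<omega>)"
    using J0 by (auto simp: joint_solution_def)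
  \<comment> \<open>Stated for any solution starting near \<open>(x, y)\<close>, as it is needed
    both for the limit and for the approximating starting points.\<close>
  have near: "\<bar>(\<integral>\<omega>. G (Z' u \<omega>, D' u \<omega>) \<partial>M) - (\<integral>\<omega>. G (Z' u \<omega>, y) \<partial>M)\<bar> \<le> \<epsilon> + 2 * \<epsilon>"
      "\<bar>(\<integral>\<omega>. G (Z' u \<omega>, y) \<partial>M) - (\<integral>\<omega>. G (X Z' \<omega>, y) \<partial>M)\<bar> \<le> 0 + 2 * (2 * \<epsilon>)"
    if J': "joint_solution Z' D'" and i': "AE \<omega> in M. Z' 0 \<omega> = x'" "AE \<omega> in M. D' 0 \<omega> = y'"
      and x': "norm (x' - x) \<le> \<delta>" "(CB + 1) * norm (x' - x) < \<rho>" and y': "norm (y' - y) \<le> \<delta>"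
      and G: "G \<in> borel_measurable borel" "\<And>p. \<bar>G p\<bar> \<le> 1" "lipschitz_gauge \<Lambda> G" for Z' D' x' y' and G :: "_ \<Rightarrow> real"
  proof -
    obtain Y' where Y': "AE \<omega> in M. path_sol (\<lambda>t. W t \<omega>) (\<lambda>t. Z' t \<omega>) (\<lambda>t. Y' t \<omega>) (\<lambda>t. D' t \<omega>)"
      using J' by (auto simp: joint_solution_def)
    note [measurable] = ZM(1)[OF J' u(7)] ZM(3)[OF J' u(7)] XM[OF J']
    have m1: "(\<lambda>\<omega>. G (Z' u \<omega>, D' u \<omega>)) \<in> borel_measurable M"
      by (rule measurable_compose[OF borel_measurable_Pair G(1)]; measurable)
    have m2: "(\<lambda>\<omega>. G (Z' u \<omega>, y)) \<in> borel_measurable M"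
      by (rule measurable_compose[OF borel_measurable_Pair G(1)]; measurable)
    have m3: "(\<lambda>\<omega>. G (X Z' \<omega>, y)) \<in> borel_measurable M"
      by (rule measurable_compose[OF borel_measurable_Pair G(1)]; measurable)
    show "\<bar>(\<integral>\<omega>. G (Z' u \<omega>, D' u \<omega>) \<partial>M) - (\<integral>\<omega>. G (Z' u \<omega>, y) \<partial>M)\<bar> \<le> \<epsilon> + 2 * \<epsilon>"
    proof (rule expectation_close[OF m1 m2 G(2) G(2) E1(2,3)])
      show "AE \<omega> in M. \<omega> \<in> E1 \<longrightarrow> \<bar>G (Z' u \<omega>, D' u \<omega>) - G (Z' u \<omega>, y)\<bar> \<le> \<epsilon>"
        using Y' E1(4) i'
      proof eventually_elim
        case (elim \<omega>)
        show ?case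
        proof
          assume \<omega>: "\<omega> \<in> E1"
          have "norm (D' u \<omega> - y) \<le> \<eta>"
          proof (rule \<delta>D[OF elim(1) u(6)])
            show "u \<le> \<delta>" using u T0 by linarith
            show "norm (W v \<omega> - W 0 \<omega>) \<le> \<delta>" if "0 \<le> v" "v \<le> u" for v
              using elim(2) \<omega> that u(2) T0 by auto
            show "norm (Z' 0 \<omega> - x) \<le> \<delta>" "norm (D' 0 \<omega> - y) \<le> \<delta>" using elim x' y' by auto
          qed
          moreover have pos: "0 < \<eta> / rB" using \<eta> rB(1) by simp
          ultimately have "(D' u \<omega> - y) /\<^sub>R (\<eta> / rB) \<in> B" using rB(1) by (intro norm_in_B) auto
          with pos have "\<bar>G (Z' u \<omega>, D' u \<omega>) - G (Z' u \<omega>, y)\<bar> \<le> \<Lambda> * (\<eta> / rB)"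
            using G(3) unfolding lipschitz_gauge_def by blast
          then show "\<bar>G (Z' u \<omega>, D' u \<omega>) - G (Z' u \<omega>, y)\<bar> \<le> \<epsilon>" using \<Lambda>\<eta> by linarith
        qed
      qed
    qed (use \<epsilon> in auto)
    show "\<bar>(\<integral>\<omega>. G (Z' u \<omega>, y) \<partial>M) - (\<integral>\<omega>. G (X Z' \<omega>, y) \<partial>M)\<bar> \<le> 0 + 2 * (2 * \<epsilon>)"
    proof (rule expectation_close[OF m2 m3 G(2) G(2) E4 pE4 order.refl])
      show "AE \<omega> in M. \<omega> \<in> E4 \<longrightarrow> \<bar>G (Z' u \<omega>, y) - G (X Z' \<omega>, y)\<bar> \<le> 0"
        using Y' Y E2(4) i'(1) init0(1) AE_space
      proof eventually_elim
        case (elim \<omega>)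
        show ?case
        proof
          assume \<omega>: "\<omega> \<in> E4"
          have far: "2 * \<rho> \<le> Z s \<omega> \<bullet> n i" for i
            using \<omega> elim(6) by (auto simp: E4_def E3_def not_less)
          have "norm (Z' s \<omega> - Z s \<omega>) \<le> (CB + 1) * norm (Z' 0 \<omega> - Z 0 \<omega>)"
            by (rule path_lipschitz[OF elim(1,2) s0])
          then have d1: "norm (Z' s \<omega> - Z s \<omega>) < \<rho>" using elim(4,5) x'(2) by simp
          have "Z' u \<omega> = Z' s \<omega> + (u - s) *\<^sub>R b0 + \<sigma> *v (W u \<omega> - W s \<omega>)"
          proof (rule path_no_hit[OF elim(1) s0 less_imp_le[OF u(1)]])
            fix v i assume v: "s < v" "v \<le> u"
            have "norm (Z' v \<omega> - Z' s \<omega>) \<le> (CB + 1) * (S0 * ((u - s) + r))"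
            proof (rule path_modulus(1)[OF elim(1) s0])
              show "norm (W t \<omega> - W s \<omega>) \<le> r" if "s \<le> t" "t \<le> u" for t
                using elim(3) \<omega> that u by (auto simp: E4_def)
            qed (use v in auto)
            also have "\<dots> \<le> (CB + 1) * (S0 * (r + r))"
              using CB_pos S u(3) by (intro mult_left_mono) auto
            finally have d2: "norm (Z' v \<omega> - Z' s \<omega>) < \<rho>" using r(2) by linarith
            have "norm (Z' v \<omega> - Z s \<omega>) < 2 * \<rho>"
              using norm_triangle_ineq[of "Z' v \<omega> - Z' s \<omega>" "Z' s \<omega> - Z s \<omega>"] d1 d2 by simp
            then have "\<bar>(Z' v \<omega> - Z s \<omega>) \<bullet> n i\<bar> < 2 * \<rho>"
              using Cauchy_Schwarz_ineq2[of "Z' v \<omega> - Z s \<omega>" "n i"] n_unit[of i] by simp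
            then show "Z' v \<omega> \<bullet> n i \<noteq> 0" using far[of i] by (auto simp: inner_diff_left)
          qed
          then show "\<bar>G (Z' u \<omega>, y) - G (X Z' \<omega>, y)\<bar> \<le> 0" by (simp add: X_def)
        qed
      qed
    qed
  qed
  define good where "good k \<longleftrightarrow> norm (xk k - x) \<le> \<delta> \<and> (CB + 1) * norm (xk k - x) < \<rho> \<and> norm (yk k - y) \<le> \<delta> \<and>
    c\<tau> * ((CB + 1) * norm (xk k - x)) < \<delta>3" for k
  have "eventually good sequentially"
  proof -
    have l1: "(\<lambda>k. norm (xk k - x)) \<longlonglongrightarrow> 0" "(\<lambda>k. norm (yk k - y)) \<longlonglongrightarrow> 0"
      using tendsto_norm_zero[OF LIM_zero[OF lim(1)]] tendsto_norm_zero[OF LIM_zero[OF lim(2)]] by auto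
    then have l2: "(\<lambda>k. (CB + 1) * norm (xk k - x)) \<longlonglongrightarrow> 0" "(\<lambda>k. c\<tau> * ((CB + 1) * norm (xk k - x))) \<longlonglongrightarrow> 0"
      by (auto intro!: tendsto_mult_right_zero)
    show ?thesis
      using order_tendstoD(2)[OF l1(1) \<delta>] order_tendstoD(2)[OF l1(2) \<delta>] order_tendstoD(2)[OF l2(1) \<rho>(1)] order_tendstoD(2)[OF l2(2) \<delta>3]
      by eventually_elim (auto simp: good_def)
  qed
  then obtain k0 where k0: "\<And>k. k0 \<le> k \<Longrightarrow> good k" by (auto simp: eventually_sequentially)
  let ?\<mu> = "distr M borel (\<lambda>\<omega>. W u \<omega> - W s \<omega>)"
  interpret \<mu>: prob_space ?\<mu> by (rule prob_space_distr) (rule dWm)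
  \<comment> \<open>Given the position at \<open>s\<close>, the value of \<open>G\<close> at the
    free motion averages to \<open>H\<close> of that position, and \<open>H\<close> varies by at
    most \<epsilon> between nearby points although \<open>G\<close> need not.\<close>
  have shift: "\<bar>(\<integral>\<omega>. G (X (Zk k) \<omega>, y) \<partial>M) - (\<integral>\<omega>. G (X Z \<omega>, y) \<partial>M)\<bar> \<le> \<epsilon>"
    if k: "good k" and G: "G \<in> borel_measurable borel" "\<And>p. \<bar>G p\<bar> \<le> 1" for k and G :: "_ \<Rightarrow> real"
  proof -
    define g where "g p = G (fst p + (u - s) *\<^sub>R b0 + \<sigma> *v snd p, y)" for p :: "(real^'n) \<times> (real^'n)"
    have gm: "g \<in> borel_measurable (borel \<Otimes>\<^sub>M borel)"
      unfolding g_def by (rule measurable_compose[OF borel_measurable_Pair G(1)]; measurable)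
    have g1: "\<bar>g p\<bar> \<le> 1" for p by (simp add: g_def G(2))
    define H where "H z = (\<integral>v. g (z, v) \<partial>?\<mu>)" for z
    have Hm: "H \<in> borel_measurable borel"
      unfolding H_def using gm by (intro \<mu>.borel_measurable_lebesgue_integral) (simp add: case_prod_beta' cong: measurable_cong_sets)
    have gz: "(\<lambda>v. g (z, v)) \<in> borel_measurable borel" for z
      using measurable_compose[OF measurable_Pair1' gm] by simp
    have H1: "\<bar>H z\<bar> \<le> 1" for z
      unfolding H_def using gz g1 by (intro \<mu>.abs_expectation_le(2)) auto
    have H_eq: "H z = (\<integral>\<omega>. g (z, W u \<omega> - W s \<omega>) \<partial>M)" for z
      unfolding H_def by (rule integral_distr[OF dWm gz])
    have rep: "(\<integral>\<omega>. G (X Z' \<omega>, y) \<partial>M) = (\<integral>\<omega>. H (Z' s \<omega>) \<partial>M)" if J': "joint_solution Z' D'" for Z' D'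
    proof -
      have "(\<integral>\<omega>. 1 * g (Z' s \<omega>, W u \<omega> - W s \<omega>) \<partial>M) = (\<integral>\<omega>. 1 * (\<integral>v. g (Z' s \<omega>, v) \<partial>?\<mu>) \<partial>M)"
        by (rule indep_integral[where c = 1, OF s0 u(1) ZM(2)[OF J' s0] _ _ gm g1]) auto
      then show ?thesis by (simp add: H_def g_def X_def)
    qed
    \<comment> \<open>Moving the start from \<open>z'\<close> to \<open>z\<close> amounts to
      shifting the Brownian increment by the inverse of \<sigma> applied to
      \<open>z - z'\<close>.\<close>
    have Hlip: "\<bar>H z - H z'\<bar> \<le> \<epsilon>" if "c\<tau> * norm (z - z') < \<delta>3" for z z'
    proof -
      define h where "h v = g (z', v)" for v
      have "h (W u \<omega> - W s \<omega> + \<tau> *v (z - z')) = g (z, W u \<omega> - W s \<omega>)" for \<omega>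
        unfolding h_def g_def by (simp add: matrix_vector_right_distrib \<tau>(3) algebra_simps)
      then have 1: "H z = (\<integral>\<omega>. h (W u \<omega> - W s \<omega> + \<tau> *v (z - z')) \<partial>M)" by (simp add: H_eq)
      have 2: "H z' = (\<integral>\<omega>. h (W u \<omega> - W s \<omega>) \<partial>M)" by (simp add: H_eq h_def)
      show ?thesis
        unfolding 1 2
      proof (rule \<delta>3D)
        show "norm (\<tau> *v (z - z')) < \<delta>3" using \<tau>(2)[of "z - z'"] that by linarith
        show "h \<in> borel_measurable borel" unfolding h_def by (rule gz)
      qed (simp add: h_def g1)
    qed
    obtain Y' where Y': "AE \<omega> in M. path_sol (\<lambda>t. W t \<omega>) (\<lambda>t. Zk k t \<omega>) (\<lambda>t. Y' t \<omega>) (\<lambda>t. Dk k t \<omega>)"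
      using Jk[of k] by (auto simp: joint_solution_def)
    have "AE \<omega> in M. \<bar>H (Zk k s \<omega>) - H (Z s \<omega>)\<bar> \<le> \<epsilon>"
      using Y' Y initk(1)[of k] init0(1)
    proof eventually_elim
      case (elim \<omega>)
      have "norm (Zk k s \<omega> - Z s \<omega>) \<le> (CB + 1) * norm (xk k - x)"
        using path_lipschitz[OF elim(1,2) s0] elim(3,4) by simp
      then have "c\<tau> * norm (Zk k s \<omega> - Z s \<omega>) \<le> c\<tau> * ((CB + 1) * norm (xk k - x))"
        using \<tau>(1) by (intro mult_left_mono) auto
      then show ?case using k by (intro Hlip) (simp add: good_def)
    qed
    then have "\<bar>(\<integral>\<omega>. H (Zk k s \<omega>) \<partial>M) - (\<integral>\<omega>. H (Z s \<omega>) \<partial>M)\<bar> \<le> \<epsilon> + 2 * 0"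
      using \<epsilon> H1 by (intro expectation_close[where E = "space M"] measurable_compose[OF ZM(1)[OF Jk s0] Hm] measurable_compose[OF ZM(1)[OF J0 s0] Hm])
        auto
    then show ?thesis using rep[OF Jk[of k]] rep[OF J0] by simp
  qed
  obtain G where G: "\<forall>m::nat. G m \<in> borel_measurable borel" "\<forall>m x. \<bar>G m x\<bar> \<le> 1" "\<forall>m. lipschitz_gauge (L * RB) (G m)"
    "\<forall>Z D U c. joint_solution Z D \<longrightarrow> U \<in> borel_measurable (F u) \<longrightarrow> (\<forall>\<omega>. \<bar>U \<omega>\<bar> \<le> c) \<longrightarrow>
      (\<lambda>m. \<integral>\<omega>. U \<omega> * G m (Z u \<omega>, D u \<omega>) \<partial>M) \<longlonglongrightarrow> (\<integral>\<omega>. U \<omega> * f (Z t \<omega>, D t \<omega>) \<partial>M)"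
    using approx_transition[OF u(7) ut f L] by (elim exE conjE)
  have Glim: "(\<lambda>m. \<integral>\<omega>. G m (Z' u \<omega>, D' u \<omega>) \<partial>M) \<longlonglongrightarrow> (\<integral>\<omega>. f (Z' t \<omega>, D' t \<omega>) \<partial>M)" if "joint_solution Z' D'" for Z' D'
    using G(4)[rule_format, OF that, of "\<lambda>_. 1" 1] by simp
  show "\<exists>k0. \<forall>k\<ge>k0. norm ((\<integral>\<omega>. f (Zk k t \<omega>, Dk k t \<omega>) \<partial>M) - (\<integral>\<omega>. f (Z t \<omega>, D t \<omega>) \<partial>M)) < \<epsilon>0"
  proof (intro exI[of _ k0] allI impI)
    fix k assume "k0 \<le> k"
    then have k: "good k" by (rule k0)
    have b: "\<bar>(\<integral>\<omega>. G m (Zk k u \<omega>, Dk k u \<omega>) \<partial>M) - (\<integral>\<omega>. G m (Z u \<omega>, D u \<omega>) \<partial>M)\<bar> \<le> 15 * \<epsilon>" for m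
    proof -
      have Gm: "G m \<in> borel_measurable borel" "\<And>p. \<bar>G m p\<bar> \<le> 1" "lipschitz_gauge \<Lambda> (G m)" using G by (auto simp: \<Lambda>_def)
      have nk: "norm (xk k - x) \<le> \<delta>" "(CB + 1) * norm (xk k - x) < \<rho>" "norm (yk k - y) \<le> \<delta>" using k by (auto simp: good_def)
      have n0: "norm (x - x) \<le> \<delta>" "(CB + 1) * norm (x - x) < \<rho>" "norm (y - y) \<le> \<delta>" using \<delta> \<rho> by auto
      note near(1)[OF Jk[of k] initk[of k] nk Gm] near(2)[OF Jk[of k] initk[of k] nk Gm]
        near(1)[OF J0 init0 n0 Gm] near(2)[OF J0 init0 n0 Gm] shift[OF k Gm(1,2)]
      then show ?thesis by linarith
    qed
    have "(\<lambda>m. \<bar>(\<integral>\<omega>. G m (Zk k u \<omega>, Dk k u \<omega>) \<partial>M) - (\<integral>\<omega>. G m (Z u \<omega>, D u \<omega>) \<partial>M)\<bar>)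
      \<longlonglongrightarrow> \<bar>(\<integral>\<omega>. f (Zk k t \<omega>, Dk k t \<omega>) \<partial>M) - (\<integral>\<omega>. f (Z t \<omega>, D t \<omega>) \<partial>M)\<bar>"
      by (intro tendsto_intros Glim Jk J0)
    then have "\<bar>(\<integral>\<omega>. f (Zk k t \<omega>, Dk k t \<omega>) \<partial>M) - (\<integral>\<omega>. f (Z t \<omega>, D t \<omega>) \<partial>M)\<bar> \<le> 15 * \<epsilon>"
      using b by (intro tendsto_upperbound) auto
    also have "\<dots> < \<epsilon>0" using \<epsilon>0 by (simp add: \<epsilon>_def)
    finally show "norm ((\<integral>\<omega>. f (Zk k t \<omega>, Dk k t \<omega>) \<partial>M) - (\<integral>\<omega>. f (Z t \<omega>, D t \<omega>) \<partial>M)) < \<epsilon>0" by simp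
  qed
qed

end

section \<open>From Lipschitz to continuous test functions on the state space\<close>

text \<open>The infimal convolution of \<zeta> with \<open>m\<close> times the distance. Since the
  infimum runs over \<open>S\<close> alone, the result is Lipschitz everywhere; this matters because
  the state space is in general not closed and \<zeta> may have no continuous extension.\<close>

lemma lipschitz_minorants:
  fixes \<zeta> :: "'a::metric_space \<Rightarrow> real"
  assumes S: "S \<noteq> {}" and cont: "continuous_on S \<zeta>" and bd: "\<And>p. p \<in> S \<Longrightarrow> \<bar>\<zeta> p\<bar> \<le> 1"
  obtains f :: "nat \<Rightarrow> 'a \<Rightarrow> real" where "\<And>m p. \<bar>f m p\<bar> \<le> 1" "\<And>m p q. \<bar>f m p - f m q\<bar> \<le> real m * dist p q"
    "\<And>m p. p \<in> S \<Longrightarrow> f m p \<le> \<zeta> p" "\<And>p. p \<in> S \<Longrightarrow> (\<lambda>m. f m p) \<longlonglongrightarrow> \<zeta> p"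
proof -
  define g where "g m p = (INF q\<in>S. \<zeta> q + real m * dist p q)" for m p
  have low: "- 1 \<le> \<zeta> q + real m * dist p q" if "q \<in> S" for m p q
  proof -
    have "0 \<le> real m * dist p q" by simp
    then show ?thesis using bd[OF that] by linarith
  qed
  have bb: "bdd_below ((\<lambda>q. \<zeta> q + real m * dist p q) ` S)" for m p
    using low by (intro bdd_belowI2[of _ "-1"]) auto
  have g_low: "- 1 \<le> g m p" for m p
    unfolding g_def using S low by (intro cINF_greatest) auto
  have g_le: "g m p \<le> \<zeta> q + real m * dist p q" if "q \<in> S" for m p q
    unfolding g_def by (rule cINF_lower[OF bb that])
  have g_lip: "g m p \<le> g m p' + real m * dist p p'" for m p p'
  proof -
    have "g m p - real m * dist p p' \<le> \<zeta> q + real m * dist p' q" if "q \<in> S" for q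
    proof -
      have "real m * dist p q \<le> real m * (dist p p' + dist p' q)"
        by (intro mult_left_mono dist_triangle) auto
      then show ?thesis using g_le[OF that, of m p] by (simp add: distrib_left)
    qed
    then have "g m p - real m * dist p p' \<le> g m p'"
      unfolding g_def[of m p'] using S by (intro cINF_greatest) auto
    then show ?thesis by simp
  qed
  define f where "f m p = min 1 (g m p)" for m p
  show thesis
  proof (rule that)
    show "\<bar>f m p\<bar> \<le> 1" for m p using g_low[of m p] by (auto simp: f_def)
    show "\<bar>f m p - f m q\<bar> \<le> real m * dist p q" for m p q
      using g_lip[of m p q] g_lip[of m q p] mult_nonneg_nonneg[of "real m" "dist p q"]
      by (auto simp: f_def min_def dist_commute)
    show le: "f m p \<le> \<zeta> p" if "p \<in> S" for m p
      using g_le[OF that, of m p] by (simp add: f_def)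
    show "(\<lambda>m. f m p) \<longlonglongrightarrow> \<zeta> p" if p: "p \<in> S" for p
    proof (rule LIMSEQ_I)
      fix \<epsilon> :: real assume \<epsilon>: "0 < \<epsilon>"
      obtain r where r: "0 < r" "\<And>q. q \<in> S \<Longrightarrow> dist q p < r \<Longrightarrow> dist (\<zeta> q) (\<zeta> p) < \<epsilon> / 2"
        using cont p \<epsilon> unfolding continuous_on_iff by (meson half_gt_zero)
      obtain m0 :: nat where m0: "2 / r < real m0" using reals_Archimedean2 by blast
      show "\<exists>m0. \<forall>m\<ge>m0. norm (f m p - \<zeta> p) < \<epsilon>"
      proof (intro exI[of _ m0] allI impI)
        fix m assume m: "m0 \<le> m"
        have mr: "2 \<le> real m * r"
        proof -
          have "2 < real m0 * r" using m0 r(1) by (simp add: pos_divide_less_eq)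
          also have "\<dots> \<le> real m * r" using m r(1) by (intro mult_right_mono) auto
          finally show ?thesis by simp
        qed
        have "\<zeta> p - \<epsilon> / 2 \<le> \<zeta> q + real m * dist p q" if q: "q \<in> S" for q
        proof (cases "dist q p < r")
          case True
          then have "\<zeta> p - \<epsilon> / 2 \<le> \<zeta> q" using r(2)[OF q] unfolding dist_real_def by linarith
          moreover have "0 \<le> real m * dist p q" by simp
          ultimately show ?thesis by linarith
        next
          case False
          then have "real m * r \<le> real m * dist p q" by (intro mult_left_mono) (auto simp: dist_commute)
          then show ?thesis using mr bd[OF q] bd[OF p] \<epsilon> by linarith
        qed
        then have "\<zeta> p - \<epsilon> / 2 \<le> g m p" unfolding g_def using S by (intro cINF_greatest) auto
        then have "\<zeta> p - \<epsilon> / 2 \<le> f m p" using bd[OF p] \<epsilon> by (simp add: f_def)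
        then show "norm (f m p - \<zeta> p) < \<epsilon>" using le[OF p, of m] \<epsilon> by simp
      qed
    qed
  qed
qed

text \<open>As \<open>f\<close> may leave \<open>S\<close> on a null set, it need not be measurable
  into the subspace. Sending this null set to \<open>p0\<close> does not change the image measure,
  which only depends on probabilities of preimages.\<close>

lemma integral_distr_restrict_space:
  fixes f :: "'w \<Rightarrow> 's::topological_space" and \<zeta> :: "'s \<Rightarrow> real"
  assumes f: "f \<in> borel_measurable M" and S: "S \<in> sets borel" "p0 \<in> S" and ae: "AE \<omega> in M. f \<omega> \<in> S"
    and \<zeta>: "\<zeta> \<in> borel_measurable (restrict_space borel S)"
  shows "integral\<^sup>L (distr M (restrict_space borel S) f) \<zeta> = (\<integral>\<omega>. indicator S (f \<omega>) * \<zeta> (f \<omega>) \<partial>M)"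
proof -
  let ?R = "restrict_space borel S"
  define f' where "f' \<omega> = (if f \<omega> \<in> S then f \<omega> else p0)" for \<omega>
  note [measurable] = f S(1)
  have f'b: "f' \<in> borel_measurable M" unfolding f'_def by measurable
  have f'm: "f' \<in> measurable M ?R"
    using f'b S(2) by (intro measurable_restrict_space2) (auto simp: f'_def)
  have eq: "emeasure M (f -` A \<inter> space M) = emeasure M (f' -` A \<inter> space M)" if "A \<in> sets ?R" for A
  proof -
    have A: "A \<in> sets borel" using that S(1) by (auto simp: sets_restrict_space)
    have "AE \<omega> in M. \<omega> \<in> f -` A \<inter> space M \<longleftrightarrow> \<omega> \<in> f' -` A \<inter> space M"
      using ae by eventually_elim (simp add: f'_def)
    then show ?thesis by (rule emeasure_eq_AE[OF _ measurable_sets[OF f A] measurable_sets[OF f'b A]])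
  qed
  have sig: "sigma_sets (space ?R) (sets ?R) = sets ?R" by (rule sets.sigma_sets_eq)
  have "distr M ?R f = distr M ?R f'"
    unfolding distr_def using eq sig by (intro measure_of_eq sets.space_closed) auto
  then have "integral\<^sup>L (distr M ?R f) \<zeta> = (\<integral>\<omega>. \<zeta> (f' \<omega>) \<partial>M)"
    using integral_distr[OF f'm \<zeta>] by simp
  also have "\<dots> = (\<integral>\<omega>. indicator S (f \<omega>) * \<zeta> (f \<omega>) \<partial>M)"
  proof (rule integral_cong_AE)
    show "(\<lambda>\<omega>. \<zeta> (f' \<omega>)) \<in> borel_measurable M" by (rule measurable_compose[OF f'm \<zeta>])
    have "(\<lambda>x. indicator S x *\<^sub>R \<zeta> x) \<in> borel_measurable borel"
      using \<zeta> S(1) by (subst (asm) borel_measurable_restrict_space_iff) auto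
    from measurable_compose[OF f this] show "(\<lambda>\<omega>. indicator S (f \<omega>) * \<zeta> (f \<omega>)) \<in> borel_measurable M" by simp
    show "AE \<omega> in M. \<zeta> (f' \<omega>) = indicator S (f \<omega>) * \<zeta> (f \<omega>)"
      using ae by eventually_elim (simp add: f'_def)
  qed
  finally show ?thesis .
qed

text \<open>The preimages differ by a subset of a null set, measurable by completeness. It serves
  test functions that are arbitrary off the state space.\<close>

lemma (in complete_measure) measurable_AE_eq:
  assumes g: "g \<in> measurable M N" and ae: "AE \<omega> in M. f \<omega> = g \<omega>" and sp: "\<And>\<omega>. \<omega> \<in> space M \<Longrightarrow> f \<omega> \<in> space N"
  shows "f \<in> measurable M N"
proof (rule measurableI[OF sp])
  fix A assume A: "A \<in> sets N"
  obtain Z where Z: "Z \<in> null_sets M" "{\<omega> \<in> space M. f \<omega> \<noteq> g \<omega>} \<subseteq> Z"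
    using ae by (auto simp: eventually_ae_filter)
  have "f -` A \<inter> space M = (g -` A \<inter> space M - Z) \<union> (f -` A \<inter> space M \<inter> Z)"
    using Z(2) by auto
  moreover have "f -` A \<inter> space M \<inter> Z \<in> sets M"
    using Z(1) by (intro complete[of _ Z]) auto
  ultimately show "f -` A \<inter> space M \<in> sets M"
    using measurable_sets[OF g A] Z(1) by (metis sets.Diff sets.Un null_setsD2)
qed

context rbm_euler
begin

lemma state_space_iff: "(x, y) \<in> state_space n \<longleftrightarrow> (\<forall>i. 0 \<le> x \<bullet> n i) \<and> (\<forall>i. x \<bullet> n i = 0 \<longrightarrow> y \<bullet> n i = 0)"
  using active_eq[of x] by (auto simp: state_space_def face_space_def polycone_def)

lemma state_space_borel: "state_space n \<in> sets borel"
proof -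
  have "state_space n = {p \<in> space borel. (\<forall>i. 0 \<le> fst p \<bullet> n i) \<and> (\<forall>i. fst p \<bullet> n i = 0 \<longrightarrow> snd p \<bullet> n i = 0)}"
    using state_space_iff by auto
  also have "\<dots> \<in> sets borel"
  proof -
    have [measurable]: "fst \<in> borel_measurable (borel :: ((real^'n) \<times> (real^'n)) measure)"
      "snd \<in> borel_measurable (borel :: ((real^'n) \<times> (real^'n)) measure)"
      by (auto intro!: borel_measurable_continuous_onI continuous_intros)
    show ?thesis by measurable
  qed
  finally show ?thesis .
qed

lemma joint_solution_state_space:
  assumes "joint_solution Z D" "0 \<le> t"
  shows "AE \<omega> in M. (Z t \<omega>, D t \<omega>) \<in> state_space n"
proof -
  obtain Y where "AE \<omega> in M. path_sol (\<lambda>t. W t \<omega>) (\<lambda>t. Z t \<omega>) (\<lambda>t. Y t \<omega>) (\<lambda>t. D t \<omega>)"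
    using assms(1) by (auto simp: joint_solution_def)
  then show ?thesis
  proof eventually_elim
    case (elim \<omega>)
    show ?case unfolding state_space_iff using path_solD(5,7)[OF elim assms(2)] by auto
  qed
qed

lemma extend_test_function:
  assumes "\<zeta> \<in> borel_measurable (restrict_space borel (state_space n))"
  shows "(\<lambda>x. indicator (state_space n) x * \<zeta> x :: real) \<in> borel_measurable borel"
  using assms state_space_borel by (subst (asm) borel_measurable_restrict_space_iff) auto

text \<open>Setting the test function to 0 off the state space makes it Borel and changes its value
  at the process on a null set only, so both conditional expectations are unaffected.\<close>

lemma joint_solution_markov_property:
  assumes J: "joint_solution Z D"
  shows "markov_property M F (state_space n) (\<lambda>t \<omega>. (Z t \<omega>, D t \<omega>))"
  unfolding markov_property_def
proof (intro allI impI, elim conjE)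
  fix \<zeta> :: "(real^'n) \<times> (real^'n) \<Rightarrow> real" and s t :: real
  assume \<zeta>: "\<zeta> \<in> borel_measurable (restrict_space borel (state_space n))" "bounded (\<zeta> ` state_space n)"
    and st: "0 < s" "0 < t"
  let ?\<zeta> = "\<lambda>x. indicator (state_space n) x * \<zeta> x"
  let ?\<Xi> = "\<lambda>t \<omega>. (Z t \<omega>, D t \<omega>)"
  let ?V = "vimage_algebra (space M) (?\<Xi> s) borel"
  obtain c where c: "\<And>x. x \<in> state_space n \<Longrightarrow> \<bar>\<zeta> x\<bar> \<le> c" using \<zeta>(2) by (auto simp: bounded_iff)
  have c': "\<bar>?\<zeta> x\<bar> \<le> \<bar>c\<bar>" for x using c[of x] by (auto simp: indicator_def)
  have m: "(\<lambda>\<omega>. ?\<zeta> (?\<Xi> (s + t) \<omega>)) \<in> borel_measurable M"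
    using st by (intro measurable_compose[OF joint_solution_measurable(2)[OF J] extend_test_function[OF \<zeta>(1)]]) auto
  have ae: "AE \<omega> in M. \<zeta> (?\<Xi> (s + t) \<omega>) = ?\<zeta> (?\<Xi> (s + t) \<omega>)"
    using joint_solution_state_space[OF J, of "s + t"] st by auto
  have "complete_measure M" using usual by (simp add: usual_conditions_def)
  then have m': "(\<lambda>\<omega>. \<zeta> (?\<Xi> (s + t) \<omega>)) \<in> borel_measurable M"
    by (rule complete_measure.measurable_AE_eq[OF _ m ae]) simp
  have subF: "subalgebra M (F s)" using st by (intro F_sub) simp
  have subV: "subalgebra M ?V"
    unfolding subalgebra_def
  proof (intro conjI subsetI)
    fix A assume "A \<in> sets ?V"
    then obtain A' where "A = ?\<Xi> s -` A' \<inter> space M" "A' \<in> sets borel" by (auto simp: sets_vimage_algebra2)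
    then show "A \<in> events" using measurable_sets[OF joint_solution_measurable(2)[OF J]] st by simp
  qed simp
  interpret V: finite_measure_subalgebra M ?V by (standard, rule subV)
  interpret FS: finite_measure_subalgebra M "F s" by (standard, rule subF)
  have "AE \<omega> in M. real_cond_exp M (F s) (\<lambda>\<omega>. ?\<zeta> (?\<Xi> (s + t) \<omega>)) \<omega> = real_cond_exp M ?V (\<lambda>\<omega>. ?\<zeta> (?\<Xi> (s + t) \<omega>)) \<omega>"
    using st by (intro joint_solution_markov[OF J _ _ extend_test_function[OF \<zeta>(1)] c']) auto
  then show "AE \<omega> in M. real_cond_exp M (F s) (\<lambda>\<omega>. \<zeta> (?\<Xi> (s + t) \<omega>)) \<omega> = real_cond_exp M ?V (\<lambda>\<omega>. \<zeta> (?\<Xi> (s + t) \<omega>)) \<omega>"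
    using V.real_cond_exp_cong[OF ae m' m] FS.real_cond_exp_cong[OF ae m' m]
    by eventually_elim simp
qed

text \<open>Minorants yield lower semicontinuity in the starting point; applied to \<zeta> and to
  its negative this is continuity.\<close>

lemma joint_solution_feller_continuous:
  assumes J: "\<And>x y. (x, y) \<in> state_space n \<Longrightarrow> joint_solution (Z x) (D (x, y)) \<and>
    (AE \<omega> in M. Z x 0 \<omega> = x) \<and> (AE \<omega> in M. D (x, y) 0 \<omega> = y)"
  shows "feller_continuous (state_space n) (transition M (state_space n) (\<lambda>(x, y) t \<omega>. (Z x t \<omega>, D (x, y) t \<omega>)))"
proof -
  let ?S = "state_space n"
  define \<Xi> where "\<Xi> = (\<lambda>(x, y) t \<omega>. (Z x t \<omega>, D (x, y) t \<omega>))"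
  have S0: "0 \<in> ?S" using state_space_iff[of 0 0] by (simp add: zero_prod_def)
  have \<Xi>M: "\<Xi> \<xi> t \<in> borel_measurable M" "AE \<omega> in M. \<Xi> \<xi> t \<omega> \<in> ?S" if "\<xi> \<in> ?S" "0 \<le> t" for \<xi> t
    using that J joint_solution_measurable(2)[of "Z (fst \<xi>)" "D \<xi>" t] joint_solution_state_space[of "Z (fst \<xi>)" "D \<xi>" t]
    by (cases \<xi>; simp add: \<Xi>_def)+
  have lip: "(\<lambda>k. \<integral>\<omega>. f (\<Xi> (\<xi>k k) t \<omega>) \<partial>M) \<longlonglongrightarrow> (\<integral>\<omega>. f (\<Xi> \<xi> t \<omega>) \<partial>M)"
    if \<xi>: "\<xi> \<in> ?S" "\<And>k. \<xi>k k \<in> ?S" "\<xi>k \<longlonglongrightarrow> \<xi>" and t: "0 < t"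
      and f: "\<And>p. \<bar>f p\<bar> \<le> 1" "0 \<le> L" "\<And>p q. \<bar>f p - f q\<bar> \<le> L * dist p q"
    for \<xi>k \<xi> and t :: real and f :: "(real^'n) \<times> (real^'n) \<Rightarrow> real" and L
  proof -
    obtain x y where xy: "\<xi> = (x, y)" by (cases \<xi>)
    have k: "\<xi>k k = (fst (\<xi>k k), snd (\<xi>k k))" for k by simp
    have J0: "joint_solution (Z x) (D (x, y))" "AE \<omega> in M. Z x 0 \<omega> = x" "AE \<omega> in M. D (x, y) 0 \<omega> = y"
      using J \<xi>(1) xy by auto
    have Jk: "joint_solution (Z (fst (\<xi>k k))) (D (\<xi>k k))" "AE \<omega> in M. Z (fst (\<xi>k k)) 0 \<omega> = fst (\<xi>k k)"
      "AE \<omega> in M. D (\<xi>k k) 0 \<omega> = snd (\<xi>k k)" for k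
      using J[of "fst (\<xi>k k)" "snd (\<xi>k k)"] \<xi>(2)[of k] by auto
    have lim: "(\<lambda>k. fst (\<xi>k k)) \<longlonglongrightarrow> x" "(\<lambda>k. snd (\<xi>k k)) \<longlonglongrightarrow> y"
      using tendsto_fst[OF \<xi>(3)] tendsto_snd[OF \<xi>(3)] by (auto simp: xy)
    have "L-lipschitz_on UNIV f" using f by (intro lipschitz_onI) (auto simp: dist_real_def)
    then have fm: "f \<in> borel_measurable borel"
      by (intro borel_measurable_continuous_onI lipschitz_on_continuous_on)
    have "(\<lambda>k. \<integral>\<omega>. f (Z (fst (\<xi>k k)) t \<omega>, D (\<xi>k k) t \<omega>) \<partial>M) \<longlonglongrightarrow> (\<integral>\<omega>. f (Z x t \<omega>, D (x, y) t \<omega>) \<partial>M)"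
    proof (rule feller_lipschitz[OF J0 Jk _ _ lim t fm f(1,2)])
      show "0 \<le> x \<bullet> n i" "x \<bullet> n i = 0 \<Longrightarrow> y \<bullet> n i = 0" for i
        using \<xi>(1) unfolding xy state_space_iff by auto
      show "\<bar>f p - f q\<bar> \<le> L * norm (p - q)" for p q using f(3)[of p q] by (simp add: dist_norm)
    qed
    then show ?thesis by (simp add: \<Xi>_def case_prod_beta xy)
  qed
  \<comment> \<open>One fixed minorant already has expectation within \<epsilon> at the limit point;
    its expectations converge, and it stays below \<zeta> for the other starting points.\<close>
  have lower: "\<exists>k0. \<forall>k\<ge>k0. (\<integral>\<omega>. indicator ?S (\<Xi> \<xi> t \<omega>) * \<zeta> (\<Xi> \<xi> t \<omega>) \<partial>M) - \<epsilon> < (\<integral>\<omega>. indicator ?S (\<Xi> (\<xi>k k) t \<omega>) * \<zeta> (\<Xi> (\<xi>k k) t \<omega>) \<partial>M)"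
    if \<xi>: "\<xi> \<in> ?S" "\<And>k. \<xi>k k \<in> ?S" "\<xi>k \<longlonglongrightarrow> \<xi>" and t: "0 < t" and \<epsilon>: "0 < \<epsilon>"
      and \<zeta>: "continuous_on ?S \<zeta>" "\<And>p. p \<in> ?S \<Longrightarrow> \<bar>\<zeta> p\<bar> \<le> 1"
    for \<xi>k \<xi> and t \<epsilon> :: real and \<zeta> :: "(real^'n) \<times> (real^'n) \<Rightarrow> real"
  proof -
    have t0: "0 \<le> t" using t by simp
    have Sne: "?S \<noteq> {}" using S0 by auto
    have zm: "(\<lambda>x. indicator ?S x * \<zeta> x) \<in> borel_measurable borel"
      using \<zeta>(1) by (intro extend_test_function borel_measurable_continuous_on_restrict)
    have z1: "\<bar>indicator ?S x * \<zeta> x\<bar> \<le> 1" for x using \<zeta>(2)[of x] by (auto simp: indicator_def)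
    obtain f where f: "\<And>m p. \<bar>f m p\<bar> \<le> 1" "\<And>m p q. \<bar>f m p - f m q\<bar> \<le> real m * dist p q"
      "\<And>m p. p \<in> ?S \<Longrightarrow> f m p \<le> \<zeta> p" "\<And>p. p \<in> ?S \<Longrightarrow> (\<lambda>m. f m p) \<longlonglongrightarrow> \<zeta> p"
      using lipschitz_minorants[OF Sne \<zeta>] by blast
    have fm: "f m \<in> borel_measurable borel" for m
    proof -
      have "(real m)-lipschitz_on UNIV (f m)" using f(2) by (intro lipschitz_onI) (auto simp: dist_real_def)
      then show ?thesis by (intro borel_measurable_continuous_onI lipschitz_on_continuous_on)
    qed
    have "(\<lambda>m. \<integral>\<omega>. f m (\<Xi> \<xi> t \<omega>) \<partial>M) \<longlonglongrightarrow> (\<integral>\<omega>. indicator ?S (\<Xi> \<xi> t \<omega>) * \<zeta> (\<Xi> \<xi> t \<omega>) \<partial>M)"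
    proof (rule integral_dominated_convergence[where w = "\<lambda>_. 1"])
      show "(\<lambda>\<omega>. indicator ?S (\<Xi> \<xi> t \<omega>) * \<zeta> (\<Xi> \<xi> t \<omega>)) \<in> borel_measurable M"
        by (rule measurable_compose[OF \<Xi>M(1)[OF \<xi>(1) t0] zm])
      show "(\<lambda>\<omega>. f m (\<Xi> \<xi> t \<omega>)) \<in> borel_measurable M" for m
        by (rule measurable_compose[OF \<Xi>M(1)[OF \<xi>(1) t0] fm])
      show "AE \<omega> in M. (\<lambda>m. f m (\<Xi> \<xi> t \<omega>)) \<longlonglongrightarrow> indicator ?S (\<Xi> \<xi> t \<omega>) * \<zeta> (\<Xi> \<xi> t \<omega>)"
        using \<Xi>M(2)[OF \<xi>(1) t0] by eventually_elim (simp add: f(4))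
    qed (use f(1) in auto)
    then have "\<forall>\<^sub>F m in sequentially. (\<integral>\<omega>. indicator ?S (\<Xi> \<xi> t \<omega>) * \<zeta> (\<Xi> \<xi> t \<omega>) \<partial>M) - \<epsilon> < (\<integral>\<omega>. f m (\<Xi> \<xi> t \<omega>) \<partial>M)"
      using \<epsilon> by (intro order_tendstoD(1)) auto
    then obtain m where m: "(\<integral>\<omega>. indicator ?S (\<Xi> \<xi> t \<omega>) * \<zeta> (\<Xi> \<xi> t \<omega>) \<partial>M) - \<epsilon> < (\<integral>\<omega>. f m (\<Xi> \<xi> t \<omega>) \<partial>M)"
      by (auto simp: eventually_sequentially)
    have "\<forall>\<^sub>F k in sequentially. (\<integral>\<omega>. indicator ?S (\<Xi> \<xi> t \<omega>) * \<zeta> (\<Xi> \<xi> t \<omega>) \<partial>M) - \<epsilon> < (\<integral>\<omega>. f m (\<Xi> (\<xi>k k) t \<omega>) \<partial>M)"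
      using lip[OF \<xi> t f(1) _ f(2), of m] by (rule order_tendstoD(1)) (use m in auto)
    moreover have "(\<integral>\<omega>. f m (\<Xi> (\<xi>k k) t \<omega>) \<partial>M) \<le> (\<integral>\<omega>. indicator ?S (\<Xi> (\<xi>k k) t \<omega>) * \<zeta> (\<Xi> (\<xi>k k) t \<omega>) \<partial>M)" for k
    proof (rule integral_mono_AE)
      note mk = \<Xi>M(1)[OF \<xi>(2)[of k] t0]
      show "integrable M (\<lambda>\<omega>. f m (\<Xi> (\<xi>k k) t \<omega>))"
        by (rule abs_expectation_le(1)[OF measurable_compose[OF mk fm] f(1)])
      show "integrable M (\<lambda>\<omega>. indicator ?S (\<Xi> (\<xi>k k) t \<omega>) * \<zeta> (\<Xi> (\<xi>k k) t \<omega>))"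
        by (rule abs_expectation_le(1)[OF measurable_compose[OF mk zm] z1])
      show "AE \<omega> in M. f m (\<Xi> (\<xi>k k) t \<omega>) \<le> indicator ?S (\<Xi> (\<xi>k k) t \<omega>) * \<zeta> (\<Xi> (\<xi>k k) t \<omega>)"
        using \<Xi>M(2)[OF \<xi>(2)[of k] t0] by eventually_elim (simp add: f(3))
    qed
    ultimately show ?thesis unfolding eventually_sequentially using less_le_trans by blast
  qed
  show ?thesis
    unfolding feller_continuous_def \<Xi>_def[symmetric]
  proof (intro allI impI, elim conjE)
    fix \<zeta> :: "(real^'n) \<times> (real^'n) \<Rightarrow> real" and t :: real
    assume \<zeta>: "continuous_on ?S \<zeta>" "bounded (\<zeta> ` ?S)" and t: "0 < t"
    have t0: "0 \<le> t" using t by simp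
    let ?I = "\<lambda>\<xi>. \<integral>\<omega>. indicator ?S (\<Xi> \<xi> t \<omega>) * \<zeta> (\<Xi> \<xi> t \<omega>) \<partial>M"
    have tr: "integral\<^sup>L (transition M ?S \<Xi> t \<xi>) \<zeta> = ?I \<xi>" if "\<xi> \<in> ?S" for \<xi>
      unfolding transition_def using \<zeta>(1)
      by (intro integral_distr_restrict_space[OF \<Xi>M(1)[OF that t0] state_space_borel S0 \<Xi>M(2)[OF that t0]]
          borel_measurable_continuous_on_restrict)
    obtain c where c: "0 < c" "\<And>p. p \<in> ?S \<Longrightarrow> \<bar>\<zeta> p\<bar> \<le> c"
      using \<zeta>(2) by (auto simp: bounded_pos)
    have "continuous_on ?S ?I"
      unfolding continuous_on_sequentially
    proof (intro allI ballI impI, elim conjE)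
      fix \<xi>k \<xi> assume \<xi>: "\<xi> \<in> ?S" "\<forall>k. \<xi>k k \<in> ?S" "\<xi>k \<longlonglongrightarrow> \<xi>"
      have sc: "(\<integral>\<omega>. indicator ?S (\<Xi> \<xi> t \<omega>) * (r * \<zeta> (\<Xi> \<xi> t \<omega>)) \<partial>M) = r * ?I \<xi>" for r \<xi>
        by (subst integral_mult_right_zero[symmetric]) (simp add: mult_ac)
      show "(?I \<circ> \<xi>k) \<longlonglongrightarrow> ?I \<xi>"
      proof (rule LIMSEQ_I)
        fix \<epsilon> :: real assume \<epsilon>: "0 < \<epsilon>"
        then have \<epsilon>c: "0 < \<epsilon> / c" using c by simp
        \<comment> \<open>Scaling by the bound of \<zeta> gives values in the unit interval around
          0; the two signs of \<open>r\<close> give the two halves of continuity.\<close>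
        have bd: "\<bar>r * \<zeta> p\<bar> \<le> 1" if "p \<in> ?S" "\<bar>r\<bar> = 1 / c" for p r
          using c(2)[OF that(1)] c(1) that(2) by (simp add: abs_mult)
        have cont: "continuous_on ?S (\<lambda>p. r * \<zeta> p)" for r by (intro continuous_intros \<zeta>(1))
        obtain k1 where k1: "\<And>k. k1 \<le> k \<Longrightarrow> (1 / c) * ?I \<xi> - \<epsilon> / c < (1 / c) * ?I (\<xi>k k)"
          using lower[OF \<xi>(1) spec[OF \<xi>(2)] \<xi>(3) t \<epsilon>c cont[of "1 / c"]] bd[of _ "1 / c"] c(1) unfolding sc by auto
        obtain k2 where k2: "\<And>k. k2 \<le> k \<Longrightarrow> (- 1 / c) * ?I \<xi> - \<epsilon> / c < (- 1 / c) * ?I (\<xi>k k)"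
          using lower[OF \<xi>(1) spec[OF \<xi>(2)] \<xi>(3) t \<epsilon>c cont[of "- 1 / c"]] bd[of _ "- 1 / c"] c(1) unfolding sc by auto
        show "\<exists>k0. \<forall>k\<ge>k0. norm ((?I \<circ> \<xi>k) k - ?I \<xi>) < \<epsilon>"
        proof (intro exI[of _ "max k1 k2"] allI impI)
          fix k assume "max k1 k2 \<le> k"
          then have "(1 / c) * ?I \<xi> - \<epsilon> / c < (1 / c) * ?I (\<xi>k k)" "(- 1 / c) * ?I \<xi> - \<epsilon> / c < (- 1 / c) * ?I (\<xi>k k)"
            using k1 k2 by auto
          moreover have "\<bar>B - A\<bar> < \<epsilon>" if "(1 / c) * A - \<epsilon> / c < (1 / c) * B" "(- 1 / c) * A - \<epsilon> / c < (- 1 / c) * B"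
            for A B
          proof -
            have "(A - \<epsilon>) / c < B / c" "(B - \<epsilon>) / c < A / c"
              using that by (simp_all add: diff_divide_distrib)
            then show ?thesis using c(1) by (simp add: divide_less_cancel abs_less_iff)
          qed
          ultimately show "norm ((?I \<circ> \<xi>k) k - ?I \<xi>) < \<epsilon>" by simp
        qed
      qed
    qed
    then show "continuous_on ?S (\<lambda>\<xi>. integral\<^sup>L (transition M ?S \<Xi> t \<xi>) \<zeta>)"
      using tr by (simp cong: continuous_on_cong)
  qed
qed


section \<open>From joint processes to pathwise solutions\<close>

lemma refl_cone_eq:
  assumes "x \<in> polycone n"
  shows "refl_cone n \<delta> \<alpha> x = convex_cone hull ((\<lambda>i. \<delta> i \<alpha>) ` {i. x \<bullet> n i = 0})"
  unfolding refl_cone_def active_eq[OF assms] ..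

text \<open>Here \<delta> is the parametrised family of directions and \<open>d\<close> its value at
  \<alpha>. The finitely many almost sure properties hold simultaneously off one null set, and
  \<open>K\<close> is eliminated by the equation for \<open>D\<close>.\<close>

lemma joint_process_joint_solution:
  assumes J: "joint_process M F W n \<delta> a b \<alpha> Z D"
    and coeff: "d = (\<lambda>i. \<delta> i \<alpha>)" "b0 = b \<alpha>" "b1 = vector_derivative b (at \<alpha>)" "\<sigma> = pd_sqrt (a \<alpha>)"
      "\<sigma>1 = vector_derivative (\<lambda>u. pd_sqrt (a u)) (at \<alpha>)"
      "Q = vector_derivative (refl_matrix \<delta>) (at \<alpha>) ** matrix_inv (refl_matrix \<delta> \<alpha>)"
  shows "joint_solution Z D"
proof -
  obtain Y where Z: "reflected_bm M F W n \<delta> a b \<alpha> Z Y" and D: "derivative_process M F W n \<delta> a b \<alpha> Z Y D"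
    using J by (auto simp: joint_process_def)
  have Z1: "adapted F Z" "AE \<omega> in M. continuous_on {0..} (\<lambda>t. Z t \<omega>)"
    "AE \<omega> in M. \<forall>t\<ge>0. Z t \<omega> \<in> polycone n \<and> Z t \<omega> = Z 0 \<omega> + t *\<^sub>R b0 + \<sigma> *v W t \<omega> + Y t \<omega>"
    "AE \<omega> in M. \<forall>s\<ge>0. \<forall>t>s. Y t \<omega> - Y s \<omega> \<in> convex_cone hull (\<Union>u\<in>{s<..t}. refl_cone n \<delta> \<alpha> (Z u \<omega>))"
    using Z unfolding reflected_bm_def coeff by - (elim conjE, assumption)+
  obtain K where D1: "adapted F D" "AE \<omega> in M. rcll (\<lambda>t. D t \<omega>)"
    "AE \<omega> in M. \<forall>t\<ge>0. D t \<omega> \<in> face_space n (Z t \<omega>) \<and>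
      D t \<omega> = D 0 \<omega> + t *\<^sub>R b1 + \<sigma>1 *v W t \<omega> + Q *v Y t \<omega> + K t \<omega>"
    "AE \<omega> in M. \<forall>s\<ge>0. \<forall>t>s. K t \<omega> - K s \<omega> \<in> span (\<Union>u\<in>{s<..t}. refl_cone n \<delta> \<alpha> (Z u \<omega>))"
    using D unfolding derivative_process_def coeff matrix_vector_mul_assoc by (elim conjE exE)
  have W: "AE \<omega> in M. continuous_on {0..} (\<lambda>t. W t \<omega>)"
    using bm by (simp add: brownian_motion_def)
  have "AE \<omega> in M. path_sol (\<lambda>t. W t \<omega>) (\<lambda>t. Z t \<omega>) (\<lambda>t. Y t \<omega>) (\<lambda>t. D t \<omega>)"
    using W Z1(2-4) D1(2-4)
  proof eventually_elim
    case (elim \<omega>)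
    have in_cone: "Z t \<omega> \<in> polycone n" if "0 \<le> t" for t
      using elim(3)[rule_format, OF that] by (rule conjunct1)
    have Zt: "Z t \<omega> = Z 0 \<omega> + t *\<^sub>R b0 + \<sigma> *v W t \<omega> + Y t \<omega>" if "0 \<le> t" for t using elim(3)[rule_format, OF that] by (rule conjunct2)
    have Dt: "D t \<omega> = D 0 \<omega> + t *\<^sub>R b1 + \<sigma>1 *v W t \<omega> + Q *v Y t \<omega> + K t \<omega>" if "0 \<le> t" for t
      using elim(6)[rule_format, OF that] by (rule conjunct2)
    \<comment> \<open>A single inclusion serves both pushes: cones and spans of the union are
      contained in those generated by the directions of the faces hit.\<close>
    have sub: "(\<Union>u\<in>{s<..t}. refl_cone n \<delta> \<alpha> (Z u \<omega>)) \<subseteq> convex_cone hull (d ` hits (\<lambda>t. Z t \<omega>) s t)"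
      if "0 \<le> s" for s t
    proof (rule UN_least)
      fix u assume u: "u \<in> {s<..t}"
      then have "{i. Z u \<omega> \<bullet> n i = 0} \<subseteq> hits (\<lambda>t. Z t \<omega>) s t" by (auto simp: hits_def)
      then show "refl_cone n \<delta> \<alpha> (Z u \<omega>) \<subseteq> convex_cone hull (d ` hits (\<lambda>t. Z t \<omega>) s t)"
        unfolding coeff(1) using refl_cone_eq[OF in_cone, of u \<delta> \<alpha>] u that
        by (simp add: hull_mono image_mono)
    qed
    show ?case
      unfolding path_sol_def skorokhod_sol_def
    proof (intro conjI allI ballI impI elim(1))
      show "continuous_on {0..e} (\<lambda>t. Z t \<omega>)" for e
        using elim(2) by (rule continuous_on_subset) auto
      show "0 \<le> Z t \<omega> \<bullet> n i" if "t \<in> {0..e}" for e t i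
        using in_cone[of t] that by (simp add: polycone_def)
      show "Y t \<omega> - Y s \<omega> \<in> convex_cone hull (d ` hits (\<lambda>t. Z t \<omega>) s t)" if "0 \<le> s" "s < t" for s t
      proof -
        have "Y t \<omega> - Y s \<omega> \<in> convex_cone hull (\<Union>u\<in>{s<..t}. refl_cone n \<delta> \<alpha> (Z u \<omega>))"
          using elim(4) that by simp
        also have "\<dots> \<subseteq> convex_cone hull (d ` hits (\<lambda>t. Z t \<omega>) s t)"
          by (intro hull_minimal sub that convex_cone_convex_cone_hull)
        finally show ?thesis .
      qed
      show "(Z t \<omega> - Y t \<omega>) - (Z s \<omega> - Y s \<omega>) = (t - s) *\<^sub>R b0 + \<sigma> *v (W t \<omega> - W s \<omega>)" if "0 \<le> s" "0 \<le> t" for s t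
        using Zt[OF that(1)] Zt[OF that(2)] by (simp add: algebra_simps)
      show "((\<lambda>t. D t \<omega>) \<longlongrightarrow> D t \<omega>) (at_right t)" if "0 \<le> t" for t
        using elim(5) that by (simp add: rcll_def)
      show "D t \<omega> \<bullet> n i = 0" if "0 \<le> t" "Z t \<omega> \<bullet> n i = 0" for t i
      proof -
        have "D t \<omega> \<in> face_space n (Z t \<omega>)" using elim(6)[rule_format, OF that(1)] by (rule conjunct1)
        then show ?thesis using that active_eq[OF in_cone[OF that(1)]] by (simp add: face_space_def)
      qed
      show "(D t \<omega> - driver (\<lambda>t. W t \<omega>) (\<lambda>t. Y t \<omega>) t) - (D s \<omega> - driver (\<lambda>t. W t \<omega>) (\<lambda>t. Y t \<omega>) s)
        \<in> span (d ` hits (\<lambda>t. Z t \<omega>) s t)" if "0 \<le> s" "s < t" for s t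
      proof -
        have "K t \<omega> - K s \<omega> \<in> span (\<Union>u\<in>{s<..t}. refl_cone n \<delta> \<alpha> (Z u \<omega>))" using elim(7) that by simp
        also have "\<dots> \<subseteq> span (d ` hits (\<lambda>t. Z t \<omega>) s t)"
          by (intro span_minimal subspace_span order.trans[OF sub[OF that(1)]] hull_minimal span_superset convex_cone_span)
        finally have "K t \<omega> - K s \<omega> \<in> span (d ` hits (\<lambda>t. Z t \<omega>) s t)" .
        moreover have "0 \<le> t" using that by simp
        ultimately show ?thesis using Dt[of t] Dt[of s] that by (simp add: driver_def algebra_simps)
      qed
    qed
  qed
  then show ?thesis unfolding joint_solution_def by (intro conjI exI Z1(1) D1(1))
qed

end

section \<open>Instantiation at a fixed parameter\<close>

theorem theorem3p2:
  fixes n :: "'n::finite \<Rightarrow> real^'n"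
    and U :: "real set"
    and d :: "'n \<Rightarrow> real \<Rightarrow> real^'n"
    and a :: "real \<Rightarrow> real^'n^'n"
    and b :: "real \<Rightarrow> real^'n"
    and M :: "'w measure"
    and F :: "real \<Rightarrow> 'w measure"
    and W :: "real \<Rightarrow> 'w \<Rightarrow> real^'n"
    and \<alpha> :: real
    and Z :: "real^'n \<Rightarrow> real \<Rightarrow> 'w \<Rightarrow> real^'n"
    and D :: "(real^'n) \<times> (real^'n) \<Rightarrow> real \<Rightarrow> 'w \<Rightarrow> real^'n"
  assumes "rbm_data n U d a b"
    and "linear_independence_condition U d"
    and "set_B_condition n U d"
    and "projection_condition n U d"
    and "hoelder_condition U d a b"
    and "prob_space M"
    and "usual_conditions M F"
    and "brownian_motion M F W"
    and "\<alpha> \<in> U"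
    and "\<forall>(x, y)\<in>state_space n.
           joint_process M F W n d a b \<alpha> (Z x) (D (x, y)) \<and>
           (AE \<omega> in M. Z x 0 \<omega> = x) \<and> (AE \<omega> in M. D (x, y) 0 \<omega> = y)"
  shows "(\<forall>Z' D'. joint_process M F W n d a b \<alpha> Z' D' \<longrightarrow>
            markov_property M F (state_space n) (\<lambda>t \<omega>. (Z' t \<omega>, D' t \<omega>)))
       \<and> feller_continuous (state_space n)
            (transition M (state_space n) (\<lambda>(x, y) t \<omega>. (Z x t \<omega>, D (x, y) t \<omega>)))"
proof -
  obtain \<theta> :: real and B :: "(real^'n) set" where B: "0 < \<theta>" "compact B" "convex B" "0 \<in> interior B"
    and normal: "\<And>i z \<nu>. z \<in> frontier B \<Longrightarrow> \<bar>z \<bullet> n i\<bar> < \<theta> \<Longrightarrow> norm \<nu> = 1 \<Longrightarrow> (\<forall>y\<in>B. 0 \<le> \<nu> \<bullet> (y - z)) \<Longrightarrow> \<nu> \<bullet> d i \<alpha> = 0"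
    using assms(3) \<open>\<alpha> \<in> U\<close> unfolding set_B_condition_def by metis
  obtain \<pi> where \<pi>: "\<And>x. \<pi> x \<in> polycone n" "\<And>x. x \<in> polycone n \<Longrightarrow> \<pi> x = x"
      "\<And>x. x \<notin> polycone n \<Longrightarrow> \<pi> x - x \<in> refl_cone n d \<alpha> (\<pi> x)"
    using assms(4) \<open>\<alpha> \<in> U\<close> unfolding projection_condition_def by metis
  have data: "norm (n i) = 1" "d i \<alpha> \<bullet> n i = 1" "pos_def_sym (a \<alpha>)" for i
    using assms(1) \<open>\<alpha> \<in> U\<close> by (auto simp: rbm_data_def)
  interpret set_B_data n "\<lambda>i. d i \<alpha>" B \<theta>
  proof
    show "lin_indep_family (\<lambda>i. d i \<alpha>)"
      using assms(2) \<open>\<alpha> \<in> U\<close> by (simp add: linear_independence_condition_def)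
    show "\<nu> \<bullet> d i \<alpha> = 0" if z: "z \<in> frontier B" "\<bar>z \<bullet> n i\<bar> < \<theta>" and \<nu>: "\<And>y. y \<in> B \<Longrightarrow> \<nu> \<bullet> y \<le> \<nu> \<bullet> z" for z i \<nu>
    proof (cases "\<nu> = 0")
      case False
      \<comment> \<open>The set-B condition is phrased with inward unit normals, whence the sign and
        the normalisation.\<close>
      have "(- (1 / norm \<nu>)) *\<^sub>R \<nu> \<bullet> d i \<alpha> = 0"
      proof (rule normal[OF z])
        show "norm (- (1 / norm \<nu>) *\<^sub>R \<nu>) = 1" using False by simp
        show "\<forall>y\<in>B. 0 \<le> (- (1 / norm \<nu>)) *\<^sub>R \<nu> \<bullet> (y - z)"
          using \<nu> False by (auto simp: inner_diff_right divide_right_mono)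
      qed
      then show ?thesis using False by simp
    qed simp
  qed (use B data in auto)
  \<comment> \<open>Merging the two matrices into \<open>Q\<close> is harmless, as the local time is
    the inverse reflection matrix applied to the push.\<close>
  interpret rbm_euler n "\<lambda>i. d i \<alpha>" B \<theta> "b \<alpha>" "vector_derivative b (at \<alpha>)" "pd_sqrt (a \<alpha>)"
    "vector_derivative (\<lambda>u. pd_sqrt (a u)) (at \<alpha>)"
    "vector_derivative (refl_matrix d) (at \<alpha>) ** matrix_inv (refl_matrix d \<alpha>)" \<pi> M F W
  proof (intro rbm_euler.intro euler_data.intro rbm_euler_axioms.intro euler_data_axioms.intro
      set_B_data_axioms assms(6-8) pos_def_sym_pd_sqrt data)
    show "0 \<le> \<pi> x \<bullet> n i" for x i using \<pi>(1)[of x] by (simp add: polycone_def)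
    show "\<pi> x - x \<in> convex_cone hull ((\<lambda>i. d i \<alpha>) ` {i. \<pi> x \<bullet> n i = 0})" for x
      using \<pi>(2,3)[of x] active_eq[OF \<pi>(1)[of x]]
      by (cases "x \<in> polycone n") (auto simp: refl_cone_def convex_cone_hull_contains_0)
  qed
  show ?thesis
  proof (intro conjI allI impI)
    fix Z' D' assume "joint_process M F W n d a b \<alpha> Z' D'"
    then show "markov_property M F (state_space n) (\<lambda>t \<omega>. (Z' t \<omega>, D' t \<omega>))"
      by (intro joint_solution_markov_property joint_process_joint_solution) auto
  next
    show "feller_continuous (state_space n)
        (transition M (state_space n) (\<lambda>(x, y) t \<omega>. (Z x t \<omega>, D (x, y) t \<omega>)))"
    proof (rule joint_solution_feller_continuous)
      fix x y assume "(x, y) \<in> state_space n"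
      then have "joint_process M F W n d a b \<alpha> (Z x) (D (x, y)) \<and>
           (AE \<omega> in M. Z x 0 \<omega> = x) \<and> (AE \<omega> in M. D (x, y) 0 \<omega> = y)"
        using assms(10) by blast
      then show "joint_solution (Z x) (D (x, y)) \<and> (AE \<omega> in M. Z x 0 \<omega> = x) \<and> (AE \<omega> in M. D (x, y) 0 \<omega> = y)"
        using joint_process_joint_solution by blast
    qed
  qed
qed

end
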